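(* Let $x_0\in\mathcal X$ and suppose assumptions (A1)--(A6) stated in the context hold. Suppose in addition that $\int_{\mathbb R^{d_x}}K^4(u)\,du<\infty$, that $\mathbb E\bigl[|F^2(z;Y)|(\log|F^2(z;Y)|)^{+}\bigr]<\infty$ for all $z\in\mathcal Z$, and that the problem $\min_{z\in\mathcal Z}\hat f_n(z,x_0)$ has a unique solution $\hat z_n(x_0)$. Then, as $n\to\infty$, $$\frac{\hat f_n(\hat z_n(x_0),x_0)-f^*(x_0)}{\sqrt{\hat\sigma_n^2(\hat z_n(x_0),x_0)\sum_{i=1}^nw_n^2(x_i,x_0)}}\Rightarrow N(0,1),$$ where $f^*(x_0)=f(z^*(x_0),x_0)$ and $\hat\sigma_n^2(z,x_0):=\sum_{i=1}^nw_n(x_i,x_0)\bigl(F(z;y_i)-\hat f_n(z,x_0)\bigr)^2$.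
   Context: Setting. $(X,Y)$ is a random vector with $X$ and $Y$ having continuous distributions on supports $\mathcal X\subseteq\mathbb R^{d_x}$ and $\mathcal Y\subseteq\mathbb R^{d_y}$. $F(z;y)$ is a real-valued cost function of the decision $z\in\mathcal Z\subseteq\mathbb R^{d_z}$ and of $y\in\mathcal Y$. The conditional expected cost is $f(z,x):=\mathbb E[F(z;Y)\mid X=x]$. The data $(x_i,y_i)$, $i=1,\dots,n$, are i.i.d. observations of $(X,Y)$. With a kernel $K$ and bandwidth $h_n>0$, define $$w_n(x_i,x_0):=\frac{K((x_i-x_0)/h_n)}{\sum_{j=1}^nK((x_j-x_0)/h_n)},\qquad \hat f_n(z,x_0):=\sum_{i=1}^nw_n(x_i,x_0)F(z;y_i).$$ $a^{+}:=\max(a,0)$. Assumptions. (A1) Regularity. (i) There is $C_F>0$ with $|F(z;y)-F(z';y)|\le C_F\|z-z'\|$ for all $y\in\mathcal Y$, $z,z'\in\mathcal Z$. (ii) $\mathcal Z$ is a nonempty compact subset of $\mathbb R^{d_z}$. (A2) Smoothness. For any $x_0\in\mathcal X$ let $\mathcal V(x_0)$ be an open neighborhood of $x_0$. (i) For all $z\in\mathcal Z$, $f(z,x)$ is twice continuously differentiable in $x\in\mathcal X$; for any $x_0\in\mathcal X$ there is $C_f>0$ with $\sup_{z\in\mathcal Z}|f(z,x)|\le C_f$, $\sup_{z\in\mathcal Z}\|\nabla_xf(z,x)\|\le C_f$, $\sup_{z\in\mathcal Z}\|\nabla_x^2f(z,x)\|\le C_f$ for all $x\in\mathcal V(x_0)$.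 (ii) $X$ has a density $p(x)$ that is twice continuously differentiable and bounded away from zero; for any $x_0\in\mathcal X$ there is $C_p>0$ with $|p(x)|\le C_p$, $\|\nabla_xp(x)\|\le C_p$, $\|\nabla_x^2p(x)\|\le C_p$ for all $x\in\mathcal V(x_0)$. (iii) For all $z,z'\in\mathcal Z$, $\nu(z,z',x):=\mathbb E[F(z;Y)F(z';Y)\mid X=x]$ is continuously differentiable in $x\in\mathcal X$; for any $x_0\in\mathcal X$ there is $C_\nu>0$ with $\sup_{z,z'\in\mathcal Z}|\nu(z,z',x)|\le C_\nu$ and $\sup_{z,z'\in\mathcal Z}\|\nabla_x\nu(z,z',x)\|\le C_\nu$ for all $x\in\mathcal V(x_0)$. (A3) Envelope. There is $M:\mathcal Y\to\mathbb R_+$ such that (i) $\sup_{z\in\mathcal Z}|F(z;y)|\le M(y)<\infty$ for almost every $y\in\mathcal Y$, and (ii) $\mathbb E[M^{2+\gamma}(Y)\mid X=x]\le C_M$ for all $x\in\mathcal V(x_0)$ and some $\gamma>0$, where $C_M>0$ is a constant. (A4) Kernel. $K:\mathbb R^{d_x}\to\mathbb R_+$ satisfies: (i) $K$ is spherically symmetric, $\int uK(u)\,du=0$ and $\int uu^{\intercal}K(u)\,du=\Upsilon(K)I_{d_x}$ for some constant $0<\Upsilon(K)<\infty$; (ii) $\sup_u|K(u)|<\infty$; (iii) $\|u\|^{d_x}K(u)\to0$ as $\|u\|\to\infty$; (iv) $\int|K(u)|^{2+\gamma}\,du<\infty$ for some $\gamma>0$. (A5) Bandwidth. $h_n=h_0n^{-\delta}$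 for all $n\ge1$, with constants $h_0>0$ and $\delta\in(1/(d_x+4),1/d_x)$. (A6) Uniqueness. The problem $\min_{z\in\mathcal Z}f(z,x_0)$ has a unique optimal solution $z^*(x_0)$. $\|\cdot\|$ is the Euclidean norm for vectors and the spectral norm for matrices.
   Formalization: Added: Var(F(z*;Y)|X=x0)>0 (else 0/0 can occur); V(x)⊆𝒳, so 𝒳 is open (boundary bias); and either |f(z,x)-f(z,x0)|p(x) is bounded over z∈𝒵, x∈𝒳, or ‖u‖^(d_x+2)K(u) is bounded (else far-away bias can dominate). *)

theory Defs
  imports "HOL-Analysis.Analysis" "HOL-Probability.Probability"
begin

section \<open>First and second derivatives of real-valued functions\<close>

definition gradient :: "(real^'n \<Rightarrow> real) \<Rightarrow> real^'n \<Rightarrow> real^'n" where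
  "gradient g x = (\<chi> i. frechet_derivative g (at x) (axis i 1))"

definition hessian :: "(real^'n \<Rightarrow> real) \<Rightarrow> real^'n \<Rightarrow> real^'n^'n" where
  "hessian g x = jacobian (gradient g) (at x)"

definition spectral_norm :: "real^'n^'m \<Rightarrow> real" where
  "spectral_norm A = onorm ((*v) A)"

text \<open>These are only used on open sets \<open>S\<close>.\<close>

definition C1_on :: "(real^'n \<Rightarrow> real) \<Rightarrow> (real^'n) set \<Rightarrow> bool" where
  "C1_on g S \<longleftrightarrow> (\<forall>x\<in>S. g differentiable (at x)) \<and> continuous_on S (gradient g)"

definition C2_on :: "(real^'n \<Rightarrow> real) \<Rightarrow> (real^'n) set \<Rightarrow> bool" where
  "C2_on g S \<longleftrightarrow>
     (\<forall>x\<in>S. g differentiable (at x)) \<and>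
     (\<forall>x\<in>S. gradient g differentiable (at x)) \<and>
     continuous_on S (hessian g)"


section \<open>The population model\<close>

text \<open>Only what is used of ``a continuous distribution on the support \<open>S\<close>'' is required: no
  point masses, and concentration on \<open>S\<close>.  A law with a Lebesgue density qualifies.\<close>

definition continuous_rv_on :: "'w measure \<Rightarrow> ('w \<Rightarrow> real^'n) \<Rightarrow> (real^'n) set \<Rightarrow> bool" where
  "continuous_rv_on M W S \<longleftrightarrow>
     W \<in> borel_measurable M \<and> S \<in> sets borel \<and> (AE \<omega> in M. W \<omega> \<in> S) \<and>
     (\<forall>w. measure (distr M borel W) {w} = 0)"

abbreviation sigma_gen :: "'w measure \<Rightarrow> ('w \<Rightarrow> real^'n) \<Rightarrow> 'w measure" where
  "sigma_gen M X \<equiv> vimage_algebra (space M) X borel"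

text \<open>\<open>g\<close> is a version of \<open>x \<mapsto> E[W | X = x]\<close>.\<close>

definition cond_mean :: "'w measure \<Rightarrow> ('w \<Rightarrow> real^'n) \<Rightarrow> ('w \<Rightarrow> real) \<Rightarrow> (real^'n \<Rightarrow> real) \<Rightarrow> bool" where
  "cond_mean M X W g \<longleftrightarrow>
     g \<in> borel_measurable borel \<and> integrable M W \<and>
     (AE \<omega> in M. real_cond_exp M (sigma_gen M X) W \<omega> = g (X \<omega>))"

definition iid_sample ::
  "'w measure \<Rightarrow> (nat \<Rightarrow> 'w \<Rightarrow> real^'dx) \<Rightarrow> (nat \<Rightarrow> 'w \<Rightarrow> real^'dy) \<Rightarrow>
   ('w \<Rightarrow> real^'dx) \<Rightarrow> ('w \<Rightarrow> real^'dy) \<Rightarrow> bool" where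
  "iid_sample M xs ys X Y \<longleftrightarrow>
     prob_space.indep_vars M (\<lambda>_. borel) (\<lambda>i \<omega>. (xs i \<omega>, ys i \<omega>)) {1..} \<and>
     (\<forall>i\<ge>1. distr M borel (\<lambda>\<omega>. (xs i \<omega>, ys i \<omega>)) = distr M borel (\<lambda>\<omega>. (X \<omega>, Y \<omega>)))"

definition unique_minimizer :: "'a set \<Rightarrow> ('a \<Rightarrow> real) \<Rightarrow> 'a \<Rightarrow> bool" where
  "unique_minimizer Z g z \<longleftrightarrow>
     is_arg_min g (\<lambda>z. z \<in> Z) z \<and> (\<forall>z'. is_arg_min g (\<lambda>z. z \<in> Z) z' \<longrightarrow> z' = z)"


section \<open>Kernel estimators\<close>

text \<open>If all kernel values vanish, then the weights are \<open>0\<close>, since \<open>0 / 0 = 0\<close>.\<close>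

definition nw_weight ::
  "(real^'dx \<Rightarrow> real) \<Rightarrow> (nat \<Rightarrow> real) \<Rightarrow> (nat \<Rightarrow> 'w \<Rightarrow> real^'dx) \<Rightarrow> real^'dx \<Rightarrow>
   nat \<Rightarrow> 'w \<Rightarrow> nat \<Rightarrow> real" where
  "nw_weight K h xs x0 n \<omega> i =
     K ((1 / h n) *\<^sub>R (xs i \<omega> - x0)) / (\<Sum>j=1..n. K ((1 / h n) *\<^sub>R (xs j \<omega> - x0)))"

definition cost_hat ::
  "(real^'dx \<Rightarrow> real) \<Rightarrow> (nat \<Rightarrow> real) \<Rightarrow> (nat \<Rightarrow> 'w \<Rightarrow> real^'dx) \<Rightarrow> (nat \<Rightarrow> 'w \<Rightarrow> real^'dy) \<Rightarrow>
   (real^'dz \<Rightarrow> real^'dy \<Rightarrow> real) \<Rightarrow> real^'dx \<Rightarrow> nat \<Rightarrow> 'w \<Rightarrow> real^'dz \<Rightarrow> real" where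
  "cost_hat K h xs ys F x0 n \<omega> z = (\<Sum>i=1..n. nw_weight K h xs x0 n \<omega> i * F z (ys i \<omega>))"

definition variance_hat ::
  "(real^'dx \<Rightarrow> real) \<Rightarrow> (nat \<Rightarrow> real) \<Rightarrow> (nat \<Rightarrow> 'w \<Rightarrow> real^'dx) \<Rightarrow> (nat \<Rightarrow> 'w \<Rightarrow> real^'dy) \<Rightarrow>
   (real^'dz \<Rightarrow> real^'dy \<Rightarrow> real) \<Rightarrow> real^'dx \<Rightarrow> nat \<Rightarrow> 'w \<Rightarrow> real^'dz \<Rightarrow> real" where
  "variance_hat K h xs ys F x0 n \<omega> z =
     (\<Sum>i=1..n. nw_weight K h xs x0 n \<omega> i * (F z (ys i \<omega>) - cost_hat K h xs ys F x0 n \<omega> z)\<^sup>2)"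


section \<open>Assumptions\<close>

definition regular_cost ::
  "(real^'dz) set \<Rightarrow> (real^'dy) set \<Rightarrow> (real^'dz \<Rightarrow> real^'dy \<Rightarrow> real) \<Rightarrow> bool" where
  "regular_cost \<Z> \<Y> F \<longleftrightarrow>
     (\<exists>C>0. \<forall>y\<in>\<Y>. \<forall>z\<in>\<Z>. \<forall>z'\<in>\<Z>. \<bar>F z y - F z' y\<bar> \<le> C * norm (z - z')) \<and>
     compact \<Z> \<and> \<Z> \<noteq> {}"

text \<open>The bounds on the derivatives over \<open>V x\<close> presuppose \<open>V x \<subseteq> \<X>\<close>, so that \<open>\<X>\<close> is open.\<close>

definition neighborhoods :: "(real^'dx) set \<Rightarrow> (real^'dx \<Rightarrow> (real^'dx) set) \<Rightarrow> bool" where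
  "neighborhoods \<X> V \<longleftrightarrow> (\<forall>x\<in>\<X>. open (V x) \<and> x \<in> V x \<and> V x \<subseteq> \<X>)"

definition smooth_cond_cost ::
  "(real^'dx) set \<Rightarrow> (real^'dx \<Rightarrow> (real^'dx) set) \<Rightarrow> (real^'dz) set \<Rightarrow>
   (real^'dz \<Rightarrow> real^'dx \<Rightarrow> real) \<Rightarrow> bool" where
  "smooth_cond_cost \<X> V \<Z> f \<longleftrightarrow>
     (\<forall>z\<in>\<Z>. C2_on (f z) \<X>) \<and>
     (\<forall>x0\<in>\<X>. \<exists>C>0. \<forall>x\<in>V x0. \<forall>z\<in>\<Z>.
        \<bar>f z x\<bar> \<le> C \<and> norm (gradient (f z) x) \<le> C \<and> spectral_norm (hessian (f z) x) \<le> C)"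

definition smooth_density ::
  "'w measure \<Rightarrow> ('w \<Rightarrow> real^'dx) \<Rightarrow> (real^'dx) set \<Rightarrow> (real^'dx \<Rightarrow> (real^'dx) set) \<Rightarrow>
   (real^'dx \<Rightarrow> real) \<Rightarrow> bool" where
  "smooth_density M X \<X> V p \<longleftrightarrow>
     (\<forall>x. 0 \<le> p x) \<and> distributed M lborel X (\<lambda>x. ennreal (p x)) \<and>
     C2_on p \<X> \<and> (\<exists>c>0. \<forall>x\<in>\<X>. c \<le> p x) \<and>
     (\<forall>x0\<in>\<X>. \<exists>C>0. \<forall>x\<in>V x0.
        \<bar>p x\<bar> \<le> C \<and> norm (gradient p x) \<le> C \<and> spectral_norm (hessian p x) \<le> C)"

definition smooth_cond_product ::
  "(real^'dx) set \<Rightarrow> (real^'dx \<Rightarrow> (real^'dx) set) \<Rightarrow> (real^'dz) set \<Rightarrow>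
   (real^'dz \<Rightarrow> real^'dz \<Rightarrow> real^'dx \<Rightarrow> real) \<Rightarrow> bool" where
  "smooth_cond_product \<X> V \<Z> \<nu> \<longleftrightarrow>
     (\<forall>z\<in>\<Z>. \<forall>z'\<in>\<Z>. C1_on (\<nu> z z') \<X>) \<and>
     (\<forall>x0\<in>\<X>. \<exists>C>0. \<forall>x\<in>V x0. \<forall>z\<in>\<Z>. \<forall>z'\<in>\<Z>.
        \<bar>\<nu> z z' x\<bar> \<le> C \<and> norm (gradient (\<nu> z z') x) \<le> C)"

text \<open>A version of \<open>E[Menv(Y)^(2+\<gamma>) | X = x]\<close> is bounded on \<open>U\<close>.  The nonnegative conditional
  expectation is used because the moment need not be finite outside \<open>U\<close>.\<close>

definition envelope ::
  "'w measure \<Rightarrow> ('w \<Rightarrow> real^'dx) \<Rightarrow> ('w \<Rightarrow> real^'dy) \<Rightarrow> (real^'dy) set \<Rightarrow> (real^'dz) set \<Rightarrow>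
   (real^'dz \<Rightarrow> real^'dy \<Rightarrow> real) \<Rightarrow> (real^'dx) set \<Rightarrow> (real^'dy \<Rightarrow> real) \<Rightarrow> bool" where
  "envelope M X Y \<Y> \<Z> F U Menv \<longleftrightarrow>
     Menv \<in> borel_measurable borel \<and> (\<forall>y\<in>\<Y>. 0 \<le> Menv y) \<and>
     (AE y in distr M borel Y. y \<in> \<Y> \<longrightarrow> (\<forall>z\<in>\<Z>. \<bar>F z y\<bar> \<le> Menv y)) \<and>
     (\<exists>\<gamma>>0. \<exists>C>0. AE \<omega> in M. X \<omega> \<in> U \<longrightarrow>
        nn_cond_exp M (sigma_gen M X) (\<lambda>\<omega>. ennreal (Menv (Y \<omega>) powr (2 + \<gamma>))) \<omega> \<le> ennreal C)"

definition outer :: "real^'n \<Rightarrow> real^'n^'n" where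
  "outer u = (\<chi> i j. u $ i * u $ j)"

definition regular_kernel :: "(real^'dx \<Rightarrow> real) \<Rightarrow> bool" where
  "regular_kernel K \<longleftrightarrow>
     K \<in> borel_measurable borel \<and> (\<forall>u. 0 \<le> K u) \<and>
     (\<forall>u v. norm u = norm v \<longrightarrow> K u = K v) \<and>
     integrable lborel (\<lambda>u. K u *\<^sub>R u) \<and> (LINT u|lborel. K u *\<^sub>R u) = 0 \<and>
     integrable lborel (\<lambda>u. K u *\<^sub>R outer u) \<and>
     (\<exists>\<Upsilon>>0. (LINT u|lborel. K u *\<^sub>R outer u) = \<Upsilon> *\<^sub>R mat 1) \<and>
     (\<exists>B. \<forall>u. \<bar>K u\<bar> \<le> B) \<and>
     ((\<lambda>u. norm u ^ CARD('dx) * K u) \<longlongrightarrow> 0) at_infinity \<and>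
     (\<exists>\<gamma>>0. integrable lborel (\<lambda>u. \<bar>K u\<bar> powr (2 + \<gamma>)))"

definition bandwidth :: "nat \<Rightarrow> (nat \<Rightarrow> real) \<Rightarrow> bool" where
  "bandwidth d h \<longleftrightarrow>
     (\<exists>h0>0. \<exists>\<delta>. 1 / (real d + 4) < \<delta> \<and> \<delta> < 1 / real d \<and>
        (\<forall>n\<ge>1. h n = h0 * real n powr (- \<delta>)))"

text \<open>The remaining assumptions do not control the smoothing bias that comes from observations far
  from \<open>x0\<close>: \<open>p\<close> and \<open>f z\<close> are bounded only near \<open>x0\<close>, and \<open>K\<close> may have high thin shells at
  radii tending to infinity, so that this bias can dominate the standard error.  Either of the
  following rules this out.  The first alternative holds if \<open>p\<close> and \<open>f\<close> are bounded on \<open>\<X>\<close>; the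
  second one holds for compactly supported, Gaussian and, in the presence of second moments, for
  all radially nonincreasing kernels.\<close>

definition tail_control ::
  "(real^'dx \<Rightarrow> real) \<Rightarrow> (real^'dx) set \<Rightarrow> (real^'dz) set \<Rightarrow> (real^'dx \<Rightarrow> real) \<Rightarrow>
   (real^'dz \<Rightarrow> real^'dx \<Rightarrow> real) \<Rightarrow> real^'dx \<Rightarrow> bool" where
  "tail_control K \<X> \<Z> p f x0 \<longleftrightarrow>
     (\<exists>B. \<forall>z\<in>\<Z>. \<forall>x\<in>\<X>. \<bar>f z x - f z x0\<bar> * p x \<le> B) \<or>
     (\<exists>B. \<forall>u. norm u ^ (CARD('dx) + 2) * K u \<le> B)"

end

theory Submission
  imports Defs
begin

text \<open>
  Write \<open>U n z\<close> for the normalized error \<open>S n * (fhat n z - f z x0) / sqrt (n * h n ^ d)\<close>, where \<open>S n\<close> is the sum of the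
  kernel values. As \<open>zhat\<close> minimizes \<open>fhat\<close> and \<open>zstar\<close> minimizes \<open>f\<close> at \<open>x0\<close>, the normalized error of the optimal
  value lies between \<open>U n zhat\<close> and \<open>U n zstar\<close>. The increments of \<open>U n\<close> are sums of independent terms that are
  bounded by a multiple of the distance of the decisions, hence have sub-exponential tails, and chaining makes
  \<open>U n\<close> asymptotically equicontinuous. Together with the consistency of \<open>zhat\<close> this reduces the
  statement to the single decision \<open>zstar\<close>, where the Lindeberg theorem for triangular arrays applies. The
  smoothing bias is \<open>O((h n)^2)\<close> uniformly in the decision, since the kernel is even, so it vanishes after
  normalization because \<open>n * h n ^ (d + 4)\<close> tends to \<open>0\<close>.
\<close>

section \<open>Convergence in probability\<close>

text \<open>Uniformity over \<open>\<Z>\<close> has to come from the process \<open>U n\<close>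
  itself. Multiplying the error by \<open>S n\<close> removes the random denominator of the weights,
  and in the studentized ratio \<open>S n\<close> cancels. What remains below the fraction bar has
  as its square the estimated variance times the normalized sum of squared kernel values; its limit
  is exactly the limit variance of \<open>U n zstar\<close>. Two cuts recur. Far from
  \<open>x0\<close> only integrability is known; there the decay of \<open>norm u ^ d * K u\<close>
  compensates the factor \<open>1 / h n ^ d\<close>. Near \<open>x0\<close> the conditional moment
  of order \<open>2 + \<gamma>\<close> of the envelope yields uniform integrability, which drives
  both the weak law and the Lindeberg condition. The bias requires a rate of order
  \<open>(h n)^2\<close> from the far region as well, and \<open>tail_control\<close> supplies
  it.\<close>

context prob_space begin

text \<open>\<open>X n\<close> tends to \<open>c\<close> in probability if and only if \<open>((\<lambda>q. X (fst q) (snd q)) \<longlongrightarrow> c) whp\<close>, so that the limit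
  theorems for filters apply to convergence in probability. Inner approximation by events makes
  measurability of the predicates unnecessary.\<close>

definition whp :: "(nat \<times> 'a) filter" where
  "whp = Abs_filter (\<lambda>P. \<forall>e>0. \<forall>\<^sub>F n in sequentially.
           \<exists>A\<in>events. 1 - e \<le> prob A \<and> (\<forall>w\<in>A. P (n, w)))"

lemma eventually_whp:
  "eventually P whp \<longleftrightarrow>
     (\<forall>e>0. \<forall>\<^sub>F n in sequentially. \<exists>A\<in>events. 1 - e \<le> prob A \<and> (\<forall>w\<in>A. P (n, w)))"
  unfolding whp_def
proof (rule eventually_Abs_filter, rule is_filter.intro)
  show "\<forall>e>0. \<forall>\<^sub>F n in sequentially. \<exists>A\<in>events. 1 - e \<le> prob A \<and> (\<forall>w\<in>A. True)"
    by (auto intro!: always_eventually bexI[of _ "space M"] simp: prob_space)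
next
  fix P Q :: "nat \<times> 'a \<Rightarrow> bool"
  assume P: "\<forall>e>0. \<forall>\<^sub>F n in sequentially. \<exists>A\<in>events. 1 - e \<le> prob A \<and> (\<forall>w\<in>A. P (n, w))"
    and Q: "\<forall>e>0. \<forall>\<^sub>F n in sequentially. \<exists>A\<in>events. 1 - e \<le> prob A \<and> (\<forall>w\<in>A. Q (n, w))"
  show "\<forall>e>0. \<forall>\<^sub>F n in sequentially. \<exists>A\<in>events. 1 - e \<le> prob A \<and> (\<forall>w\<in>A. P (n, w) \<and> Q (n, w))"
  proof (intro allI impI)
    fix e :: real assume "0 < e"
    then have "0 < e / 2" by simp
    from P[rule_format, OF this] Q[rule_format, OF this]
    show "\<forall>\<^sub>F n in sequentially. \<exists>A\<in>events. 1 - e \<le> prob A \<and> (\<forall>w\<in>A. P (n, w) \<and> Q (n, w))"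
    proof eventually_elim
      case (elim n)
      then obtain A B where A: "A \<in> events" "1 - e/2 \<le> prob A" "\<forall>w\<in>A. P (n, w)"
        and B: "B \<in> events" "1 - e/2 \<le> prob B" "\<forall>w\<in>B. Q (n, w)" by blast
      have "prob (A \<union> B) + prob (A \<inter> B) = prob A + prob B"
        using A(1) B(1) by (simp add: finite_measure_Union' finite_measure_Diff' Int_commute)
      moreover have "prob (A \<union> B) \<le> 1" by simp
      ultimately have "1 - e \<le> prob (A \<inter> B)" using A(2) B(2) by linarith
      then show ?case using A B by (intro bexI[of _ "A \<inter> B"]) auto
    qed
  qed
next
  fix P Q :: "nat \<times> 'a \<Rightarrow> bool"
  assume imp: "\<forall>x. P x \<longrightarrow> Q x"
    and P: "\<forall>e>0. \<forall>\<^sub>F n in sequentially. \<exists>A\<in>events. 1 - e \<le> prob A \<and> (\<forall>w\<in>A. P (n, w))"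
  show "\<forall>e>0. \<forall>\<^sub>F n in sequentially. \<exists>A\<in>events. 1 - e \<le> prob A \<and> (\<forall>w\<in>A. Q (n, w))"
  proof (intro allI impI)
    fix e :: real assume "0 < e"
    with P have "\<forall>\<^sub>F n in sequentially. \<exists>A\<in>events. 1 - e \<le> prob A \<and> (\<forall>w\<in>A. P (n, w))" by blast
    then show "\<forall>\<^sub>F n in sequentially. \<exists>A\<in>events. 1 - e \<le> prob A \<and> (\<forall>w\<in>A. Q (n, w))"
      using imp by (elim eventually_mono) blast
  qed
qed

text \<open>Deterministic limits in \<open>n\<close> become limits along \<open>whp\<close>, so
  random and nonrandom terms can be combined by the same rules.\<close>

lemma filterlim_fst_whp: "filterlim fst sequentially whp"
  unfolding filterlim_iff
proof (intro allI impI)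
  fix P :: "nat \<Rightarrow> bool" assume P: "eventually P sequentially"
  show "\<forall>\<^sub>F q in whp. P (fst q)"
    unfolding eventually_whp using P
    by (auto elim!: eventually_mono intro!: bexI[of _ "space M"] simp: prob_space)
qed

lemma eventually_whp_fst:
  "eventually P sequentially \<Longrightarrow> \<forall>\<^sub>F q in whp. P (fst q)"
  using filterlim_fst_whp unfolding filterlim_iff by blast

lemma tendsto_whp_fst: "(x \<longlongrightarrow> c) sequentially \<Longrightarrow> ((\<lambda>q. x (fst q)) \<longlongrightarrow> c) whp"
  by (rule filterlim_compose[OF _ filterlim_fst_whp])

lemma eventually_whp_AE:
  assumes "\<forall>\<^sub>F n in sequentially. AE w in M. P n w"
  shows "\<forall>\<^sub>F q in whp. P (fst q) (snd q)"
  unfolding eventually_whp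
proof (intro allI impI)
  fix e :: real assume "0 < e"
  show "\<forall>\<^sub>F n in sequentially. \<exists>A\<in>events. 1 - e \<le> prob A \<and> (\<forall>w\<in>A. P (fst (n, w)) (snd (n, w)))"
    using assms
  proof eventually_elim
    case (elim n)
    then obtain N where N: "{w \<in> space M. \<not> P n w} \<subseteq> N" "N \<in> null_sets M"
      by (auto simp: eventually_ae_filter)
    have "prob (space M - N) = 1"
      using N(2) by (subst prob_compl) (auto simp: measure_eq_0_null_sets)
    then show ?case
      using N \<open>0 < e\<close> by (intro bexI[of _ "space M - N"]) auto
  qed
qed

lemma tendsto_whp_markov:
  fixes X :: "nat \<Rightarrow> 'a \<Rightarrow> real"
  assumes int: "\<forall>\<^sub>F n in sequentially. integrable M (X n)"
    and lim: "(\<lambda>n. expectation (\<lambda>w. \<bar>X n w\<bar>)) \<longlonglongrightarrow> 0"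
  shows "((\<lambda>q. X (fst q) (snd q)) \<longlongrightarrow> 0) whp"
proof (rule tendstoI)
  fix r :: real assume r: "0 < r"
  show "\<forall>\<^sub>F q in whp. dist (X (fst q) (snd q)) 0 < r"
    unfolding eventually_whp
  proof (intro allI impI)
    fix e :: real assume e: "0 < e"
    have "\<forall>\<^sub>F n in sequentially. expectation (\<lambda>w. \<bar>X n w\<bar>) < r * e"
      using lim r e by (intro order_tendstoD) auto
    then show "\<forall>\<^sub>F n in sequentially. \<exists>A\<in>events. 1 - e \<le> prob A \<and>
        (\<forall>w\<in>A. dist (X (fst (n, w)) (snd (n, w))) 0 < r)"
      using int
    proof eventually_elim
      case (elim n)
      have [measurable]: "X n \<in> borel_measurable M" using elim(2) by auto
      let ?B = "{w\<in>space M. r \<le> \<bar>X n w\<bar>}"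
      have "prob ?B \<le> expectation (\<lambda>w. \<bar>X n w\<bar>) / r"
        using elim(2) r by (intro integral_Markov_inequality_measure[where A="{}"]) auto
      also have "\<dots> < e" using elim(1) r by (simp add: field_simps)
      finally have "prob ?B < e" .
      then have "1 - e \<le> prob (space M - ?B)" by (subst prob_compl) auto
      then show ?case by (intro bexI[of _ "space M - ?B"]) (auto simp: not_le)
    qed
  qed
qed

text \<open>A tight sequence times a vanishing one vanishes; bounded first absolute moments give
  tightness through Markov's inequality.\<close>

lemma tendsto_whp_tight_mult:
  fixes U X :: "nat \<Rightarrow> 'a \<Rightarrow> real"
  assumes int: "\<forall>\<^sub>F n in sequentially. integrable M (U n)"
    and bd: "\<forall>\<^sub>F n in sequentially. expectation (\<lambda>w. \<bar>U n w\<bar>) \<le> B"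
    and X: "((\<lambda>q. X (fst q) (snd q)) \<longlongrightarrow> 0) whp"
  shows "((\<lambda>q. U (fst q) (snd q) * X (fst q) (snd q)) \<longlongrightarrow> 0) whp"
proof (rule tendstoI)
  fix r :: real assume r: "0 < r"
  show "\<forall>\<^sub>F q in whp. dist (U (fst q) (snd q) * X (fst q) (snd q)) 0 < r"
    unfolding eventually_whp
  proof (intro allI impI)
    fix e :: real assume e: "0 < e"
    define b where "b = \<bar>B\<bar> + 1"
    have b: "0 < b" "B \<le> b" by (auto simp: b_def)
    \<comment> \<open>The level at which Markov's inequality gives \<open>b / L = e / 2\<close>;
      \<open>b\<close> dominates \<open>B\<close> and is positive whatever the sign of
      \<open>B\<close>.\<close>
    define L where "L = 2 * b / e"
    have L: "0 < L" using e b by (simp add: L_def)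
    have "\<forall>\<^sub>F q in whp. dist (X (fst q) (snd q)) 0 < r / L"
      using X L r by (intro tendstoD) auto
    then have "\<forall>\<^sub>F n in sequentially. \<exists>A\<in>events. 1 - e/2 \<le> prob A \<and> (\<forall>w\<in>A. \<bar>X n w\<bar> < r / L)"
      using e unfolding eventually_whp by (auto dest!: spec[of _ "e/2"])
    then show "\<forall>\<^sub>F n in sequentially. \<exists>A\<in>events. 1 - e \<le> prob A \<and>
        (\<forall>w\<in>A. dist (U (fst (n, w)) (snd (n, w)) * X (fst (n, w)) (snd (n, w))) 0 < r)"
      using int bd
    proof eventually_elim
      case (elim n)
      obtain A where A: "A \<in> events" "1 - e/2 \<le> prob A" "\<forall>w\<in>A. \<bar>X n w\<bar> < r / L"
        using elim(1) by blast
      have [measurable]: "U n \<in> borel_measurable M" using elim(2) by auto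
      let ?B = "{w\<in>space M. L \<le> \<bar>U n w\<bar>}"
      have "prob ?B \<le> expectation (\<lambda>w. \<bar>U n w\<bar>) / L"
        using elim(2) L by (intro integral_Markov_inequality_measure[where A="{}"]) auto
      also have "\<dots> \<le> b / L" using elim(3) L b by (intro divide_right_mono) auto
      also have "\<dots> = e / 2" using e b by (simp add: L_def)
      finally have "prob ?B \<le> e / 2" .
      moreover have "prob A \<le> prob (A - ?B) + prob ?B"
        using A(1) by (intro order_trans[OF _ measure_Un_le] finite_measure_mono) auto
      ultimately have "1 - e \<le> prob (A - ?B)" using A(2) by linarith
      moreover have "\<bar>U n w\<bar> * \<bar>X n w\<bar> < r" if "w \<in> A - ?B" for w
      proof -
        have u: "\<bar>U n w\<bar> < L" using that sets.sets_into_space[OF A(1)] by auto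
        have x: "\<bar>X n w\<bar> < r / L" using that A(3) by auto
        have "\<bar>U n w\<bar> * \<bar>X n w\<bar> \<le> L * \<bar>X n w\<bar>" using u by (intro mult_right_mono) auto
        also have "\<dots> < L * (r / L)" using x L by (intro mult_strict_left_mono)
        finally show ?thesis using L by simp
      qed
      ultimately show ?case using A(1)
        by (intro bexI[of _ "A - ?B"]) (auto simp: abs_mult)
    qed
  qed
qed

text \<open>Slutsky's rule for characteristic functions: \<open>iexp (t * x)\<close> is bounded by 1
  and \<open>|t|\<close>-Lipschitz in \<open>x\<close>, so the two values differ by at most
  \<open>|t| * e\<close> on the event of closeness, plus twice the probability of its
  complement.\<close>

lemma slutsky_char:
  fixes T U :: "nat \<Rightarrow> 'a \<Rightarrow> real"
  assumes [measurable]: "\<And>n. T n \<in> borel_measurable M" "\<And>n. U n \<in> borel_measurable M"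
    and diff: "((\<lambda>q. T (fst q) (snd q) - U (fst q) (snd q)) \<longlongrightarrow> 0) whp"
    and lim: "(\<lambda>n. char (distr M borel (U n)) t) \<longlonglongrightarrow> c"
  shows "(\<lambda>n. char (distr M borel (T n)) t) \<longlonglongrightarrow> c"
proof -
  have "(\<lambda>n. char (distr M borel (T n)) t - char (distr M borel (U n)) t) \<longlonglongrightarrow> 0"
  proof (rule tendstoI)
    fix r :: real assume r: "0 < r"
    \<comment> \<open>The final estimate is \<open>(|t| + 2) * e\<close>; the larger denominator
      makes it strictly less than \<open>r\<close>.\<close>
    define e where "e = r / (\<bar>t\<bar> + 3)"
    have e: "0 < e" using r by (auto simp: e_def intro!: divide_pos_pos)
    have "\<forall>\<^sub>F q in whp. dist (T (fst q) (snd q) - U (fst q) (snd q)) 0 < e"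
      using diff e by (intro tendstoD) auto
    then have "\<forall>\<^sub>F n in sequentially. \<exists>A\<in>events. 1 - e \<le> prob A \<and> (\<forall>w\<in>A. \<bar>T n w - U n w\<bar> < e)"
      using e unfolding eventually_whp by (auto simp: dist_real_def)
    then show "\<forall>\<^sub>F n in sequentially. dist (char (distr M borel (T n)) t - char (distr M borel (U n)) t) 0 < r"
    proof eventually_elim
      case (elim n)
      then obtain A where A[measurable]: "A \<in> events" and A2: "1 - e \<le> prob A" "\<forall>w\<in>A. \<bar>T n w - U n w\<bar> < e"
        by blast
      have i: "integrable M (\<lambda>w. iexp (t * T n w))" "integrable M (\<lambda>w. iexp (t * U n w))"
        by (auto intro!: integrable_const_bound[where B=1])
      have ind: "integrable M (indicator (space M - A) :: 'a \<Rightarrow> real)"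
        by (intro integrable_real_indicator) (auto simp: less_top[symmetric])
      have "char (distr M borel (T n)) t - char (distr M borel (U n)) t =
          (CLINT w|M. iexp (t * T n w) - iexp (t * U n w))"
        unfolding char_def using i by (simp add: integral_distr)
      also have "norm \<dots> \<le> expectation (\<lambda>w. norm (iexp (t * T n w) - iexp (t * U n w)))"
        by (rule integral_norm_bound)
      also have "\<dots> \<le> expectation (\<lambda>w. \<bar>t\<bar> * e + 2 * indicator (space M - A) w)"
      proof (rule integral_mono)
        fix w assume w: "w \<in> space M"
        show "norm (iexp (t * T n w) - iexp (t * U n w)) \<le> \<bar>t\<bar> * e + 2 * indicator (space M - A) w"
        proof (cases "w \<in> A")
          case True
          have eq: "iexp (t * T n w) - iexp (t * U n w) = iexp (t * U n w) * (iexp (t * (T n w - U n w)) - 1)"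
            by (simp add: exp_diff right_diff_distrib)
          have "norm (iexp (t * T n w) - iexp (t * U n w)) = norm (iexp (t * (T n w - U n w)) - 1)"
            by (subst eq, subst norm_mult) simp
          also have "\<dots> \<le> \<bar>t * (T n w - U n w)\<bar>"
            using iexp_approx1[of "t * (T n w - U n w)" 0] by simp
          also have "\<dots> \<le> \<bar>t\<bar> * e" unfolding abs_mult using A2(2) True by (intro mult_left_mono) (auto intro: less_imp_le)
          finally show ?thesis using True by simp
        next
          case False
          have "norm (iexp (t * T n w) - iexp (t * U n w)) \<le> 1 + 1"
            by (intro order_trans[OF norm_triangle_ineq4]) simp
          then show ?thesis using False w e by (simp add: add_nonneg_nonneg add_increasing)
        qed
      next
        show "integrable M (\<lambda>w. \<bar>t\<bar> * e + 2 * indicator (space M - A) w)"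
          using ind by (intro Bochner_Integration.integrable_add integrable_mult_right integrable_const) auto
      qed (use i in \<open>auto intro!: integrable_norm\<close>)
      also have "\<dots> = \<bar>t\<bar> * e + 2 * prob (space M - A)"
        using ind by (subst Bochner_Integration.integral_add) (auto simp: prob_space)
      also have "\<dots> \<le> \<bar>t\<bar> * e + 2 * e" using A2(1) by (subst prob_compl) auto
      also have "\<dots> < r"
      proof -
        have "(\<bar>t\<bar> + 2) * e < (\<bar>t\<bar> + 3) * e" using e by (intro mult_strict_right_mono) auto
        also have "\<dots> = r" by (simp add: e_def add_nonneg_eq_0_iff)
        finally show ?thesis by (simp add: algebra_simps)
      qed
      finally show ?case by simp
    qed
  qed
  from tendsto_add[OF this lim] show ?thesis by simp
qed

end

section \<open>Chaining\<close>

text \<open>The unit ball is covered by finitely many, say \<open>D\<close>, balls of half its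
  radius. Rescaling this one covering refines a net at scale \<open>2^-k\<close> to one at half the
  scale at the price of a factor \<open>D\<close>, so the cardinality grows only
  geometrically.\<close>

lemma dyadic_nets:
  fixes Z :: "'b::euclidean_space set"
  assumes "bounded Z"
  obtains R :: real and D :: nat and T :: "nat \<Rightarrow> 'b set"
  where "0 < R" "1 \<le> D" "\<And>k. T k \<subseteq> Z" "\<And>k. finite (T k)" "\<And>k. card (T k) \<le> D ^ k"
    "\<And>k z. z \<in> Z \<Longrightarrow> \<exists>t\<in>T k. dist z t \<le> R * (1/2) ^ k"
proof -
  obtain r where r: "0 < r" "\<And>z. z \<in> Z \<Longrightarrow> norm z \<le> r"
    using assms by (auto simp: bounded_pos)
  have "compact (cball (0::'b) 1)" by simp
  then obtain C where C: "finite C" "cball (0::'b) 1 \<subseteq> (\<Union>x\<in>C. ball x (1/2))"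
    unfolding compact_eq_totally_bounded by (meson half_gt_zero zero_less_one)
  have "(0::'b) \<in> cball 0 1" by simp
  with C(2) have "C \<noteq> {}" by blast
  then have D1: "1 \<le> card C" using C(1) by (simp add: Suc_le_eq card_gt_0_iff)
  define S where "S = rec_nat {0::'b} (\<lambda>k S. (\<lambda>(c, u). c + (r * (1/2) ^ k) *\<^sub>R u) ` (S \<times> C))"
  have S0: "S 0 = {0}" and SS: "\<And>k. S (Suc k) = (\<lambda>(c, u). c + (r * (1/2) ^ k) *\<^sub>R u) ` (S k \<times> C)"
    by (simp_all add: S_def)
  have S: "finite (S k) \<and> card (S k) \<le> card C ^ k \<and> (\<forall>z\<in>Z. \<exists>s\<in>S k. dist z s \<le> r * (1/2) ^ k)" for k
  proof (induction k)
    case 0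
    then show ?case using r by (simp add: S0)
  next
    case (Suc k)
    have fin: "finite (S k \<times> C)" using Suc C by simp
    have "card (S (Suc k)) \<le> card (S k \<times> C)" unfolding SS by (rule card_image_le[OF fin])
    also have "\<dots> \<le> card C ^ Suc k" using Suc by (simp add: card_cartesian_product mult.commute)
    finally have 1: "card (S (Suc k)) \<le> card C ^ Suc k" .
    have 2: "\<exists>s\<in>S (Suc k). dist z s \<le> r * (1/2) ^ Suc k" if z: "z \<in> Z" for z
    proof -
      define \<rho> where "\<rho> = r * (1/2) ^ k"
      have \<rho>: "0 < \<rho>" using r by (simp add: \<rho>_def)
      obtain s where s: "s \<in> S k" "dist z s \<le> \<rho>" using Suc z unfolding \<rho>_def by blast
      have "(1 / \<rho>) *\<^sub>R (z - s) \<in> cball 0 1"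
        unfolding mem_cball_0 norm_scaleR using s(2) \<rho> by (simp add: dist_norm divide_le_eq_1)
      then have "(1 / \<rho>) *\<^sub>R (z - s) \<in> (\<Union>x\<in>C. ball x (1/2))" using C(2) by blast
      then obtain u where u: "u \<in> C" "dist u ((1 / \<rho>) *\<^sub>R (z - s)) < 1/2"
        unfolding UN_iff mem_ball by blast
      have "z - (s + \<rho> *\<^sub>R u) = \<rho> *\<^sub>R ((1 / \<rho>) *\<^sub>R (z - s) - u)"
        using \<rho> by (simp add: algebra_simps)
      then have "dist z (s + \<rho> *\<^sub>R u) = \<rho> * norm ((1 / \<rho>) *\<^sub>R (z - s) - u)"
        using \<rho> by (simp add: dist_norm)
      also have "\<dots> \<le> \<rho> * (1/2)"
        using u(2) \<rho> by (intro mult_left_mono) (auto simp: dist_norm norm_minus_commute)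
      finally have "dist z (s + \<rho> *\<^sub>R u) \<le> r * (1/2) ^ Suc k" by (simp add: \<rho>_def)
      moreover have "s + \<rho> *\<^sub>R u \<in> S (Suc k)"
        unfolding SS \<rho>_def using s(1) u(1) by force
      ultimately show ?thesis by blast
    qed
    show ?case using fin 1 2 unfolding SS by blast
  qed
  \<comment> \<open>Points of \<open>S k\<close> may lie outside \<open>Z\<close>. Each one close to
    \<open>Z\<close> is replaced by a nearby point of \<open>Z\<close>, which doubles the radius
    from \<open>r\<close> to \<open>2 * r\<close>.\<close>
  define pick where "pick k s = (SOME z. z \<in> Z \<and> dist z s \<le> r * (1/2) ^ k)" for k s
  define T where "T k = pick k ` {s \<in> S k. \<exists>z\<in>Z. dist z s \<le> r * (1/2) ^ k}" for k
  have pick: "pick k s \<in> Z \<and> dist (pick k s) s \<le> r * (1/2) ^ k"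
    if "\<exists>z\<in>Z. dist z s \<le> r * (1/2) ^ k" for k s
    unfolding pick_def by (rule someI_ex) (use that in blast)
  show ?thesis
  proof
    show "0 < 2 * r" "1 \<le> card C" using r D1 by auto
    show "T k \<subseteq> Z" for k using pick by (auto simp: T_def)
    show "finite (T k)" for k using S[of k] by (simp add: T_def)
    show "card (T k) \<le> card C ^ k" for k
    proof -
      have "card (T k) \<le> card {s \<in> S k. \<exists>z\<in>Z. dist z s \<le> r * (1/2) ^ k}"
        unfolding T_def using S[of k] by (intro card_image_le) auto
      also have "\<dots> \<le> card (S k)" using S[of k] by (intro card_mono) auto
      finally show ?thesis using S[of k] by linarith
    qed
    show "\<exists>t\<in>T k. dist z t \<le> 2 * r * (1/2) ^ k" if z: "z \<in> Z" for k z
    proof -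
      obtain s where s: "s \<in> S k" "dist z s \<le> r * (1/2) ^ k" using S[of k] z by blast
      then have "pick k s \<in> T k" using z by (auto simp: T_def)
      moreover have "dist z (pick k s) \<le> dist z s + dist (pick k s) s" by (rule dist_triangle2)
      then have "dist z (pick k s) \<le> 2 * r * (1/2) ^ k" using s(2) pick[of s k] z by fastforce
      ultimately show ?thesis by blast
    qed
  qed
qed

context prob_space begin

text \<open>The modulus \<open>\<delta>\<close> does not depend on the process \<open>W\<close>, which is what makes the lemma applicable
  along a sequence of processes.\<close>

lemma chaining:
  fixes Z :: "'b::euclidean_space set"
  assumes Z: "bounded Z" and z0: "z0 \<in> Z" and e: "0 < e" and Q: "0 \<le> Q"
  shows "\<exists>\<delta>>0. \<forall>W. (\<forall>z\<in>Z. W z \<in> borel_measurable M) \<longrightarrow>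
      (\<forall>z\<in>Z. \<forall>z'\<in>Z. \<forall>r>0. dist z z' \<le> r \<longrightarrow>
        (\<forall>s. prob {w\<in>space M. r * s < \<bar>W z w - W z' w\<bar>} \<le> Q * exp (- s))) \<longrightarrow>
      (AE w in M. continuous_on Z (\<lambda>z. W z w)) \<longrightarrow>
      (\<exists>A\<in>events. 1 - e \<le> prob A \<and>
        (\<forall>w\<in>A. \<forall>z\<in>Z. dist z z0 < \<delta> \<longrightarrow> \<bar>W z w - W z0 w :: real\<bar> \<le> e))"
proof -
  obtain R :: real and D :: nat and T :: "nat \<Rightarrow> 'b set"
    where R: "0 < R" and D: "1 \<le> D" and TZ: "\<And>k. T k \<subseteq> Z" and fT: "\<And>k. finite (T k)"
      and cT: "\<And>k. card (T k) \<le> D ^ k"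
      and T: "\<And>k z. z \<in> Z \<Longrightarrow> \<exists>t\<in>T k. dist z t \<le> R * (1/2) ^ k"
    using dyadic_nets[OF Z] by metis
  have TZ': "t \<in> Z" if "t \<in> T k" for k t using TZ that by blast
  \<comment> \<open>With this constant \<open>exp (- s k)\<close> is the power \<open>Suc k\<close>
    of \<open>1 / (2 * D^2)\<close>, which beats the number \<open>D ^ k * D ^ Suc k\<close> of
    links between levels \<open>k\<close> and \<open>Suc k\<close> and leaves a summable
    factor.\<close>
  define c where "c = ln (2 * (real D)\<^sup>2)"
  have D2: "1 \<le> (real D)\<^sup>2" using D by simp
  have c0: "0 \<le> c" unfolding c_def using D2 by (intro ln_ge_zero) simp
  \<comment> \<open>A link between the approximations of one point at levels \<open>k\<close> and
    \<open>Suc k\<close> has length at most \<open>R / 2^k + R / 2^(k+1)\<close>, hence at most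
    \<open>r k\<close>; so has the link from level \<open>k0\<close> to \<open>z0\<close>, of length
    at most twice \<open>R / 2^k0\<close>.\<close>
  define r where "r k = 2 * (R * (1/2) ^ k)" for k :: nat
  have r0: "0 < r k" for k using R by (simp add: r_def)
  define s where "s k = c * real (Suc k)" for k
  have exp_s: "exp (- s k) = 1 / (2 * (real D)\<^sup>2) ^ Suc k" for k
  proof -
    have "exp (s k) = exp c ^ Suc k" by (simp add: s_def exp_of_nat2_mult del: of_nat_Suc)
    also have "exp c = 2 * (real D)\<^sup>2" using D by (simp add: c_def)
    finally show ?thesis by (simp add: exp_minus inverse_eq_divide)
  qed
  have DDs: "real D ^ k * real D ^ Suc k * exp (- s k) \<le> (1/2) ^ k" for k
  proof -
    have "real D ^ k * real D ^ Suc k * exp (- s k) \<le> real D ^ Suc k * real D ^ Suc k * exp (- s k)"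
      using D by (intro mult_right_mono) auto
    also have "\<dots> = (1/2) ^ Suc k"
      using D by (simp add: exp_s power_mult_distrib power_divide power2_eq_square del: power_Suc)
    also have "\<dots> \<le> (1/2) ^ k" by simp
    finally show ?thesis .
  qed
  have Ds: "real D ^ k * exp (- s k) \<le> (1/2) ^ k" for k
  proof -
    have "real D ^ k * 1 * exp (- s k) \<le> real D ^ k * real D ^ Suc k * exp (- s k)"
      using D by (intro mult_right_mono mult_left_mono one_le_power) auto
    then show ?thesis using DDs[of k] by simp
  qed
  define g where "g k = r k * s k" for k
  have g0: "0 \<le> g k" for k using r0[of k] c0 by (simp add: g_def s_def)
  have sg: "summable g"
  proof -
    have "summable (\<lambda>k. 2 * R * c * (of_nat (Suc k) * (1/2::real) ^ k))"
      using geometric_deriv_sums[of "1/2::real"] by (intro summable_mult) (auto simp: sums_iff)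
    then show ?thesis by (rule summable_cong[THEN iffD1, rotated]) (auto simp: g_def r_def s_def field_simps)
  qed
  have "(\<lambda>k0. g k0 + (\<Sum>i. g (i + k0))) \<longlonglongrightarrow> 0 + 0"
    using sg by (intro tendsto_add summable_LIMSEQ_zero suminf_exist_split2)
  then have ev1: "\<forall>\<^sub>F k0 in sequentially. g k0 + (\<Sum>i. g (i + k0)) < e"
    using e by (intro order_tendstoD(2)) auto
  have "(\<lambda>k0. 3 * Q * (1/2::real) ^ k0) \<longlonglongrightarrow> 3 * Q * 0"
    by (intro tendsto_mult tendsto_const LIMSEQ_power_zero) simp
  then have ev2: "\<forall>\<^sub>F k0 in sequentially. 3 * Q * (1/2::real) ^ k0 < e"
    using e by (intro order_tendstoD(2)) auto
  \<comment> \<open>One level serves two purposes: the links from \<open>k0\<close> on move the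
    process by less than \<open>e\<close>, and the exceptional event has probability at most
    \<open>Q / 2^k0\<close> for the links to \<open>z0\<close> plus \<open>2 * Q / 2^k0\<close> for
    the series. Its choice does not involve \<open>W\<close>, hence neither does the
    modulus.\<close>
  obtain k0 where k0: "g k0 + (\<Sum>i. g (i + k0)) < e" "3 * Q * (1/2::real) ^ k0 < e"
    using eventually_happens'[OF _ eventually_conj[OF ev1 ev2]] by auto
  show ?thesis
  proof (intro exI[of _ "R * (1/2) ^ k0"] conjI allI impI)
    show "0 < R * (1/2) ^ k0" using R by simp
    fix W :: "'b \<Rightarrow> 'a \<Rightarrow> real"
    assume meas: "\<forall>z\<in>Z. W z \<in> borel_measurable M"
      and tail: "\<forall>z\<in>Z. \<forall>z'\<in>Z. \<forall>r>0. dist z z' \<le> r \<longrightarrow>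
        (\<forall>s. prob {w\<in>space M. r * s < \<bar>W z w - W z' w\<bar>} \<le> Q * exp (- s))"
      and cont: "AE w in M. continuous_on Z (\<lambda>z. W z w)"
    define bad where "bad k t t' = {w\<in>space M. r k * s k < \<bar>W t w - W t' w\<bar>}" for k t t'
    have bad_ev: "bad k t t' \<in> events" if "t \<in> Z" "t' \<in> Z" for k t t'
    proof -
      have [measurable]: "W t \<in> borel_measurable M" "W t' \<in> borel_measurable M" using meas that by auto
      show ?thesis unfolding bad_def by measurable
    qed
    have bad_le: "prob (bad k t t') \<le> Q * exp (- s k)" if "t \<in> Z" "t' \<in> Z" "dist t t' \<le> r k" for k t t'
      using tail that r0[of k] unfolding bad_def by blast
    obtain N where N: "{w \<in> space M. \<not> continuous_on Z (\<lambda>z. W z w)} \<subseteq> N" "N \<in> null_sets M"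
      using cont by (auto simp: eventually_ae_filter)
    \<comment> \<open>\<open>z0\<close> need not belong to any net, so the chain begins with a
      direct link from level \<open>k0\<close> to \<open>z0\<close>.\<close>
    define P0 where "P0 = {t\<in>T k0. dist t z0 \<le> r k0}"
    define B0 where "B0 = (\<Union>t\<in>P0. bad k0 t z0)"
    define P where "P k = {q\<in>T k \<times> T (Suc k). dist (fst q) (snd q) \<le> r k}" for k
    define B where "B k = (\<Union>q\<in>P k. bad k (fst q) (snd q))" for k
    have fP: "finite P0" "finite (P k)" for k using fT by (auto simp: P0_def P_def)
    have B0e: "B0 \<in> events"
      unfolding B0_def using fP TZ z0 by (intro sets.finite_UN bad_ev) (auto simp: P0_def intro: TZ')
    have Be: "B k \<in> events" for k
      unfolding B_def using fP TZ by (intro sets.finite_UN bad_ev) (auto simp: P_def intro: TZ')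
    have "prob B0 \<le> (\<Sum>t\<in>P0. prob (bad k0 t z0))"
      unfolding B0_def using fP TZ z0
      by (intro finite_measure_subadditive_finite) (auto simp: P0_def intro!: bad_ev intro: TZ')
    also have "\<dots> \<le> (\<Sum>t\<in>P0. Q * exp (- s k0))"
      using TZ z0 by (intro sum_mono bad_le) (auto simp: P0_def intro: TZ')
    also have "\<dots> = real (card P0) * (Q * exp (- s k0))" by simp
    also have "\<dots> \<le> real D ^ k0 * (Q * exp (- s k0))"
    proof (intro mult_right_mono)
      have "card P0 \<le> card (T k0)" unfolding P0_def by (intro card_mono fT) auto
      then show "real (card P0) \<le> real D ^ k0" using cT[of k0] by (metis le_trans of_nat_le_iff of_nat_power)
    qed (use Q in simp)
    also have "\<dots> = Q * (real D ^ k0 * exp (- s k0))" by simp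
    also have "\<dots> \<le> Q * (1/2) ^ k0" using Ds Q by (intro mult_left_mono)
    finally have pB0: "prob B0 \<le> Q * (1/2) ^ k0" .
    have pB: "prob (B k) \<le> Q * (1/2) ^ k" for k
    proof -
      have "prob (B k) \<le> (\<Sum>q\<in>P k. prob (bad k (fst q) (snd q)))"
        unfolding B_def using fP TZ
        by (intro finite_measure_subadditive_finite) (auto simp: P_def intro!: bad_ev intro: TZ')
      also have "\<dots> \<le> (\<Sum>q\<in>P k. Q * exp (- s k))"
        using TZ by (intro sum_mono bad_le) (auto simp: P_def intro: TZ')
      also have "\<dots> = real (card (P k)) * (Q * exp (- s k))" by simp
      also have "\<dots> \<le> (real D ^ k * real D ^ Suc k) * (Q * exp (- s k))"
      proof (intro mult_right_mono)
        have "card (P k) \<le> card (T k \<times> T (Suc k))"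
          unfolding P_def by (intro card_mono finite_cartesian_product fT) auto
        also have "\<dots> \<le> D ^ k * D ^ Suc k"
          unfolding card_cartesian_product by (intro mult_le_mono cT)
        finally show "real (card (P k)) \<le> real D ^ k * real D ^ Suc k"
          by (metis of_nat_le_iff of_nat_mult of_nat_power)
      qed (use Q in simp)
      also have "\<dots> = Q * (real D ^ k * real D ^ Suc k * exp (- s k))" by simp
      also have "\<dots> \<le> Q * (1/2) ^ k" using DDs Q by (intro mult_left_mono)
      finally show ?thesis .
    qed
    have sums: "(\<lambda>i. Q * (1/2) ^ (i + k0)) sums (2 * Q * (1/2::real) ^ k0)"
      using sums_mult[OF geometric_sums[of "1/2::real"], of "Q * (1/2) ^ k0"]
      by (simp add: power_add mult_ac)
    have smB: "summable (\<lambda>i. prob (B (i + k0)))"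
      using pB by (intro summable_comparison_test'[OF sums_summable[OF sums], of 0]) auto
    have "prob (\<Union>i. B (i + k0)) \<le> (\<Sum>i. prob (B (i + k0)))"
      using Be smB by (intro finite_measure_subadditive_countably) auto
    also have "\<dots> \<le> (\<Sum>i. Q * (1/2) ^ (i + k0))"
      using pB by (intro suminf_le smB sums_summable[OF sums])
    also have "\<dots> = 2 * Q * (1/2::real) ^ k0" using sums by (simp add: sums_iff)
    finally have pU: "prob (\<Union>i. B (i + k0)) \<le> 2 * Q * (1/2::real) ^ k0" .
    define E where "E = N \<union> (B0 \<union> (\<Union>i. B (i + k0)))"
    have Ee: "E \<in> events" unfolding E_def using N B0e Be by auto
    have "prob E \<le> prob N + (prob B0 + prob (\<Union>i. B (i + k0)))"
      unfolding E_def using N B0e Be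
      by (intro order_trans[OF measure_Un_le] add_left_mono) (auto intro!: measure_Un_le)
    also have "\<dots> \<le> 3 * Q * (1/2::real) ^ k0"
      using pB0 pU N(2) by (simp add: measure_eq_0_null_sets)
    also have "\<dots> < e" by (rule k0)
    finally have pE: "prob E < e" .
    show "\<exists>A\<in>events. 1 - e \<le> prob A \<and>
        (\<forall>w\<in>A. \<forall>z\<in>Z. dist z z0 < R * (1/2) ^ k0 \<longrightarrow> \<bar>W z w - W z0 w\<bar> \<le> e)"
    proof (intro bexI[of _ "space M - E"] conjI ballI impI)
      show "space M - E \<in> events" using Ee by auto
      show "1 - e \<le> prob (space M - E)" using pE Ee by (subst prob_compl) auto
      fix w z assume w: "w \<in> space M - E" and z: "z \<in> Z" and dz: "dist z z0 < R * (1/2) ^ k0"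
      obtain t where t: "\<And>k. t k \<in> T k" "\<And>k. dist z (t k) \<le> R * (1/2) ^ k"
        using T[OF z] by metis
      have tZ: "t k \<in> Z" for k using t(1) TZ by blast
      have d0: "dist (t k0) z0 \<le> r k0"
        using dist_triangle3[of "t k0" z0 z] t(2)[of k0] dz by (simp add: r_def)
      have h0: "\<bar>W (t k0) w - W z0 w\<bar> \<le> g k0"
      proof (rule ccontr)
        assume "\<not> ?thesis"
        then have "w \<in> bad k0 (t k0) z0" using w by (auto simp: bad_def g_def)
        moreover have "t k0 \<in> P0" using t(1) d0 by (auto simp: P0_def)
        ultimately have "w \<in> B0" unfolding B0_def by (intro UN_I)
        with w show False by (auto simp: E_def)
      qed
      have hs: "\<bar>W (t (Suc (i + k0))) w - W (t (i + k0)) w\<bar> \<le> g (i + k0)" for i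
      proof (rule ccontr)
        assume nn: "\<not> ?thesis"
        have "dist (t (i + k0)) (t (Suc (i + k0))) \<le> dist (t (i + k0)) z + dist z (t (Suc (i + k0)))"
          by (rule dist_triangle)
        also have "\<dots> \<le> R * (1/2) ^ (i + k0) + R * (1/2) ^ Suc (i + k0)"
          using t(2)[of "i + k0"] t(2)[of "Suc (i + k0)"]
          by (subst dist_commute) (rule add_mono)
        also have "\<dots> \<le> r (i + k0)" using R by (simp add: r_def)
        finally have "dist (t (i + k0)) (t (Suc (i + k0))) \<le> r (i + k0)" .
        then have "(t (i + k0), t (Suc (i + k0))) \<in> P (i + k0)" using t(1) by (simp add: P_def)
        moreover have "w \<in> bad (i + k0) (t (i + k0)) (t (Suc (i + k0)))"
          using w nn by (simp add: bad_def g_def abs_minus_commute)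
        ultimately have "w \<in> B (i + k0)" unfolding B_def by (intro UN_I) (assumption, simp only: fst_conv snd_conv)
        with w show False by (auto simp: E_def)
      qed
      have sg': "summable (\<lambda>i. g (i + k0))" using sg by (simp add: summable_iff_shift)
      have bnd: "\<bar>W (t (m + k0)) w - W z0 w\<bar> \<le> e" for m
      proof -
        have "\<bar>W (t (m + k0)) w - W (t k0) w\<bar> \<le> (\<Sum>i<m. g (i + k0))"
        proof (induction m)
          case (Suc m)
          have "\<bar>W (t (Suc m + k0)) w - W (t k0) w\<bar> \<le>
              \<bar>W (t (Suc (m + k0))) w - W (t (m + k0)) w\<bar> + \<bar>W (t (m + k0)) w - W (t k0) w\<bar>"
            unfolding add_Suc by linarith
          also have "\<dots> \<le> g (m + k0) + (\<Sum>i<m. g (i + k0))" using hs Suc by (rule add_mono)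
          finally show ?case by simp
        qed simp
        also have "\<dots> \<le> (\<Sum>i. g (i + k0))" using g0 sg' by (intro sum_le_suminf) auto
        finally show ?thesis using h0 k0(1) by linarith
      qed
      have tlim: "(\<lambda>m. t (m + k0)) \<longlonglongrightarrow> z"
      proof (rule metric_tendsto_imp_tendsto)
        show "(\<lambda>m. R * (1/2) ^ (m + k0)) \<longlonglongrightarrow> 0"
          by (intro tendsto_mult_right_zero LIMSEQ_ignore_initial_segment LIMSEQ_power_zero) simp
        show "\<forall>\<^sub>F m in sequentially. dist (t (m + k0)) z \<le> dist (R * (1/2) ^ (m + k0)) 0"
          using t(2) R by (auto simp: dist_commute intro!: always_eventually)
      qed
      \<comment> \<open>Only countably many links are controlled by events. Continuity of the path
        carries the bound to the limit \<open>z\<close> of the chain, so no supremum over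
        \<open>Z\<close> has to be measurable.\<close>
      have "continuous_on Z (\<lambda>z. W z w)" using w N(1) by (auto simp: E_def)
      then have "(\<lambda>m. W (t (m + k0)) w) \<longlonglongrightarrow> W z w"
        using tlim tZ z by (auto simp: continuous_on_sequentially o_def)
      then have "(\<lambda>m. \<bar>W (t (m + k0)) w - W z0 w\<bar>) \<longlonglongrightarrow> \<bar>W z w - W z0 w\<bar>"
        by (intro tendsto_intros)
      then show "\<bar>W z w - W z0 w\<bar> \<le> e" using bnd by (intro LIMSEQ_le_const2) auto
    qed
  qed
qed

end

section \<open>Sums of independent copies\<close>

lemma exp_le_quadratic:
  fixes x :: real
  assumes "\<bar>x\<bar> \<le> 1"
  shows "exp x \<le> 1 + x + x\<^sup>2"
proof (cases "0 \<le> x")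
  case True
  then show ?thesis using assms exp_bound[of x] by simp
next
  case False
  define y where "y = - x"
  have y: "0 < y" "y \<le> 1" using False assms by (auto simp: y_def)
  \<comment> \<open>The product on the right equals \<open>1 + y^3\<close>.\<close>
  have "1 \<le> (1 - y + y\<^sup>2) * (1 + y)"
    using y by (simp add: algebra_simps power2_eq_square)
  also have "\<dots> \<le> (1 - y + y\<^sup>2) * exp y"
    using y by (intro mult_left_mono exp_ge_add_one_self) auto
  finally have "exp (- y) \<le> 1 - y + y\<^sup>2"
    by (simp add: exp_minus field_simps)
  then show ?thesis by (simp add: y_def)
qed

context prob_space begin

lemma expectation_abs_le_sqrt:
  fixes A :: "'a \<Rightarrow> real"
  assumes [measurable]: "A \<in> borel_measurable M" and i: "integrable M (\<lambda>w. (A w)\<^sup>2)"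
  shows "integrable M A" "expectation (\<lambda>w. \<bar>A w\<bar>) \<le> sqrt (expectation (\<lambda>w. (A w)\<^sup>2))"
proof -
  show iA: "integrable M A" by (rule square_integrable_imp_integrable[OF _ i]) simp
  have "0 \<le> variance (\<lambda>w. \<bar>A w\<bar>)" by (rule variance_positive)
  also have "\<dots> = expectation (\<lambda>w. \<bar>A w\<bar>\<^sup>2) - (expectation (\<lambda>w. \<bar>A w\<bar>))\<^sup>2"
    using i iA by (intro variance_eq) auto
  finally show "expectation (\<lambda>w. \<bar>A w\<bar>) \<le> sqrt (expectation (\<lambda>w. (A w)\<^sup>2))"
    by (intro real_le_rsqrt) simp
qed

end

text \<open>\<open>V0\<close> carries the common law, so that all moments of a summand are expressed
  through one variable. The copies are indexed from 1, and nothing is assumed about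
  \<open>V 0\<close>.\<close>

locale iid_copies = prob_space M for M :: "'a measure" +
  fixes V0 :: "'a \<Rightarrow> 'b::topological_space" and V :: "nat \<Rightarrow> 'a \<Rightarrow> 'b"
  assumes V0_meas [measurable]: "V0 \<in> borel_measurable M"
    and indep: "indep_vars (\<lambda>_. borel) V {1..}"
    and same_distr: "\<And>i. 1 \<le> i \<Longrightarrow> distr M borel (V i) = distr M borel V0"
begin

lemma V_meas: "1 \<le> i \<Longrightarrow> V i \<in> borel_measurable M"
  using indep unfolding indep_vars_def2 by auto

lemma V_meas_sum [measurable]:
  fixes g :: "'b \<Rightarrow> real"
  assumes [measurable]: "g \<in> borel_measurable borel"
  shows "(\<lambda>w. \<Sum>i=1..n. g (V i w)) \<in> borel_measurable M"
  by (intro borel_measurable_sum measurable_compose[OF V_meas assms]) auto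

lemmas V_meas_sum' [measurable] = V_meas_sum[simplified]

lemma integrable_copy:
  fixes g :: "'b \<Rightarrow> 'c::{banach, second_countable_topology}"
  assumes "g \<in> borel_measurable borel" "1 \<le> i"
  shows "integrable M (\<lambda>w. g (V i w)) \<longleftrightarrow> integrable M (\<lambda>w. g (V0 w))"
  using integrable_distr_eq[OF V_meas[OF assms(2)] assms(1)] integrable_distr_eq[OF V0_meas assms(1)]
    same_distr[OF assms(2)] by simp

lemma expectation_copy:
  fixes g :: "'b \<Rightarrow> 'c::{banach, second_countable_topology}"
  assumes "g \<in> borel_measurable borel" "1 \<le> i"
  shows "integral\<^sup>L M (\<lambda>w. g (V i w)) = integral\<^sup>L M (\<lambda>w. g (V0 w))"
  using integral_distr[OF V_meas[OF assms(2)] assms(1)] integral_distr[OF V0_meas assms(1)]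
    same_distr[OF assms(2)] by simp

lemma AE_copy:
  assumes "Measurable.pred borel P" "1 \<le> i" "AE w in M. P (V0 w)"
  shows "AE w in M. P (V i w)"
proof -
  have P: "{x \<in> space borel. P x} \<in> sets borel" using assms(1) by (simp add: pred_def)
  have "AE x in distr M borel V0. P x" using assms(3) by (subst AE_distr_iff[OF V0_meas P])
  then have "AE x in distr M borel (V i). P x" by (simp only: same_distr[OF assms(2)])
  then show ?thesis by (subst (asm) AE_distr_iff[OF V_meas[OF assms(2)] P])
qed

lemma indep_compose:
  fixes g :: "'b \<Rightarrow> real"
  assumes "g \<in> borel_measurable borel"
  shows "indep_vars (\<lambda>_. borel) (\<lambda>i w. g (V i w)) {1..n}"
  using indep_vars_compose2[where Y="\<lambda>_. g", OF indep_vars_subset[OF indep, of "{1..n}"]] assms by auto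

lemma char_sum:
  fixes g :: "'b \<Rightarrow> real"
  assumes g: "g \<in> borel_measurable borel"
  shows "char (distr M borel (\<lambda>w. \<Sum>i=1..n. g (V i w))) t =
    char (distr M borel (\<lambda>w. g (V0 w))) t ^ n"
proof -
  have "char (distr M borel (\<lambda>w. \<Sum>i=1..n. g (V i w))) t =
      (\<Prod>i=1..n. char (distr M borel (\<lambda>w. g (V i w))) t)"
    by (rule char_distr_sum[OF indep_compose[OF g]])
  also have "\<dots> = (\<Prod>i=1..n. char (distr M borel (\<lambda>w. g (V0 w))) t)"
  proof (rule prod.cong)
    fix i assume "i \<in> {1..n}"
    then have i: "1 \<le> i" by simp
    have "distr M borel (\<lambda>w. g (V i w)) = distr (distr M borel (V i)) borel g"
      using V_meas[OF i] g by (simp add: distr_distr o_def)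
    also have "\<dots> = distr M borel (\<lambda>w. g (V0 w))"
      using g by (simp add: same_distr[OF i] distr_distr o_def)
    finally show "char (distr M borel (\<lambda>w. g (V i w))) t = char (distr M borel (\<lambda>w. g (V0 w))) t" by simp
  qed simp
  finally show ?thesis by simp
qed

lemma exp_sum:
  fixes g :: "'b \<Rightarrow> real"
  assumes g[measurable]: "g \<in> borel_measurable borel" and i: "integrable M (\<lambda>w. exp (g (V0 w)))"
  shows "integrable M (\<lambda>w. exp (\<Sum>i=1..n. g (V i w)))"
    "expectation (\<lambda>w. exp (\<Sum>i=1..n. g (V i w))) = expectation (\<lambda>w. exp (g (V0 w))) ^ n"
proof -
  have ii: "\<And>i. i \<in> {1..n} \<Longrightarrow> integrable M (\<lambda>w. exp (g (V i w)))"
    using integrable_copy[of "\<lambda>x. exp (g x)"] i by auto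
  have ind: "indep_vars (\<lambda>_. borel) (\<lambda>i w. exp (g (V i w))) {1..n}"
    by (rule indep_compose[of "\<lambda>x. exp (g x)"]) measurable
  show "integrable M (\<lambda>w. exp (\<Sum>i=1..n. g (V i w)))"
    using indep_vars_integrable[OF _ ind ii] by (simp add: exp_sum)
  have "expectation (\<lambda>w. exp (\<Sum>i=1..n. g (V i w))) = (\<Prod>i=1..n. expectation (\<lambda>w. exp (g (V i w))))"
    using indep_vars_lebesgue_integral[OF _ ind ii] by (simp add: exp_sum)
  also have "\<dots> = (\<Prod>i=1..n. expectation (\<lambda>w. exp (g (V0 w))))"
    using expectation_copy[of "\<lambda>x. exp (g x)"] by (intro prod.cong) auto
  finally show "expectation (\<lambda>w. exp (\<Sum>i=1..n. g (V i w))) = expectation (\<lambda>w. exp (g (V0 w))) ^ n"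
    by simp
qed

text \<open>Independence removes the mixed terms of the expanded square. The raw second moment
  appears on the right because it is what the kernel computations deliver.\<close>

lemma sum_centered_square:
  fixes g :: "'b \<Rightarrow> real"
  assumes g[measurable]: "g \<in> borel_measurable borel" and i2: "integrable M (\<lambda>w. (g (V0 w))\<^sup>2)"
  defines "m \<equiv> expectation (\<lambda>w. g (V0 w))"
  shows "integrable M (\<lambda>w. ((\<Sum>i=1..n. g (V i w)) - real n * m)\<^sup>2)"
    "expectation (\<lambda>w. ((\<Sum>i=1..n. g (V i w)) - real n * m)\<^sup>2) \<le> real n * expectation (\<lambda>w. (g (V0 w))\<^sup>2)"
proof -
  have i1: "integrable M (\<lambda>w. g (V0 w))"
    by (rule square_integrable_imp_integrable[OF _ i2]) simp
  define c where "c = (\<lambda>x. g x - m)"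
  have c[measurable]: "c \<in> borel_measurable borel" by (simp add: c_def)
  have c2: "integrable M (\<lambda>w. (c (V0 w))\<^sup>2)"
    using i1 i2 by (simp add: c_def power2_diff)
  have c1: "integrable M (\<lambda>w. c (V0 w))" using i1 by (simp add: c_def)
  have c0: "expectation (\<lambda>w. c (V0 w)) = 0" using i1 by (simp add: c_def m_def prob_space)
  have eq: "((\<Sum>i=1..n. g (V i w)) - real n * m)\<^sup>2 =
      (\<Sum>i=1..n. \<Sum>j=1..n. c (V i w) * c (V j w))" for w
    by (simp add: c_def power2_eq_square sum_product[symmetric] sum_subtractf)
  have pair: "integrable M (\<lambda>w. c (V i w) * c (V j w)) \<and>
      expectation (\<lambda>w. c (V i w) * c (V j w)) =
        (if i = j then expectation (\<lambda>w. (c (V0 w))\<^sup>2) else 0)"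
    if ij: "i \<in> {1..n}" "j \<in> {1..n}" for i j
  proof (cases "i = j")
    case True
    then show ?thesis
      using integrable_copy[of "\<lambda>x. (c x)\<^sup>2" i] expectation_copy[of "\<lambda>x. (c x)\<^sup>2" i] c2 ij
      by (auto simp: power2_eq_square)
  next
    case False
    have ind: "indep_vars (\<lambda>_. borel) (\<lambda>k w. c (V k w)) {i, j}"
      using ij by (intro indep_vars_subset[OF indep_compose[OF c, of n]]) auto
    have ii: "\<And>k. k \<in> {i, j} \<Longrightarrow> integrable M (\<lambda>w. c (V k w))"
      using integrable_copy[of c] c1 ij by auto
    show ?thesis
      using indep_vars_integrable[OF _ ind ii] indep_vars_lebesgue_integral[OF _ ind ii] False
        expectation_copy[of c] c0 ij by auto
  qed
  show "integrable M (\<lambda>w. ((\<Sum>i=1..n. g (V i w)) - real n * m)\<^sup>2)"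
    unfolding eq using pair by (intro Bochner_Integration.integrable_sum) auto
  have "expectation (\<lambda>w. ((\<Sum>i=1..n. g (V i w)) - real n * m)\<^sup>2) =
      (\<Sum>i=1..n. \<Sum>j=1..n. expectation (\<lambda>w. c (V i w) * c (V j w)))"
    unfolding eq using pair
    by (subst Bochner_Integration.integral_sum; (intro Bochner_Integration.integrable_sum sum.cong Bochner_Integration.integral_sum)?) auto
  also have "\<dots> = (\<Sum>i=1..n. \<Sum>j=1..n. if i = j then expectation (\<lambda>w. (c (V0 w))\<^sup>2) else 0)"
    using pair by (intro sum.cong) auto
  also have "\<dots> = real n * expectation (\<lambda>w. (c (V0 w))\<^sup>2)" by simp
  also have "expectation (\<lambda>w. (c (V0 w))\<^sup>2) \<le> expectation (\<lambda>w. (g (V0 w))\<^sup>2)"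
    unfolding c_def m_def using variance_eq[OF i1 i2] by simp
  finally show "expectation (\<lambda>w. ((\<Sum>i=1..n. g (V i w)) - real n * m)\<^sup>2) \<le>
      real n * expectation (\<lambda>w. (g (V0 w))\<^sup>2)" by (simp add: mult_left_mono)
qed

text \<open>Only the scale \<open>a\<close> enters: sub-exponential tails, obtained from the exponential moment at
  the single point \<open>1 / a\<close>, are enough for chaining over a finite-dimensional set.\<close>

lemma sum_centered_tail:
  fixes g :: "'b \<Rightarrow> real"
  assumes g[measurable]: "g \<in> borel_measurable borel"
    and b: "AE w in M. \<bar>g (V0 w)\<bar> \<le> b"
    and a: "0 < a" "2 * b \<le> a"
    and v: "real n * expectation (\<lambda>w. (g (V0 w))\<^sup>2) \<le> c * a\<^sup>2"
  shows "prob {w\<in>space M. a * s < \<bar>(\<Sum>i=1..n. g (V i w)) - real n * expectation (\<lambda>w. g (V0 w))\<bar>}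
    \<le> 2 * exp c * exp (- s)"
proof -
  define m where "m = expectation (\<lambda>w. g (V0 w))"
  have i1: "integrable M (\<lambda>w. g (V0 w))"
    using b by (intro integrable_const_bound[where B=b]) auto
  have mb: "\<bar>m\<bar> \<le> b"
  proof -
    have "\<bar>m\<bar> \<le> expectation (\<lambda>w. \<bar>g (V0 w)\<bar>)" unfolding m_def by (rule integral_abs_bound)
    also have "\<dots> \<le> expectation (\<lambda>w. b)" using b i1 by (intro integral_mono_AE) auto
    finally show ?thesis by (simp add: prob_space)
  qed
  have i2: "integrable M (\<lambda>w. (g (V0 w))\<^sup>2)"
  proof (intro integrable_const_bound[where B="b\<^sup>2"])
    show "AE w in M. norm ((g (V0 w))\<^sup>2) \<le> b\<^sup>2"
      using b by eventually_elim (simp add: abs_le_square_iff[symmetric] abs_le_iff)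
  qed simp
  \<comment> \<open>A one-sided Chernoff bound; the sign \<open>k\<close> yields both tails from a
    single argument.\<close>
  have one: "prob {w\<in>space M. s < (\<Sum>i=1..n. k * (g (V i w) - m) / a)} \<le> exp c * exp (- s)"
    if k: "\<bar>k\<bar> = 1" for k :: real
  proof -
    \<comment> \<open>The scaling gives \<open>|d| \<le> 1\<close>, by
      \<open>|g - m| \<le> 2 * b \<le> a\<close>. Then \<open>exp d \<le> 1 + d + d^2\<close>, and
      the linear term has mean zero.\<close>
    define d where "d = (\<lambda>x. k * (g x - m) / a)"
    have [measurable]: "d \<in> borel_measurable borel" by (simp add: d_def)
    have d1: "AE w in M. \<bar>d (V0 w)\<bar> \<le> 1"
      using b
    proof eventually_elim
      case (elim w)
      have "\<bar>k * (g (V0 w) - m)\<bar> = \<bar>g (V0 w) - m\<bar>" using k by (simp add: abs_mult)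
      also have "\<dots> \<le> a" using elim mb a by linarith
      finally show ?case using a by (simp add: d_def)
    qed
    have ie: "integrable M (\<lambda>w. exp (d (V0 w)))"
      using d1 by (intro integrable_const_bound[where B="exp 1"]) (auto simp: abs_le_iff elim!: eventually_mono)
    have id1: "integrable M (\<lambda>w. d (V0 w))" using i1 by (simp add: d_def)
    have k2: "k\<^sup>2 = 1" using k by (metis power2_abs power_one)
    have d2: "(d x)\<^sup>2 = ((g x)\<^sup>2 - 2 * m * g x + m\<^sup>2) / a\<^sup>2" for x
      unfolding d_def power_divide power_mult_distrib k2 by (simp add: power2_diff)
    have id2: "integrable M (\<lambda>w. (d (V0 w))\<^sup>2)" unfolding d2 using i1 i2 by simp
    have "expectation (\<lambda>w. exp (d (V0 w))) \<le> expectation (\<lambda>w. 1 + d (V0 w) + (d (V0 w))\<^sup>2)"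
      using d1 by (intro integral_mono_AE ie Bochner_Integration.integrable_add integrable_const id1 id2)
        (auto elim!: eventually_mono intro: exp_le_quadratic)
    also have "\<dots> = 1 + expectation (\<lambda>w. d (V0 w)) + expectation (\<lambda>w. (d (V0 w))\<^sup>2)"
      using id1 id2 by (simp add: prob_space)
    also have "expectation (\<lambda>w. d (V0 w)) = 0" using i1 by (simp add: d_def m_def prob_space)
    also have "expectation (\<lambda>w. (d (V0 w))\<^sup>2) = (expectation (\<lambda>w. (g (V0 w))\<^sup>2) - m\<^sup>2) / a\<^sup>2"
      unfolding d2 using i1 i2 by (simp add: prob_space m_def[symmetric] power2_eq_square)
    also have "\<dots> \<le> expectation (\<lambda>w. (g (V0 w))\<^sup>2) / a\<^sup>2" by (intro divide_right_mono) auto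
    also have "1 + 0 + expectation (\<lambda>w. (g (V0 w))\<^sup>2) / a\<^sup>2 \<le> exp (expectation (\<lambda>w. (g (V0 w))\<^sup>2) / a\<^sup>2)"
      using exp_ge_add_one_self by simp
    finally have "expectation (\<lambda>w. exp (d (V0 w))) ^ n \<le> exp (expectation (\<lambda>w. (g (V0 w))\<^sup>2) / a\<^sup>2) ^ n"
      by (intro power_mono integral_nonneg_AE) auto
    also have "\<dots> = exp (real n * expectation (\<lambda>w. (g (V0 w))\<^sup>2) / a\<^sup>2)"
      by (simp add: exp_of_nat_mult[symmetric])
    also have "\<dots> \<le> exp c" using v a by (simp add: field_simps)
    finally have mgf: "expectation (\<lambda>w. exp (\<Sum>i=1..n. d (V i w))) \<le> exp c"
      using exp_sum(2)[of d n] ie by simp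
    have "prob {w\<in>space M. s < (\<Sum>i=1..n. d (V i w))} \<le>
        prob {w\<in>space M. exp s \<le> exp (\<Sum>i=1..n. d (V i w))}"
      by (intro finite_measure_mono) auto
    also have "\<dots> \<le> expectation (\<lambda>w. exp (\<Sum>i=1..n. d (V i w))) / exp s"
      using exp_sum(1)[of d n] ie by (intro integral_Markov_inequality_measure[where A="{}"]) auto
    also have "\<dots> \<le> exp c / exp s" by (intro divide_right_mono mgf) simp
    finally show ?thesis by (simp add: d_def exp_minus field_simps)
  qed
  have sumk: "(\<Sum>i=1..n. k * (g (V i w) - m) / a) = k * ((\<Sum>i=1..n. g (V i w)) - real n * m) / a" for k w
    by (simp add: sum_divide_distrib[symmetric] sum_distrib_left[symmetric] sum_subtractf)
  let ?S = "\<lambda>w. (\<Sum>i=1..n. g (V i w)) - real n * m"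
  have "prob {w\<in>space M. a * s < \<bar>?S w\<bar>} \<le>
      prob ({w\<in>space M. s < 1 * ?S w / a} \<union> {w\<in>space M. s < (-1) * ?S w / a})"
    using a by (intro finite_measure_mono) (auto simp: field_simps abs_if split: if_splits)
  also have "\<dots> \<le> prob {w\<in>space M. s < 1 * ?S w / a} + prob {w\<in>space M. s < (-1) * ?S w / a}"
    by (intro measure_Un_le) measurable
  also have "\<dots> \<le> exp c * exp (- s) + exp c * exp (- s)"
    using one[of 1] one[of "-1"] unfolding sumk by (intro add_mono) auto
  finally show ?thesis by (simp add: m_def)
qed

text \<open>The Lindeberg theorem for rows of independent copies. The summands are not centred;
  instead \<open>n\<close> times their mean must vanish, which is where the smoothing bias will
  enter. The characteristic function of a row is a power \<open>\<phi> n ^ n\<close>, compared with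
  \<open>(1 - t^2 * v / (2 * n)) ^ n\<close>.\<close>

lemma triangular_clt_char:
  fixes g :: "nat \<Rightarrow> 'b \<Rightarrow> real"
  assumes g[measurable]: "\<And>n. g n \<in> borel_measurable borel"
    and i2: "\<And>n. integrable M (\<lambda>w. (g n (V0 w))\<^sup>2)"
    and mean: "(\<lambda>n. real n * expectation (\<lambda>w. g n (V0 w))) \<longlonglongrightarrow> 0"
    and var: "(\<lambda>n. real n * expectation (\<lambda>w. (g n (V0 w))\<^sup>2)) \<longlonglongrightarrow> v"
    and lindeberg: "\<And>e. 0 < e \<Longrightarrow>
      (\<lambda>n. real n * expectation (\<lambda>w. (g n (V0 w))\<^sup>2 * indicator {x. e < \<bar>x\<bar>} (g n (V0 w)))) \<longlonglongrightarrow> 0"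
  shows "(\<lambda>n. char (distr M borel (\<lambda>w. \<Sum>i=1..n. g n (V i w))) t) \<longlonglongrightarrow> exp (- (t\<^sup>2 * v / 2))"
proof -
  have v0: "0 \<le> v"
    using var by (rule LIMSEQ_le_const) (auto intro!: exI[of _ 0] mult_nonneg_nonneg integral_nonneg_AE)
  define G where "G n w = g n (V0 w)" for n w
  have [measurable]: "G n \<in> borel_measurable M" for n unfolding G_def[abs_def] by measurable
  have i2: "integrable M (\<lambda>w. (G n w)\<^sup>2)" for n using i2 by (simp add: G_def)
  have i1: "integrable M (G n)" for n
    by (rule square_integrable_imp_integrable[OF _ i2]) simp
  \<comment> \<open>Up to the factor \<open>t^2 / 6\<close>, the remainder of the second-order
    expansion of the characteristic function. The cubic alternative is used where
    \<open>|G n w| \<le> e\<close>, the quadratic one on the Lindeberg event.\<close>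
  define R where "R n = expectation (\<lambda>w. min (6 * (G n w)\<^sup>2) (\<bar>t\<bar> * \<bar>G n w\<bar> ^ 3))" for n
  have R0: "0 \<le> R n" for n unfolding R_def by (intro integral_nonneg_AE) auto
  have Rlim: "(\<lambda>n. real n * R n) \<longlonglongrightarrow> 0"
  proof (rule tendstoI)
    fix r :: real assume r: "0 < r"
    \<comment> \<open>Makes the limit \<open>|t| * e * v\<close> of the cubic part at most
      \<open>r / 2\<close>; the added ones keep the denominator positive.\<close>
    define e where "e = r / (2 * (\<bar>t\<bar> + 1) * (\<bar>v\<bar> + 1))"
    have e: "0 < e" using r by (simp add: e_def add_nonneg_pos)
    have bound: "real n * R n \<le> \<bar>t\<bar> * e * (real n * expectation (\<lambda>w. (G n w)\<^sup>2)) +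
        6 * (real n * expectation (\<lambda>w. (G n w)\<^sup>2 * indicator {x. e < \<bar>x\<bar>} (G n w)))" for n
    proof -
      have ii: "integrable M (\<lambda>w. (G n w)\<^sup>2 * indicator {x. e < \<bar>x\<bar>} (G n w))"
        by (rule Bochner_Integration.integrable_bound[where f="\<lambda>w. (G n w)\<^sup>2"])
          (use i2 in \<open>auto split: split_indicator\<close>)
      have "R n \<le> expectation (\<lambda>w. \<bar>t\<bar> * e * (G n w)\<^sup>2 + 6 * ((G n w)\<^sup>2 * indicator {x. e < \<bar>x\<bar>} (G n w)))"
        unfolding R_def
      proof (rule integral_mono')
        fix w
        show "0 \<le> \<bar>t\<bar> * e * (G n w)\<^sup>2 + 6 * ((G n w)\<^sup>2 * indicator {x. e < \<bar>x\<bar>} (G n w))"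
          using e by simp
        show "min (6 * (G n w)\<^sup>2) (\<bar>t\<bar> * \<bar>G n w\<bar> ^ 3) \<le>
            \<bar>t\<bar> * e * (G n w)\<^sup>2 + 6 * ((G n w)\<^sup>2 * indicator {x. e < \<bar>x\<bar>} (G n w))"
        proof (cases "e < \<bar>G n w\<bar>")
          case True
          then show ?thesis using e by (simp add: min.coboundedI1)
        next
          case False
          have "\<bar>t\<bar> * \<bar>G n w\<bar> ^ 3 = \<bar>t\<bar> * (\<bar>G n w\<bar> * (G n w)\<^sup>2)"
            by (simp add: power3_eq_cube power2_eq_square)
          also have "\<dots> \<le> \<bar>t\<bar> * (e * (G n w)\<^sup>2)"
            using False by (intro mult_left_mono mult_right_mono) auto
          finally show ?thesis using False by (simp add: min.coboundedI2 mult.assoc)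
        qed
      qed (use i2 ii in auto)
      also have "\<dots> = \<bar>t\<bar> * e * expectation (\<lambda>w. (G n w)\<^sup>2) +
          6 * expectation (\<lambda>w. (G n w)\<^sup>2 * indicator {x. e < \<bar>x\<bar>} (G n w))"
        using i2 ii by simp
      finally have "real n * R n \<le> real n * (\<bar>t\<bar> * e * expectation (\<lambda>w. (G n w)\<^sup>2) +
          6 * expectation (\<lambda>w. (G n w)\<^sup>2 * indicator {x. e < \<bar>x\<bar>} (G n w)))"
        by (intro mult_left_mono) auto
      then show ?thesis by (simp add: algebra_simps)
    qed
    have "(\<lambda>n. \<bar>t\<bar> * e * (real n * expectation (\<lambda>w. (G n w)\<^sup>2)) +
        6 * (real n * expectation (\<lambda>w. (G n w)\<^sup>2 * indicator {x. e < \<bar>x\<bar>} (G n w)))) \<longlonglongrightarrow>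
        \<bar>t\<bar> * e * v + 6 * 0"
      using var lindeberg[OF e] unfolding G_def by (intro tendsto_add tendsto_mult tendsto_const)
    moreover have "\<bar>t\<bar> * e * v + 6 * 0 < r"
    proof -
      have "\<bar>t\<bar> * e * v \<le> (\<bar>t\<bar> + 1) * e * (\<bar>v\<bar> + 1)" using e v0 by (intro mult_mono) auto
      also have "\<dots> = r / 2"
      proof -
        have *: "a * (r / (2 * a * b)) * b = r / 2" if "0 < a" "0 < b" for a b :: real
          using that by simp
        show ?thesis unfolding e_def by (rule *) linarith+
      qed
      also have "\<dots> < r" using r by simp
      finally show ?thesis by simp
    qed
    ultimately have "\<forall>\<^sub>F n in sequentially. \<bar>t\<bar> * e * (real n * expectation (\<lambda>w. (G n w)\<^sup>2)) +
        6 * (real n * expectation (\<lambda>w. (G n w)\<^sup>2 * indicator {x. e < \<bar>x\<bar>} (G n w))) < r"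
      by (rule order_tendstoD)
    then show "\<forall>\<^sub>F n in sequentially. dist (real n * R n) 0 < r"
    proof eventually_elim
      case (elim n)
      then show ?case using bound[of n] R0[of n] by simp
    qed
  qed
  define \<phi> where "\<phi> n = char (distr M borel (G n)) t" for n
  define c where "c n = 1 + (- (t\<^sup>2 * v / 2)) / real n" for n
  \<comment> \<open>The three terms account for the mean, for the error of the second moment, and
    for the Taylor remainder.\<close>
  define b where "b n = \<bar>t\<bar> * \<bar>real n * expectation (G n)\<bar> +
      t\<^sup>2 / 2 * \<bar>real n * expectation (\<lambda>w. (G n w)\<^sup>2) - v\<bar> + t\<^sup>2 / 6 * (real n * R n)" for n
  have b_lim: "b \<longlonglongrightarrow> \<bar>t\<bar> * \<bar>0\<bar> + t\<^sup>2 / 2 * \<bar>v - v\<bar> + t\<^sup>2 / 6 * 0"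
    unfolding b_def[abs_def] using mean var Rlim unfolding G_def
    by (intro tendsto_intros)
  have close: "norm (\<phi> n - of_real (c n)) * real n \<le> b n" if n: "0 < n" for n
  proof -
    interpret D: real_distribution "distr M borel (G n)" by simp
    have mom: "integrable (distr M borel (G n)) (\<lambda>x. x ^ k)" if "k \<le> 2" for k
      using that i1 i2 by (auto simp: integrable_distr_eq numeral_2_eq_2 le_Suc_eq prob_space)
    have "norm (\<phi> n - (\<Sum>k\<le>2. (\<i> * t) ^ k / fact k * D.expectation (\<lambda>x. x ^ k))) \<le>
        \<bar>t\<bar> ^ 2 / fact (Suc 2) * D.expectation (\<lambda>x. min (2 * \<bar>x\<bar> ^ 2 * Suc 2) (\<bar>t\<bar> * \<bar>x\<bar> ^ Suc 2))"
      unfolding \<phi>_def using D.char_approx2[of 2 t, OF mom] by simp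
    also have "D.expectation (\<lambda>x. min (2 * \<bar>x\<bar> ^ 2 * Suc 2) (\<bar>t\<bar> * \<bar>x\<bar> ^ Suc 2)) = R n"
      unfolding R_def by (subst integral_distr) (auto simp: eval_nat_numeral mult_ac)
    also have "(\<Sum>k\<le>2. (\<i> * t) ^ k / fact k * D.expectation (\<lambda>x. x ^ k)) =
        1 + \<i> * of_real (t * expectation (G n)) - of_real (t\<^sup>2 / 2 * expectation (\<lambda>w. (G n w)\<^sup>2))"
      by (simp add: numeral_2_eq_2 integral_distr D.prob_space power_mult_distrib)
         (simp add: power2_eq_square[symmetric] numeral_2_eq_2[symmetric] D.prob_space prob_space)
    finally have 1: "norm (\<phi> n - (1 + \<i> * of_real (t * expectation (G n)) -
        of_real (t\<^sup>2 / 2 * expectation (\<lambda>w. (G n w)\<^sup>2)))) \<le> t\<^sup>2 / 6 * R n"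
      by (simp add: fact_numeral)
    have "\<phi> n - of_real (c n) = (\<phi> n - (1 + \<i> * of_real (t * expectation (G n)) -
        of_real (t\<^sup>2 / 2 * expectation (\<lambda>w. (G n w)\<^sup>2)))) + (\<i> * of_real (t * expectation (G n)) -
        of_real (t\<^sup>2 / 2 * (expectation (\<lambda>w. (G n w)\<^sup>2) - v / real n)))"
      by (simp add: c_def algebra_simps)
    then have "norm (\<phi> n - of_real (c n)) \<le> t\<^sup>2 / 6 * R n + (norm (\<i> * of_real (t * expectation (G n))) +
        norm (complex_of_real (t\<^sup>2 / 2 * (expectation (\<lambda>w. (G n w)\<^sup>2) - v / real n))))"
      using 1 by (metis (no_types, lifting) norm_triangle_le norm_triangle_ineq4 add_mono)
    also have "\<dots> = t\<^sup>2 / 6 * R n + (\<bar>t\<bar> * \<bar>expectation (G n)\<bar> +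
        t\<^sup>2 / 2 * \<bar>expectation (\<lambda>w. (G n w)\<^sup>2) - v / real n\<bar>)"
      by (simp add: norm_mult abs_mult del: of_real_diff of_real_mult of_real_divide)
    finally have "norm (\<phi> n - of_real (c n)) * real n \<le> (t\<^sup>2 / 6 * R n + (\<bar>t\<bar> * \<bar>expectation (G n)\<bar> +
        t\<^sup>2 / 2 * \<bar>expectation (\<lambda>w. (G n w)\<^sup>2) - v / real n\<bar>)) * real n"
      by (intro mult_right_mono) auto
    also have "\<dots> = t\<^sup>2 / 6 * (real n * R n) + (\<bar>t\<bar> * \<bar>real n * expectation (G n)\<bar> +
        t\<^sup>2 / 2 * (real n * \<bar>expectation (\<lambda>w. (G n w)\<^sup>2) - v / real n\<bar>))"
      by (simp add: abs_mult algebra_simps)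
    also have "real n * \<bar>expectation (\<lambda>w. (G n w)\<^sup>2) - v / real n\<bar> =
        \<bar>real n * (expectation (\<lambda>w. (G n w)\<^sup>2) - v / real n)\<bar>" by (simp add: abs_mult)
    also have "real n * (expectation (\<lambda>w. (G n w)\<^sup>2) - v / real n) =
        real n * expectation (\<lambda>w. (G n w)\<^sup>2) - v" using n by (simp add: field_simps)
    finally show ?thesis by (simp add: b_def)
  qed
  have "(\<lambda>n. complex_of_real (c n ^ n)) \<longlonglongrightarrow> complex_of_real (exp (- (t\<^sup>2 * v / 2)))"
    unfolding c_def by (intro tendsto_of_real tendsto_exp_limit_sequentially)
  moreover have "(\<lambda>n. \<phi> n ^ n - complex_of_real (c n ^ n)) \<longlonglongrightarrow> 0"
  proof (rule Lim_null_comparison)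
    show "b \<longlonglongrightarrow> 0" using b_lim by simp
    \<comment> \<open>Beyond \<open>N\<close> also \<open>|c n| \<le> 1\<close>, as required by the
      telescoping estimate \<open>|\<phi>^n - c^n| \<le> n * |\<phi> - c|\<close> for numbers in the
      unit disc.\<close>
    obtain N where N: "t\<^sup>2 * v / 2 < real N" using reals_Archimedean2 by blast
    show "\<forall>\<^sub>F n in sequentially. norm (\<phi> n ^ n - complex_of_real (c n ^ n)) \<le> b n"
      using eventually_ge_at_top[of "Suc N"]
    proof eventually_elim
      case (elim n)
      interpret D: real_distribution "distr M borel (G n)" by simp
      have "t\<^sup>2 * v / 2 < real n" using N elim by linarith
      then have c1: "\<bar>c n\<bar> \<le> 1" using v0 elim by (auto simp: c_def abs_le_iff field_simps)
      have "norm (\<phi> n ^ n - complex_of_real (c n) ^ n) \<le> real n * norm (\<phi> n - complex_of_real (c n))"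
        using c1 by (intro norm_power_diff) (auto simp: \<phi>_def D.cmod_char_le_1)
      also have "\<dots> \<le> b n" using close[of n] elim by (simp add: mult.commute)
      finally show ?case by simp
    qed
  qed
  ultimately have "(\<lambda>n. \<phi> n ^ n) \<longlonglongrightarrow> complex_of_real (exp (- (t\<^sup>2 * v / 2)))"
    using tendsto_add[of "\<lambda>n. \<phi> n ^ n - complex_of_real (c n ^ n)" 0] by fastforce
  then show ?thesis unfolding char_sum[OF g] by (simp add: \<phi>_def G_def[abs_def])
qed

end

section \<open>Kernel averages\<close>

lemma lborel_integral_affine:
  fixes f :: "'b::euclidean_space \<Rightarrow> 'c::{banach, second_countable_topology}"
  assumes [measurable]: "f \<in> borel_measurable borel" and c: "c \<noteq> 0"
  shows "integral\<^sup>L lborel f = \<bar>c\<bar> ^ DIM('b) *\<^sub>R (LINT u|lborel. f (t + c *\<^sub>R u))"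
  by (subst lborel_affine[OF c, of t]) (simp add: integral_density integral_distr)

lemma lborel_integrable_affine:
  fixes f :: "'b::euclidean_space \<Rightarrow> 'c::{banach, second_countable_topology}"
  assumes [measurable]: "f \<in> borel_measurable borel" and c: "c \<noteq> 0"
  shows "integrable lborel f \<longleftrightarrow> integrable lborel (\<lambda>u. f (t + c *\<^sub>R u))"
proof -
  have "integrable lborel f \<longleftrightarrow> integrable (density (distr lborel borel (\<lambda>x. t + c *\<^sub>R x)) (\<lambda>_. ennreal (\<bar>c\<bar> ^ DIM('b)))) f"
    by (subst lborel_affine[OF c, of t]) (simp add: ennreal_power)
  also have "\<dots> \<longleftrightarrow> integrable lborel (\<lambda>u. f (t + c *\<^sub>R u))"
  proof -
    have *: "integrable lborel (\<lambda>u. a *\<^sub>R g u) \<longleftrightarrow> integrable lborel g" if "a \<noteq> 0" for a and g :: "'b \<Rightarrow> 'c"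
      using that integrable_scaleR_right[of "inverse a" lborel "\<lambda>u. a *\<^sub>R g u"]
        integrable_scaleR_right[of a lborel g] by auto
    show ?thesis using c by (simp add: integrable_density integrable_distr_eq *)
  qed
  finally show ?thesis .
qed

text \<open>The properties shared by the kernel and its square. The last one is Parzen's condition:
  rescaled kernel values at a fixed distance from the centre are negligible against
  \<open>h ^ d\<close>.\<close>

definition smoothing_kernel :: "('b::euclidean_space \<Rightarrow> real) \<Rightarrow> bool" where
  "smoothing_kernel k \<longleftrightarrow> k \<in> borel_measurable borel \<and> (\<forall>u. 0 \<le> k u) \<and> integrable lborel k \<and>
     (\<exists>B. \<forall>u. k u \<le> B) \<and> ((\<lambda>u. norm u ^ DIM('b) * k u) \<longlongrightarrow> 0) at_infinity"

text \<open>Variances of kernel sums are averages with the squared kernel, so the limit theorems for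
  averages must apply to it too.\<close>

lemma kernel_square:
  fixes k :: "'b::euclidean_space \<Rightarrow> real"
  assumes k: "smoothing_kernel k"
  shows "smoothing_kernel (\<lambda>u. (k u)\<^sup>2)"
proof -
  obtain B where B: "\<And>u. k u \<le> B" using k by (auto simp: smoothing_kernel_def)
  have [measurable]: "k \<in> borel_measurable borel" and k0: "\<And>u. 0 \<le> k u" and ki: "integrable lborel k"
    and kl: "((\<lambda>u. norm u ^ DIM('b) * k u) \<longlongrightarrow> 0) at_infinity"
    using k by (auto simp: smoothing_kernel_def)
  have B0: "0 \<le> B" using k0[of 0] B[of 0] by linarith
  have le: "(k u)\<^sup>2 \<le> B * k u" for u
    unfolding power2_eq_square using B k0 by (intro mult_right_mono)
  have "integrable lborel (\<lambda>u. (k u)\<^sup>2)"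
    by (rule Bochner_Integration.integrable_bound[where f="\<lambda>u. B * k u"])
      (use ki le k0 B0 in \<open>auto simp: abs_of_nonneg\<close>)
  moreover have "(k u)\<^sup>2 \<le> B\<^sup>2" for u using B k0 by (intro power_mono)
  moreover have "((\<lambda>u. norm u ^ DIM('b) * (k u)\<^sup>2) \<longlongrightarrow> 0) at_infinity"
  proof (rule Lim_null_comparison)
    show "((\<lambda>u. B * (norm u ^ DIM('b) * k u)) \<longlongrightarrow> 0) at_infinity"
      by (intro tendsto_mult_right_zero kl)
    show "\<forall>\<^sub>F u in at_infinity. norm (norm u ^ DIM('b) * (k u)\<^sup>2) \<le> B * (norm u ^ DIM('b) * k u)"
    proof (intro always_eventually allI)
      fix u :: 'b
      have "norm u ^ DIM('b) * (k u)\<^sup>2 \<le> norm u ^ DIM('b) * (B * k u)"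
        using le by (intro mult_left_mono) auto
      then show "norm (norm u ^ DIM('b) * (k u)\<^sup>2) \<le> B * (norm u ^ DIM('b) * k u)"
        by (simp add: abs_mult mult_ac)
    qed
  qed
  ultimately show ?thesis unfolding smoothing_kernel_def by auto
qed

locale kernel_model =
  iid_copies M "\<lambda>w. (X w, Y w)" "\<lambda>i w. (xs i w, ys i w)"
  for M :: "'w measure" and X :: "'w \<Rightarrow> real^'dx" and Y :: "'w \<Rightarrow> real^'dy"
    and xs :: "nat \<Rightarrow> 'w \<Rightarrow> real^'dx" and ys :: "nat \<Rightarrow> 'w \<Rightarrow> real^'dy" +
  fixes p :: "real^'dx \<Rightarrow> real" and x0 :: "real^'dx" and h :: "nat \<Rightarrow> real"
  assumes p_nonneg: "\<And>x. 0 \<le> p x"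
    and X_density: "distributed M lborel X (\<lambda>x. ennreal (p x))"
    and p_cont: "isCont p x0"
    and h_pos: "\<And>n. 1 \<le> n \<Longrightarrow> 0 < h n"
    and h_lim: "h \<longlonglongrightarrow> 0"
    and nh_lim: "filterlim (\<lambda>n. real n * h n ^ CARD('dx)) at_top sequentially"
begin

section \<open>Smoothed means: algebra, localization, limit\<close>

lemma X_meas [measurable]: "X \<in> borel_measurable M"
  using measurable_compose[OF V0_meas, of fst borel] by (simp add: borel_prod[symmetric])

lemma Y_meas [measurable]: "Y \<in> borel_measurable M"
  using measurable_compose[OF V0_meas, of snd borel] by (simp add: borel_prod[symmetric])

lemma xs_meas: "1 \<le> i \<Longrightarrow> xs i \<in> borel_measurable M"
  using measurable_compose[OF V_meas, of i fst borel] by (simp add: borel_prod[symmetric])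

lemma ys_meas: "1 \<le> i \<Longrightarrow> ys i \<in> borel_measurable M"
  using measurable_compose[OF V_meas, of i snd borel] by (simp add: borel_prod[symmetric])

lemma p_meas [measurable]: "p \<in> borel_measurable borel"
  using distributed_real_measurable[OF p_nonneg X_density] by simp

definition kn :: "(real^'dx \<Rightarrow> real) \<Rightarrow> nat \<Rightarrow> real^'dx \<Rightarrow> real" where
  "kn k n x = k ((1 / h n) *\<^sub>R (x - x0))"

text \<open>An approximation of \<open>E[W | X = x0] * p x0\<close> times the mass of
  \<open>k\<close>. \<open>W\<close> is an arbitrary random variable, so that truncated and
  localized versions of functions of \<open>Y\<close> are covered.\<close>

definition kmean :: "(real^'dx \<Rightarrow> real) \<Rightarrow> nat \<Rightarrow> ('w \<Rightarrow> real) \<Rightarrow> real" where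
  "kmean k n W = expectation (\<lambda>w. kn k n (X w) * W w) / h n ^ CARD('dx)"

lemma kn_meas [measurable]: "k \<in> borel_measurable borel \<Longrightarrow> kn k n \<in> borel_measurable borel"
  unfolding kn_def[abs_def]
  by (rule measurable_compose[of _ borel borel k]) (auto intro!: borel_measurable_continuous_onI continuous_intros)

lemma kn_integrable:
  assumes k: "smoothing_kernel k" and W: "integrable M W"
  shows "integrable M (\<lambda>w. kn k n (X w) * W w)"
proof -
  obtain B where B: "\<And>u. k u \<le> B" using k by (auto simp: smoothing_kernel_def)
  have [measurable]: "k \<in> borel_measurable borel" and k0: "\<And>u. 0 \<le> k u" using k by (auto simp: smoothing_kernel_def)
  have [measurable]: "W \<in> borel_measurable M" using W by simp
  have B0: "0 \<le> B" using k0[of 0] B[of 0] by linarith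
  show ?thesis
    by (rule Bochner_Integration.integrable_bound[where f="\<lambda>w. B * W w"])
      (use W B k0 B0 in \<open>auto simp: abs_mult kn_def intro!: mult_right_mono\<close>)
qed

lemma kmean_add:
  "smoothing_kernel k \<Longrightarrow> integrable M W \<Longrightarrow> integrable M W' \<Longrightarrow>
    kmean k n (\<lambda>w. W w + W' w) = kmean k n W + kmean k n W'"
  unfolding kmean_def by (simp add: ring_distribs add_divide_distrib kn_integrable)

lemma kmean_diff:
  "smoothing_kernel k \<Longrightarrow> integrable M W \<Longrightarrow> integrable M W' \<Longrightarrow>
    kmean k n (\<lambda>w. W w - W' w) = kmean k n W - kmean k n W'"
  unfolding kmean_def by (simp add: right_diff_distrib diff_divide_distrib kn_integrable)

lemma kmean_mono:
  assumes "smoothing_kernel k" "integrable M W" "integrable M W'" "1 \<le> n" "AE w in M. W w \<le> W' w"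
  shows "kmean k n W \<le> kmean k n W'"
  unfolding kmean_def
proof (intro divide_right_mono integral_mono_AE kn_integrable assms)
  show "AE w in M. kn k n (X w) * W w \<le> kn k n (X w) * W' w"
    using assms(5) by eventually_elim (use assms(1) in \<open>auto simp: kn_def smoothing_kernel_def intro!: mult_left_mono\<close>)
  show "0 \<le> h n ^ CARD('dx)" using h_pos[OF assms(4)] by simp
qed

lemma kmean_nonneg:
  assumes "smoothing_kernel k" "1 \<le> n" "AE w in M. 0 \<le> W w"
  shows "0 \<le> kmean k n W"
  unfolding kmean_def
proof (intro divide_nonneg_nonneg integral_nonneg_AE)
  show "AE w in M. 0 \<le> kn k n (X w) * W w"
    using assms(3) by eventually_elim (use assms(1) in \<open>auto simp: kn_def smoothing_kernel_def\<close>)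
  show "0 \<le> h n ^ CARD('dx)" using h_pos[OF assms(2)] by simp
qed

lemma kmean_abs:
  assumes k: "smoothing_kernel k" and n: "1 \<le> n"
  shows "\<bar>kmean k n W\<bar> \<le> kmean k n (\<lambda>w. \<bar>W w\<bar>)"
proof -
  have "\<bar>kn k n x * y\<bar> = kn k n x * \<bar>y\<bar>" for x y
    using k by (simp add: abs_mult kn_def smoothing_kernel_def)
  then have "\<bar>expectation (\<lambda>w. kn k n (X w) * W w)\<bar> \<le> expectation (\<lambda>w. kn k n (X w) * \<bar>W w\<bar>)"
    using integral_abs_bound[of M "\<lambda>w. kn k n (X w) * W w"] by simp
  then show ?thesis using h_pos[OF n] by (simp add: kmean_def divide_right_mono)
qed

lemma kmean_abs_le:
  assumes k: "smoothing_kernel k" and n: "1 \<le> n" and W: "integrable M W" "AE w in M. \<bar>W w\<bar> \<le> c"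
  shows "\<bar>kmean k n W\<bar> \<le> c * kmean k n (\<lambda>_. 1)"
proof -
  have "\<bar>kmean k n W\<bar> \<le> kmean k n (\<lambda>w. \<bar>W w\<bar>)" by (rule kmean_abs[OF k n])
  also have "\<dots> \<le> kmean k n (\<lambda>_. c)" using W by (intro kmean_mono k n) auto
  finally show ?thesis by (simp add: kmean_def mult.commute)
qed

lemma eventually_h_less:
  assumes "0 < e"
  shows "\<forall>\<^sub>F n in sequentially. 0 < h n \<and> h n < e"
proof -
  have "\<forall>\<^sub>F n in sequentially. h n < e" using h_lim assms by (rule order_tendstoD(2))
  then show ?thesis using eventually_ge_at_top[of 1]
    by eventually_elim (auto intro: h_pos)
qed

text \<open>At distance at least \<open>r\<close> the rescaled argument has norm at least
  \<open>r / h n\<close>, so by Parzen's condition the kernel value is at most a small multiple of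
  \<open>h n ^ d\<close>. This cancels the normalization, and mere integrability of \<open>W\<close>
  suffices.\<close>

lemma kmean_far:
  assumes k: "smoothing_kernel k" and W: "integrable M W" and r: "0 < r"
  shows "(\<lambda>n. kmean k n (\<lambda>w. \<bar>W w\<bar> * indicator {x. r \<le> dist x x0} (X w))) \<longlonglongrightarrow> 0"
proof (rule tendstoI)
  have [measurable]: "k \<in> borel_measurable borel" and k0: "\<And>u. 0 \<le> k u" using k by (auto simp: smoothing_kernel_def)
  have [measurable]: "W \<in> borel_measurable M" using W by simp
  let ?D = "\<lambda>w. \<bar>W w\<bar> * indicator {x. r \<le> dist x x0} (X w)"
  have iD: "integrable M ?D"
    by (rule Bochner_Integration.integrable_bound[where f="W"]) (use W in \<open>auto split: split_indicator\<close>)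
  fix e :: real assume e: "0 < e"
  define E where "E = expectation (\<lambda>w. \<bar>W w\<bar>)"
  have E0: "0 \<le> E" by (simp add: E_def)
  \<comment> \<open>Turns the final bound into \<open>e * E / (E + 1)\<close>, which stays below
    \<open>e\<close> even for \<open>E = 0\<close>.\<close>
  define c where "c = e * r ^ CARD('dx) / (E + 1)"
  have c: "0 < c" using e r E0 by (simp add: c_def)
  have "\<forall>\<^sub>F u in at_infinity. dist (norm u ^ CARD('dx) * k u) 0 < c"
    using k c by (intro tendstoD) (auto simp: smoothing_kernel_def)
  then obtain b where b: "\<And>u. b \<le> norm u \<Longrightarrow> norm u ^ CARD('dx) * k u < c"
    using k0 by (auto simp: eventually_at_infinity)
  \<comment> \<open>A bandwidth this small sends every point at distance at least \<open>r\<close>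
    beyond the threshold \<open>b\<close> after rescaling.\<close>
  have "\<forall>\<^sub>F n in sequentially. 0 < h n \<and> h n < r / (\<bar>b\<bar> + 1)"
    using r by (intro eventually_h_less) (simp add: add_nonneg_pos)
  then show "\<forall>\<^sub>F n in sequentially. dist (kmean k n ?D) 0 < e"
    using eventually_ge_at_top[of 1]
  proof eventually_elim
    case (elim n)
    then have hn: "0 < h n" by simp
    have "h n * (\<bar>b\<bar> + 1) < r" using elim by (simp add: field_simps add_nonneg_pos)
    then have hb: "h n * \<bar>b\<bar> \<le> r" using hn by (simp add: algebra_simps)
    have pt: "kn k n x * indicator {x. r \<le> dist x x0} x \<le> c * h n ^ CARD('dx) / r ^ CARD('dx)" for x
    proof (cases "r \<le> dist x x0")
      case True
      define u where "u = (1 / h n) *\<^sub>R (x - x0)"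
      have nu: "norm u = dist x x0 / h n" using hn by (simp add: u_def dist_norm)
      have ur: "r / h n \<le> norm u" unfolding nu using True hn by (intro divide_right_mono) auto
      have "b \<le> r / h n" 
      proof -
        have "b * h n \<le> \<bar>b\<bar> * h n" using hn by (intro mult_right_mono) auto
        also have "\<dots> \<le> r" using hb by (simp add: mult.commute)
        finally show ?thesis using hn by (simp add: pos_le_divide_eq)
      qed
      then have "norm u ^ CARD('dx) * k u < c" using ur by (intro b) linarith
      moreover have "(r / h n) ^ CARD('dx) * k u \<le> norm u ^ CARD('dx) * k u"
        using ur r hn k0 by (intro mult_right_mono power_mono) auto
      ultimately have "(r / h n) ^ CARD('dx) * k u \<le> c" by linarith
      then have "k u \<le> c * h n ^ CARD('dx) / r ^ CARD('dx)"
        using r hn by (simp add: power_divide field_simps)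
      then show ?thesis using True by (simp add: kn_def u_def)
    next
      case False
      then show ?thesis using c hn r by simp
    qed
    have "expectation (\<lambda>w. kn k n (X w) * ?D w) \<le>
        expectation (\<lambda>w. c * h n ^ CARD('dx) / r ^ CARD('dx) * \<bar>W w\<bar>)"
    proof (intro integral_mono kn_integrable k iD)
      fix w
      have "kn k n (X w) * ?D w = kn k n (X w) * indicator {x. r \<le> dist x x0} (X w) * \<bar>W w\<bar>" by simp
      also have "\<dots> \<le> c * h n ^ CARD('dx) / r ^ CARD('dx) * \<bar>W w\<bar>"
        using pt by (intro mult_right_mono) auto
      finally show "kn k n (X w) * ?D w \<le> c * h n ^ CARD('dx) / r ^ CARD('dx) * \<bar>W w\<bar>" .
    qed (use W in auto)
    also have "\<dots> = c * h n ^ CARD('dx) / r ^ CARD('dx) * E" by (simp add: E_def)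
    finally have "kmean k n ?D \<le> c * h n ^ CARD('dx) / r ^ CARD('dx) * E / h n ^ CARD('dx)"
      unfolding kmean_def using hn by (intro divide_right_mono) auto
    also have "\<dots> = e * (E / (E + 1))" using hn r by (simp add: c_def)
    also have "\<dots> < e * 1" using e E0 by (intro mult_strict_left_mono) (auto simp: field_simps)
    finally show ?case using kmean_nonneg[OF k elim(2), of ?D] by simp
  qed
qed

text \<open>After the substitution \<open>x = x0 + h n * u\<close> the integrand converges pointwise
  by continuity at \<open>x0\<close>. Boundedness of \<open>g * p\<close> on the ball provides the
  integrable majorant \<open>B * k\<close>.\<close>

lemma kmean_near:
  assumes k: "smoothing_kernel k" and [measurable]: "g \<in> borel_measurable borel" and gc: "isCont g x0" and r: "0 < r"
    and B: "\<And>x. x \<in> ball x0 r \<Longrightarrow> \<bar>g x * p x\<bar> \<le> B"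
  shows "(\<lambda>n. kmean k n (\<lambda>w. g (X w) * indicator (ball x0 r) (X w))) \<longlonglongrightarrow> g x0 * p x0 * integral\<^sup>L lborel k"
proof -
  have [measurable]: "k \<in> borel_measurable borel" and k0: "\<And>u. 0 \<le> k u" and ki: "integrable lborel k"
    using k by (auto simp: smoothing_kernel_def)
  have B0: "0 \<le> B" using B[of x0] r by fastforce
  have [measurable]: "ball x0 r \<in> sets borel" by simp
  define q where "q x = g x * p x * indicator (ball x0 r) x" for x
  have [measurable]: "q \<in> borel_measurable borel" unfolding q_def[abs_def] by measurable
  have qB: "\<bar>q x\<bar> \<le> B" for x using B B0 by (auto simp: q_def split: split_indicator)
  have qc: "isCont q x0"
  proof -
    have "\<forall>\<^sub>F x in nhds x0. q x = g x * p x"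
      using eventually_nhds_in_open[of "ball x0 r" x0] r
      by (auto simp: q_def elim!: eventually_mono)
    from isCont_cong[OF this] show ?thesis using gc p_cont by simp
  qed
  have "(\<lambda>n. LINT u|lborel. k u * q (x0 + h n *\<^sub>R u)) \<longlonglongrightarrow> (LINT u|lborel. k u * q x0)"
  proof (rule integral_dominated_convergence[where w="\<lambda>u. k u * B"])
    show "AE u in lborel. (\<lambda>n. k u * q (x0 + h n *\<^sub>R u)) \<longlonglongrightarrow> k u * q x0"
    proof (intro AE_I2 tendsto_mult tendsto_const)
      fix u
      have "(\<lambda>n. x0 + h n *\<^sub>R u) \<longlonglongrightarrow> x0 + 0 *\<^sub>R u" by (intro tendsto_intros h_lim)
      then show "(\<lambda>n. q (x0 + h n *\<^sub>R u)) \<longlonglongrightarrow> q x0"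
        by (intro isCont_tendsto_compose[OF qc]) simp
    qed
    show "AE u in lborel. norm (k u * q (x0 + h n *\<^sub>R u)) \<le> k u * B" for n
      using qB k0 by (auto simp: abs_mult intro!: mult_left_mono)
  qed (use ki in auto)
  also have "(LINT u|lborel. k u * q x0) = g x0 * p x0 * integral\<^sup>L lborel k"
    using r by (simp add: q_def)
  finally show ?thesis
  proof (rule Lim_transform_eventually)
    show "\<forall>\<^sub>F n in sequentially. (LINT u|lborel. k u * q (x0 + h n *\<^sub>R u)) =
        kmean k n (\<lambda>w. g (X w) * indicator (ball x0 r) (X w))"
      using eventually_ge_at_top[of 1]
    proof eventually_elim
      case (elim n)
      have hn: "0 < h n" by (rule h_pos[OF elim])
      have "expectation (\<lambda>w. kn k n (X w) * (g (X w) * indicator (ball x0 r) (X w))) =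
          (LINT x|lborel. p x * (kn k n x * (g x * indicator (ball x0 r) x)))"
        by (subst distributed_integral[OF X_density, symmetric]) (auto simp: p_nonneg)
      also have "\<dots> = (LINT x|lborel. kn k n x * q x)"
        by (intro Bochner_Integration.integral_cong) (auto simp: q_def)
      also have "\<dots> = h n ^ CARD('dx) * (LINT u|lborel. k u * q (x0 + h n *\<^sub>R u))"
        using hn by (subst lborel_integral_affine[where c="h n" and t=x0]) (auto simp: kn_def)
      finally show ?case using hn by (simp add: kmean_def)
    qed
  qed
qed

section \<open>Conditional means given X\<close>

lemma subalgebra_sigma_gen: "subalgebra M (sigma_gen M X)"
  unfolding subalgebra_def
  by (auto simp: sets_vimage_algebra2 space_vimage_algebra intro!: measurable_sets[OF X_meas, simplified])

lemma cond_mean_const: "cond_mean M X (\<lambda>_. c) (\<lambda>_. c)"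
proof -
  interpret finite_measure_subalgebra M "sigma_gen M X" by standard (rule subalgebra_sigma_gen)
  show ?thesis unfolding cond_mean_def using real_cond_exp_F_meas[of "\<lambda>_. c"] by auto
qed

lemma cond_mean_add:
  assumes "cond_mean M X W g" "cond_mean M X W' g'"
  shows "cond_mean M X (\<lambda>w. W w + W' w) (\<lambda>x. g x + g' x)"
proof -
  interpret finite_measure_subalgebra M "sigma_gen M X" by standard (rule subalgebra_sigma_gen)
  have i: "integrable M W" "integrable M W'" using assms by (auto simp: cond_mean_def)
  have "AE w in M. real_cond_exp M (sigma_gen M X) W w = g (X w)"
    "AE w in M. real_cond_exp M (sigma_gen M X) W' w = g' (X w)"
    using assms by (auto simp: cond_mean_def)
  with real_cond_exp_add[OF i] have
    "AE w in M. real_cond_exp M (sigma_gen M X) (\<lambda>w. W w + W' w) w = g (X w) + g' (X w)"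
    by eventually_elim simp
  then show ?thesis using assms by (auto simp: cond_mean_def)
qed

lemma cond_mean_cmult:
  assumes "cond_mean M X W g"
  shows "cond_mean M X (\<lambda>w. c * W w) (\<lambda>x. c * g x)"
proof -
  interpret finite_measure_subalgebra M "sigma_gen M X" by standard (rule subalgebra_sigma_gen)
  have i: "integrable M W" using assms by (auto simp: cond_mean_def)
  have "AE w in M. real_cond_exp M (sigma_gen M X) W w = g (X w)"
    using assms by (auto simp: cond_mean_def)
  with real_cond_exp_cmult[OF i, of c] have
    "AE w in M. real_cond_exp M (sigma_gen M X) (\<lambda>w. c * W w) w = c * g (X w)"
    by eventually_elim simp
  then show ?thesis using assms by (auto simp: cond_mean_def)
qed

text \<open>The characterizing property of a conditional mean, tested against bounded functions of
  \<open>X\<close>; the tests used below are kernel values times indicators.\<close>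

lemma cond_mean_intg:
  assumes g: "cond_mean M X W g" and [measurable]: "\<psi> \<in> borel_measurable borel" and B: "\<And>x. \<bar>\<psi> x\<bar> \<le> B"
  shows "integrable M (\<lambda>w. \<psi> (X w) * g (X w))"
    "expectation (\<lambda>w. \<psi> (X w) * W w) = expectation (\<lambda>w. \<psi> (X w) * g (X w))"
proof -
  have W: "integrable M W" and [measurable]: "g \<in> borel_measurable borel" using g by (auto simp: cond_mean_def)
  interpret finite_measure_subalgebra M "sigma_gen M X" by standard (rule subalgebra_sigma_gen)
  have XF: "X \<in> measurable (sigma_gen M X) borel" by (rule measurable_vimage_algebra1) simp
  have \<psi>F: "(\<lambda>w. \<psi> (X w)) \<in> borel_measurable (sigma_gen M X)"
    by (rule measurable_compose[OF XF]) simp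
  have [measurable]: "W \<in> borel_measurable M" using W by simp
  have i: "integrable M (\<lambda>w. \<psi> (X w) * W w)"
    by (rule Bochner_Integration.integrable_bound[where f="\<lambda>w. \<bar>B\<bar> * W w"])
      (use W B in \<open>auto simp: abs_mult intro!: mult_right_mono AE_I2 order_trans[OF B]\<close>)
  note * = real_cond_exp_intg[OF i \<psi>F]
  have AE: "AE w in M. \<psi> (X w) * real_cond_exp M (sigma_gen M X) W w = \<psi> (X w) * g (X w)"
    using g by (auto simp: cond_mean_def elim!: eventually_mono)
  show "integrable M (\<lambda>w. \<psi> (X w) * g (X w))"
    using * AE by (subst integrable_cong_AE[symmetric]) auto
  show "expectation (\<lambda>w. \<psi> (X w) * W w) = expectation (\<lambda>w. \<psi> (X w) * g (X w))"
    using * AE by (subst integral_cong_AE[of _ _ "\<lambda>w. \<psi> (X w) * real_cond_exp M (sigma_gen M X) W w"]) auto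
qed

text \<open>Bochner's lemma in conditional form. Conditioning replaces \<open>W\<close> by
  \<open>g\<close> only on a ball around \<open>x0\<close>; outside it \<open>g\<close> need not be
  bounded, and \<open>W\<close> itself is handled by \<open>kmean_far\<close>. Continuity at the
  single point \<open>x0\<close> selects the value \<open>g x0\<close> although \<open>g\<close> is
  only a version.\<close>

theorem kmean_tendsto:
  assumes k: "smoothing_kernel k" and g: "cond_mean M X W g" and gc: "isCont g x0"
  shows "(\<lambda>n. kmean k n W) \<longlonglongrightarrow> g x0 * p x0 * integral\<^sup>L lborel k"
proof -
  have W: "integrable M W" and [measurable]: "g \<in> borel_measurable borel" using g by (auto simp: cond_mean_def)
  have [measurable]: "W \<in> borel_measurable M" using W by simp
  have [measurable]: "k \<in> borel_measurable borel" and k0: "\<And>u. 0 \<le> k u" using k by (auto simp: smoothing_kernel_def)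
  obtain B where B: "\<And>u. k u \<le> B" using k by (auto simp: smoothing_kernel_def)
  define b where "b = \<bar>g x0 * p x0\<bar> + 1"
  have "isCont (\<lambda>x. \<bar>g x * p x\<bar>) x0" using gc p_cont by (intro continuous_intros)
  then have "((\<lambda>x. \<bar>g x * p x\<bar>) \<longlongrightarrow> \<bar>g x0 * p x0\<bar>) (nhds x0)"
    unfolding isCont_def by (rule tendsto_at_iff_tendsto_nhds[where g="\<lambda>x. \<bar>g x * p x\<bar>" and l=x0, THEN iffD1])
  then have "\<forall>\<^sub>F x in nhds x0. \<bar>g x * p x\<bar> < b"
    by (rule order_tendstoD(2)) (simp add: b_def)
  \<comment> \<open>The ball on which continuity at \<open>x0\<close> bounds \<open>g * p\<close>,
    as \<open>kmean_near\<close> demands.\<close>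
  then obtain r where r: "0 < r" "\<And>x. x \<in> ball x0 r \<Longrightarrow> \<bar>g x * p x\<bar> \<le> b"
    unfolding eventually_nhds_metric by (auto simp: dist_commute less_imp_le)
  have [measurable]: "ball x0 r \<in> sets borel" by simp
  define Wn where "Wn w = W w * indicator (ball x0 r) (X w)" for w
  define Wf where "Wf w = W w * indicator {x. r \<le> dist x x0} (X w)" for w
  have [measurable]: "Wn \<in> borel_measurable M" "Wf \<in> borel_measurable M"
    unfolding Wn_def[abs_def] Wf_def[abs_def] by measurable
  have iW: "integrable M Wn" "integrable M Wf"
    by (rule Bochner_Integration.integrable_bound[OF W]; auto simp: Wn_def Wf_def split: split_indicator)+
  have split: "kmean k n W = kmean k n Wn + kmean k n Wf" for n
  proof -
    have "W = (\<lambda>w. Wn w + Wf w)" by (auto simp: Wn_def Wf_def dist_commute split: split_indicator)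
    then show ?thesis using kmean_add[OF k iW] by metis
  qed
  have near: "kmean k n Wn = kmean k n (\<lambda>w. g (X w) * indicator (ball x0 r) (X w))" for n
  proof -
    have "expectation (\<lambda>w. (kn k n (X w) * indicator (ball x0 r) (X w)) * W w) =
        expectation (\<lambda>w. (kn k n (X w) * indicator (ball x0 r) (X w)) * g (X w))"
      using B k0 by (intro cond_mean_intg(2)[OF g, where \<psi>="\<lambda>x. kn k n x * indicator (ball x0 r) x" and B="\<bar>B\<bar>"])
        (auto simp: kn_def split: split_indicator intro: order_trans[OF B])
    then show ?thesis by (simp add: kmean_def Wn_def mult_ac)
  qed
  have "(\<lambda>n. kmean k n Wf) \<longlonglongrightarrow> 0"
  proof (rule Lim_null_comparison[OF _ kmean_far[OF k W r(1)]])
    have "(\<lambda>w. \<bar>Wf w\<bar>) = (\<lambda>w. \<bar>W w\<bar> * indicator {x. r \<le> dist x x0} (X w))"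
      by (auto simp: Wf_def abs_mult)
    then show "\<forall>\<^sub>F n in sequentially. norm (kmean k n Wf) \<le>
        kmean k n (\<lambda>w. \<bar>W w\<bar> * indicator {x. r \<le> dist x x0} (X w))"
      using kmean_abs[OF k, of _ Wf] by (intro eventually_mono[OF eventually_ge_at_top[of 1]]) simp
  qed
  from tendsto_add[OF kmean_near[OF k \<open>g \<in> borel_measurable borel\<close> gc r] this]
  show ?thesis by (simp add: split near)
qed

lemma kmean_one_tendsto:
  assumes k: "smoothing_kernel k"
  shows "(\<lambda>n. kmean k n (\<lambda>_. 1)) \<longlonglongrightarrow> p x0 * integral\<^sup>L lborel k"
  using kmean_tendsto[OF k cond_mean_const[of 1]] by simp

end

section \<open>Limit theorems for kernel sums\<close>

lemma borel_measurable_fst [measurable]: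
  "fst \<in> (borel :: ('b::topological_space \<times> 'c::topological_space) measure) \<rightarrow>\<^sub>M borel"
  by (intro borel_measurable_continuous_onI continuous_intros)

lemma borel_measurable_snd [measurable]:
  "snd \<in> (borel :: ('b::topological_space \<times> 'c::topological_space) measure) \<rightarrow>\<^sub>M borel"
  by (intro borel_measurable_continuous_onI continuous_intros)

context kernel_model begin

text \<open>Uniform integrability of \<open>W\<close> conditionally on \<open>X = x\<close>, for \<open>x\<close> near \<open>x0\<close>, tested against
  weights \<open>\<psi> X\<close>.\<close>

definition locally_ui :: "('w \<Rightarrow> real) \<Rightarrow> bool" where
  "locally_ui W \<longleftrightarrow> (\<exists>r>0. \<forall>e>0. \<exists>L. \<forall>\<psi>\<in>borel_measurable borel. (\<forall>x. 0 \<le> \<psi> x) \<longrightarrow> (\<exists>B. \<forall>x. \<psi> x \<le> B) \<longrightarrow>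
     expectation (\<lambda>w. \<psi> (X w) * (indicator (ball x0 r) (X w) * (\<bar>W w\<bar> * indicator {L<..} \<bar>W w\<bar>)))
       \<le> e * expectation (\<lambda>w. \<psi> (X w)))"

definition ksum :: "(real^'dx \<Rightarrow> real) \<Rightarrow> nat \<Rightarrow> (real^'dy \<Rightarrow> real) \<Rightarrow> 'w \<Rightarrow> real" where
  "ksum k n \<phi> w = (\<Sum>i=1..n. kn k n (xs i w) * \<phi> (ys i w))"

lemma ksum_meas:
  assumes [measurable]: "k \<in> borel_measurable borel" "\<phi> \<in> borel_measurable borel"
  shows "ksum k n \<phi> \<in> borel_measurable M"
  using V_meas_sum[of "\<lambda>v. kn k n (fst v) * \<phi> (snd v)" n] unfolding ksum_def[abs_def] by simp

lemma locally_ui_one: "locally_ui (\<lambda>_. 1)"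
  unfolding locally_ui_def
  by (intro exI[of _ 1] conjI allI impI exI[of _ "1::real"]) (auto intro!: mult_nonneg_nonneg integral_nonneg_AE)

lemma kmean_ui:
  assumes k: "smoothing_kernel k" and W: "integrable M W" and ui: "locally_ui W"
    and L: "filterlim lev at_top sequentially"
  shows "(\<lambda>n. kmean k n (\<lambda>w. \<bar>W w\<bar> * indicator {lev n<..} \<bar>W w\<bar>)) \<longlonglongrightarrow> 0"
proof (rule tendstoI)
  have [measurable]: "k \<in> borel_measurable borel" and k0: "\<And>u. 0 \<le> k u"
    using k by (auto simp: smoothing_kernel_def)
  obtain B where B: "\<And>u. k u \<le> B" using k by (auto simp: smoothing_kernel_def)
  have [measurable]: "W \<in> borel_measurable M" using W by simp
  obtain r where r: "0 < r"
    and ui: "\<And>e. 0 < e \<Longrightarrow> \<exists>L. \<forall>\<psi>\<in>borel_measurable borel. (\<forall>x. 0 \<le> \<psi> x) \<longrightarrow> (\<exists>B. \<forall>x. \<psi> x \<le> B) \<longrightarrow>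
     expectation (\<lambda>w. \<psi> (X w) * (indicator (ball x0 r) (X w) * (\<bar>W w\<bar> * indicator {L<..} \<bar>W w\<bar>)))
       \<le> e * expectation (\<lambda>w. \<psi> (X w))"
    using ui unfolding locally_ui_def by blast
  have [measurable]: "ball x0 r \<in> sets borel" by simp
  fix e :: real assume e: "0 < e"
  \<comment> \<open>Exceeds the limit of \<open>kmean k n (\<lambda>_. 1)\<close>, so eventually the
    near part is at most \<open>e / 2\<close>.\<close>
  define c where "c = p x0 * integral\<^sup>L lborel k + 1"
  have c: "0 < c" unfolding c_def using p_nonneg k0
    by (intro add_nonneg_pos mult_nonneg_nonneg integral_nonneg_AE) auto
  have pos: "0 < e / (2 * c)" using e c by simp
  obtain L where Lui: "\<And>\<psi>. \<psi> \<in> borel_measurable borel \<Longrightarrow> (\<forall>x. 0 \<le> \<psi> x) \<Longrightarrow> (\<exists>B. \<forall>x. \<psi> x \<le> B) \<Longrightarrow>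
     expectation (\<lambda>w. \<psi> (X w) * (indicator (ball x0 r) (X w) * (\<bar>W w\<bar> * indicator {L<..} \<bar>W w\<bar>)))
       \<le> e / (2 * c) * expectation (\<lambda>w. \<psi> (X w))"
    using ui[OF pos] by blast
  let ?far = "\<lambda>w. \<bar>W w\<bar> * indicator {x. r \<le> dist x x0} (X w)"
  let ?near = "\<lambda>w. indicator (ball x0 r) (X w) * (\<bar>W w\<bar> * indicator {L<..} \<bar>W w\<bar>)"
  let ?D = "\<lambda>n w. \<bar>W w\<bar> * indicator {lev n<..} \<bar>W w\<bar>"
  have int: "integrable M ?far" "integrable M ?near" "integrable M (?D n)" for n
    by (rule Bochner_Integration.integrable_bound[OF W]; auto split: split_indicator)+
  have "\<forall>\<^sub>F n in sequentially. kmean k n ?far < e / 2"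
    using e by (intro order_tendstoD(2)[OF kmean_far[OF k W r]]) simp
  moreover have "\<forall>\<^sub>F n in sequentially. kmean k n (\<lambda>_. 1) < c"
    using kmean_one_tendsto[OF k] by (rule order_tendstoD(2)) (simp add: c_def)
  moreover have "\<forall>\<^sub>F n in sequentially. L \<le> lev n"
    using L by (simp add: filterlim_at_top)
  ultimately show "\<forall>\<^sub>F n in sequentially. dist (kmean k n (?D n)) 0 < e"
    using eventually_ge_at_top[of 1]
  proof eventually_elim
    case (elim n)
    have "kmean k n (?D n) \<le> kmean k n (\<lambda>w. ?far w + ?near w)"
      using elim(3) int
      by (intro kmean_mono[OF k _ _ elim(4)] Bochner_Integration.integrable_add)
        (auto simp: dist_commute split: split_indicator)
    also have "\<dots> = kmean k n ?far + kmean k n ?near" by (rule kmean_add[OF k int(1,2)])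
    also have "kmean k n ?near \<le> e / (2 * c) * kmean k n (\<lambda>_. 1)"
    proof -
      have "expectation (\<lambda>w. kn k n (X w) * ?near w) \<le> e / (2 * c) * expectation (\<lambda>w. kn k n (X w))"
        using B k0 by (intro Lui) (auto simp: kn_def)
      then have "expectation (\<lambda>w. kn k n (X w) * ?near w) / h n ^ CARD('dx) \<le>
          e / (2 * c) * expectation (\<lambda>w. kn k n (X w)) / h n ^ CARD('dx)"
        using h_pos[OF elim(4)] by (intro divide_right_mono) auto
      then show ?thesis by (simp add: kmean_def)
    qed
    also have "e / (2 * c) * kmean k n (\<lambda>_. 1) \<le> e / (2 * c) * c"
      using elim(2) e c by (intro mult_left_mono) auto
    also have "\<dots> = e / 2" using c by simp
    finally have "kmean k n (?D n) < e" using elim(1) by linarith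
    moreover have "0 \<le> kmean k n (?D n)" by (rule kmean_nonneg[OF k elim(4)]) simp
    ultimately show ?case by simp
  qed
qed

lemma nhd_pos: "1 \<le> n \<Longrightarrow> 0 < real n * h n ^ CARD('dx)"
  using h_pos[of n] by simp

text \<open>Only first moments are at hand, so the summands are truncated: the truncated sum is
  treated by its variance, the remainder in mean. Uniform integrability makes the remainder small
  although the law of the summands changes with \<open>n\<close>.\<close>

theorem kernel_wlln:
  assumes k: "smoothing_kernel k" and [measurable]: "\<phi> \<in> borel_measurable borel"
    and g: "cond_mean M X (\<lambda>w. \<phi> (Y w)) g" and gc: "isCont g x0"
    and ui: "locally_ui (\<lambda>w. \<phi> (Y w))"
  shows "((\<lambda>q. ksum k (fst q) \<phi> (snd q) / (real (fst q) * h (fst q) ^ CARD('dx))) \<longlongrightarrow>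
      g x0 * p x0 * integral\<^sup>L lborel k) whp"
proof -
  let ?a = "\<lambda>n. real n * h n ^ CARD('dx)"
  have [measurable]: "k \<in> borel_measurable borel" and k0: "\<And>u. 0 \<le> k u"
    using k by (auto simp: smoothing_kernel_def)
  obtain B where B: "\<And>u. k u \<le> B" using k by (auto simp: smoothing_kernel_def)
  have B0: "0 \<le> B" using k0[of 0] B[of 0] by linarith
  have W: "integrable M (\<lambda>w. \<phi> (Y w))" using g by (simp add: cond_mean_def)
  \<comment> \<open>The level grows so slowly that the variance of the truncated average vanishes.\<close>
  define lev where "lev n = sqrt (sqrt (?a n))" for n
  have Ltop: "filterlim lev at_top sequentially"
    unfolding lev_def by (intro filterlim_compose[OF sqrt_at_top] nh_lim)
  define g0 where "g0 n = (\<lambda>v. kn k n (fst v) * \<phi> (snd v))" for n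
  define g1 where "g1 n = (\<lambda>v. kn k n (fst v) * (\<phi> (snd v) * indicator {..lev n} \<bar>\<phi> (snd v)\<bar>))" for n
  define g2 where "g2 n = (\<lambda>v. kn k n (fst v) * (\<phi> (snd v) * indicator {lev n<..} \<bar>\<phi> (snd v)\<bar>))" for n
  have [measurable]: "g0 n \<in> borel_measurable borel" "g1 n \<in> borel_measurable borel" "g2 n \<in> borel_measurable borel" for n
    unfolding g0_def g1_def g2_def by measurable
  have g012: "g0 n v = g1 n v + g2 n v" for n v
    by (auto simp: g0_def g1_def g2_def split: split_indicator)
  define D where "D n = (\<lambda>w. ksum k n \<phi> w / ?a n - kmean k n (\<lambda>w. \<phi> (Y w)))" for n
  \<comment> \<open>First the standard deviation of the truncated average, where the squared level
    equals \<open>sqrt (n * h n ^ d)\<close>; then the remainder, counted twice because its centre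
    is bounded by the same mean.\<close>
  define b where "b n = sqrt (B * kmean k n (\<lambda>_. 1) / sqrt (?a n)) +
      2 * kmean k n (\<lambda>w. \<bar>\<phi> (Y w)\<bar> * indicator {lev n<..} \<bar>\<phi> (Y w)\<bar>)" for n
  have key: "integrable M (D n) \<and> expectation (\<lambda>w. \<bar>D n w\<bar>) \<le> b n" if n: "1 \<le> n" for n
  proof -
    have a: "0 < ?a n" by (rule nhd_pos[OF n])
    have h: "0 < h n" by (rule h_pos[OF n])
    let ?W1 = "\<lambda>w. \<phi> (Y w) * indicator {..lev n} \<bar>\<phi> (Y w)\<bar>"
    let ?W2 = "\<lambda>w. \<phi> (Y w) * indicator {lev n<..} \<bar>\<phi> (Y w)\<bar>"
    have iW: "integrable M ?W1" "integrable M ?W2"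
      by (rule Bochner_Integration.integrable_bound[OF W]; auto split: split_indicator)+
    have i: "integrable M (\<lambda>w. g1 n (X w, Y w))" "integrable M (\<lambda>w. g2 n (X w, Y w))"
      using kn_integrable[OF k iW(1)] kn_integrable[OF k iW(2)] by (simp_all add: g1_def g2_def)
    define m1 where "m1 = expectation (\<lambda>w. g1 n (X w, Y w))"
    define m2 where "m2 = expectation (\<lambda>w. g2 n (X w, Y w))"
    define S1 where "S1 w = (\<Sum>i=1..n. g1 n (xs i w, ys i w)) - real n * m1" for w
    define S2 where "S2 w = (\<Sum>i=1..n. g2 n (xs i w, ys i w)) - real n * m2" for w
    have [measurable]: "S1 \<in> borel_measurable M" "S2 \<in> borel_measurable M"
      using V_meas_sum[of "g1 n" n] V_meas_sum[of "g2 n" n] unfolding S1_def[abs_def] S2_def[abs_def] by auto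
    have "expectation (\<lambda>w. kn k n (X w) * \<phi> (Y w)) = m1 + m2"
      using Bochner_Integration.integral_add[OF i] unfolding m1_def m2_def
      by (simp add: g012[symmetric] g0_def)
    then have kmW: "kmean k n (\<lambda>w. \<phi> (Y w)) = (m1 + m2) / h n ^ CARD('dx)" by (simp add: kmean_def)
    have Deq: "D n w = (S1 w + S2 w) / ?a n" for w
    proof -
      have "ksum k n \<phi> w = (\<Sum>i=1..n. g1 n (xs i w, ys i w)) + (\<Sum>i=1..n. g2 n (xs i w, ys i w))"
        unfolding ksum_def sum.distrib[symmetric] g012[symmetric] by (simp add: g0_def)
      moreover have "kmean k n (\<lambda>w. \<phi> (Y w)) = (real n * m1 + real n * m2) / ?a n"
        unfolding kmW using n h by (simp add: field_simps)
      ultimately show ?thesis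
        unfolding D_def S1_def S2_def by (simp add: add_divide_distrib diff_divide_distrib)
    qed
    have sq_le: "(g1 n (x, y))\<^sup>2 \<le> (B * (lev n)\<^sup>2) * kn k n x" for x y
    proof -
      have "(kn k n x)\<^sup>2 \<le> B * kn k n x"
        unfolding power2_eq_square using B k0 by (intro mult_right_mono) (auto simp: kn_def)
      moreover have "(\<phi> y * indicator {..lev n} \<bar>\<phi> y\<bar>)\<^sup>2 \<le> (lev n)\<^sup>2"
        by (rule power2_le_iff_abs_le[THEN iffD2]) (use a in \<open>auto simp: lev_def split: split_indicator\<close>)
      ultimately have "(kn k n x)\<^sup>2 * (\<phi> y * indicator {..lev n} \<bar>\<phi> y\<bar>)\<^sup>2 \<le> (B * kn k n x) * (lev n)\<^sup>2"
        using B0 k0 by (intro mult_mono mult_nonneg_nonneg) (auto simp: kn_def)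
      then show ?thesis by (simp add: g1_def power_mult_distrib mult_ac)
    qed
    have ikn: "integrable M (\<lambda>w. kn k n (X w))" using kn_integrable[OF k, of "\<lambda>_. 1"] by simp
    have i2: "integrable M (\<lambda>w. (g1 n (X w, Y w))\<^sup>2)"
      by (rule Bochner_Integration.integrable_bound[where f="\<lambda>w. (B * (lev n)\<^sup>2) * kn k n (X w)"])
        (use ikn sq_le in \<open>auto intro!: AE_I2 intro: order_trans[OF _ abs_ge_self]\<close>)
    have "expectation (\<lambda>w. (g1 n (X w, Y w))\<^sup>2) \<le> expectation (\<lambda>w. (B * (lev n)\<^sup>2) * kn k n (X w))"
      using i2 ikn sq_le by (intro integral_mono) auto
    also have "\<dots> = B * sqrt (?a n) * (h n ^ CARD('dx) * kmean k n (\<lambda>_. 1))"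
      using a h by (simp add: kmean_def lev_def)
    finally have v: "expectation (\<lambda>w. (g1 n (X w, Y w))\<^sup>2) \<le> B * sqrt (?a n) * (h n ^ CARD('dx) * kmean k n (\<lambda>_. 1))" .
    have sc: "integrable M (\<lambda>w. (S1 w)\<^sup>2)"
        "expectation (\<lambda>w. (S1 w)\<^sup>2) \<le> real n * expectation (\<lambda>w. (g1 n (X w, Y w))\<^sup>2)"
      using sum_centered_square[of "g1 n" n] i2 unfolding S1_def m1_def by auto
    have iS1: "integrable M S1" using expectation_abs_le_sqrt(1)[of S1] sc by simp
    have "expectation (\<lambda>w. (S1 w)\<^sup>2) \<le> real n * expectation (\<lambda>w. (g1 n (X w, Y w))\<^sup>2)" using sc by simp
    also have "\<dots> \<le> real n * (B * sqrt (?a n) * (h n ^ CARD('dx) * kmean k n (\<lambda>_. 1)))"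
      using v by (intro mult_left_mono) auto
    also have "\<dots> = (B * kmean k n (\<lambda>_. 1) / sqrt (?a n)) * (?a n)\<^sup>2"
    proof -
      have "sqrt (?a n) = ?a n / sqrt (?a n)" using a by (simp add: real_div_sqrt)
      then have "real n * (B * sqrt (?a n) * (h n ^ CARD('dx) * kmean k n (\<lambda>_. 1))) =
         B * (?a n / sqrt (?a n)) * (?a n * kmean k n (\<lambda>_. 1))" by simp
      then show ?thesis by (simp add: power2_eq_square)
    qed
    finally have "sqrt (expectation (\<lambda>w. (S1 w)\<^sup>2)) \<le> sqrt ((B * kmean k n (\<lambda>_. 1) / sqrt (?a n)) * (?a n)\<^sup>2)"
      by (rule real_sqrt_le_mono)
    also have "\<dots> = sqrt (B * kmean k n (\<lambda>_. 1) / sqrt (?a n)) * ?a n"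
    proof -
      have *: "sqrt (c * a\<^sup>2) = sqrt c * a" if "0 < a" for c a :: real
        using that by (simp add: real_sqrt_mult)
      show ?thesis by (rule *[OF a])
    qed
    finally have S1: "expectation (\<lambda>w. \<bar>S1 w\<bar>) \<le> sqrt (B * kmean k n (\<lambda>_. 1) / sqrt (?a n)) * ?a n"
      using expectation_abs_le_sqrt(2)[of S1] sc by simp
    have ic: "integrable M (\<lambda>w. g2 n (xs i w, ys i w))" if "i \<in> {1..n}" for i
      using integrable_copy[of "g2 n" i] i that by auto
    have iS2: "integrable M S2"
      unfolding S2_def[abs_def] using ic by (intro Bochner_Integration.integrable_diff Bochner_Integration.integrable_sum) auto
    have E2: "expectation (\<lambda>w. \<bar>g2 n (X w, Y w)\<bar>) =
        h n ^ CARD('dx) * kmean k n (\<lambda>w. \<bar>\<phi> (Y w)\<bar> * indicator {lev n<..} \<bar>\<phi> (Y w)\<bar>)"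
      using h k0 by (simp add: kmean_def g2_def abs_mult kn_def)
    have "expectation (\<lambda>w. \<bar>S2 w\<bar>) \<le> expectation (\<lambda>w. (\<Sum>i=1..n. \<bar>g2 n (xs i w, ys i w)\<bar>) + real n * \<bar>m2\<bar>)"
    proof (intro integral_mono)
      show "\<bar>S2 w\<bar> \<le> (\<Sum>i=1..n. \<bar>g2 n (xs i w, ys i w)\<bar>) + real n * \<bar>m2\<bar>" for w
        unfolding S2_def by (intro order_trans[OF abs_triangle_ineq4] add_mono sum_abs) (simp add: abs_mult)
    qed (use iS2 ic in \<open>auto intro!: Bochner_Integration.integrable_add Bochner_Integration.integrable_sum\<close>)
    also have "\<dots> = (\<Sum>i=1..n. expectation (\<lambda>w. \<bar>g2 n (xs i w, ys i w)\<bar>)) + real n * \<bar>m2\<bar>"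
      using ic by (subst Bochner_Integration.integral_add)
        (auto simp: prob_space intro!: Bochner_Integration.integrable_sum Bochner_Integration.integral_sum)
    also have "(\<Sum>i=1..n. expectation (\<lambda>w. \<bar>g2 n (xs i w, ys i w)\<bar>)) = (\<Sum>i=1..n. expectation (\<lambda>w. \<bar>g2 n (X w, Y w)\<bar>))"
      using expectation_copy[of "\<lambda>v. \<bar>g2 n v\<bar>"] by (intro sum.cong) auto
    also have "(\<Sum>i=1..n. expectation (\<lambda>w. \<bar>g2 n (X w, Y w)\<bar>)) + real n * \<bar>m2\<bar> \<le>
        (\<Sum>i=1..n. expectation (\<lambda>w. \<bar>g2 n (X w, Y w)\<bar>)) + real n * expectation (\<lambda>w. \<bar>g2 n (X w, Y w)\<bar>)"
      unfolding m2_def by (intro add_left_mono mult_left_mono integral_abs_bound) simp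
    finally have S2: "expectation (\<lambda>w. \<bar>S2 w\<bar>) \<le>
        2 * kmean k n (\<lambda>w. \<bar>\<phi> (Y w)\<bar> * indicator {lev n<..} \<bar>\<phi> (Y w)\<bar>) * ?a n"
      by (simp add: E2 mult_ac)
    have iD: "integrable M (D n)" unfolding Deq[abs_def] using iS1 iS2 by simp
    have "expectation (\<lambda>w. \<bar>D n w\<bar>) \<le> expectation (\<lambda>w. (\<bar>S1 w\<bar> + \<bar>S2 w\<bar>) / ?a n)"
      using iD iS1 iS2 a by (intro integral_mono) (auto simp: Deq divide_right_mono)
    also have "\<dots> = (expectation (\<lambda>w. \<bar>S1 w\<bar>) + expectation (\<lambda>w. \<bar>S2 w\<bar>)) / ?a n" using iS1 iS2 by simp
    also have "\<dots> \<le> (b n * ?a n) / ?a n"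
      using S1 S2 a unfolding b_def by (intro divide_right_mono) (auto simp: distrib_right)
    also have "\<dots> = b n" using a by (intro nonzero_mult_div_cancel_right) linarith
    finally show ?thesis using iD by blast
  qed
  have t1: "(\<lambda>n. B * kmean k n (\<lambda>_. 1)) \<longlonglongrightarrow> B * (p x0 * integral\<^sup>L lborel k)"
    by (rule tendsto_mult[OF tendsto_const kmean_one_tendsto[OF k]])
  have t2: "filterlim (\<lambda>n. sqrt (?a n)) at_infinity sequentially"
    by (rule filterlim_at_top_imp_at_infinity[OF filterlim_compose[OF sqrt_at_top nh_lim]])
  have "b \<longlonglongrightarrow> sqrt 0 + 2 * 0"
    unfolding b_def[abs_def]
    by (rule tendsto_add[OF tendsto_real_sqrt[OF tendsto_divide_0[OF t1 t2]]
      tendsto_mult[OF tendsto_const kmean_ui[OF k W ui Ltop]]])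
  then have b0: "b \<longlonglongrightarrow> 0" by simp
  have "(\<lambda>n. expectation (\<lambda>w. \<bar>D n w\<bar>)) \<longlonglongrightarrow> 0"
  proof (rule Lim_null_comparison[OF _ b0])
    show "\<forall>\<^sub>F n in sequentially. norm (expectation (\<lambda>w. \<bar>D n w\<bar>)) \<le> b n"
      by (rule eventually_mono[OF eventually_ge_at_top[of 1]]) (use key in auto)
  qed
  moreover have "\<forall>\<^sub>F n in sequentially. integrable M (D n)"
    by (rule eventually_mono[OF eventually_ge_at_top[of 1]]) (use key in auto)
  ultimately have "((\<lambda>q. D (fst q) (snd q)) \<longlongrightarrow> 0) whp" by (intro tendsto_whp_markov)
  from tendsto_add[OF this tendsto_whp_fst[OF kmean_tendsto[OF k g gc]]]
  show ?thesis by (simp add: D_def)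
qed

text \<open>The limit variance is a smoothed mean with kernel \<open>k^2\<close>. Since
  \<open>k\<close> is bounded, a summand exceeding \<open>e\<close> forces \<open>\<phi>^2\<close>
  above a level of order \<open>n * h n ^ d\<close>, so the Lindeberg condition reduces to
  \<open>kmean_ui\<close>.\<close>

theorem kernel_clt_char:
  assumes k: "smoothing_kernel k" and [measurable]: "\<phi> \<in> borel_measurable borel"
    and g: "cond_mean M X (\<lambda>w. (\<phi> (Y w))\<^sup>2) g" and gc: "isCont g x0"
    and ui: "locally_ui (\<lambda>w. (\<phi> (Y w))\<^sup>2)"
    and bias: "(\<lambda>n. sqrt (real n * h n ^ CARD('dx)) * kmean k n (\<lambda>w. \<phi> (Y w))) \<longlonglongrightarrow> 0"
  shows "(\<lambda>n. char (distr M borel (\<lambda>w. ksum k n \<phi> w / sqrt (real n * h n ^ CARD('dx)))) t) \<longlonglongrightarrow>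
    exp (- (t\<^sup>2 * (g x0 * p x0 * (LINT u|lborel. (k u)\<^sup>2)) / 2))"
proof -
  let ?a = "\<lambda>n. real n * h n ^ CARD('dx)"
  have [measurable]: "k \<in> borel_measurable borel" and k0: "\<And>u. 0 \<le> k u"
    using k by (auto simp: smoothing_kernel_def)
  obtain B where B: "\<And>u. k u \<le> B" using k by (auto simp: smoothing_kernel_def)
  have B0: "0 \<le> B" using k0[of 0] B[of 0] by linarith
  note k2 = kernel_square[OF k]
  have W2: "integrable M (\<lambda>w. (\<phi> (Y w))\<^sup>2)" using g by (simp add: cond_mean_def)
  define G where "G n = (\<lambda>v. kn k n (fst v) * \<phi> (snd v) / sqrt (?a n))" for n
  have [measurable]: "G n \<in> borel_measurable borel" for n unfolding G_def by measurable
  have sq: "(G n (x, y))\<^sup>2 = kn (\<lambda>u. (k u)\<^sup>2) n x * (\<phi> y)\<^sup>2 / ?a n" if "1 \<le> n" for n x y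
    using nhd_pos[OF that] by (simp add: G_def kn_def power_divide power_mult_distrib)
  have "(\<lambda>n. char (distr M borel (\<lambda>w. \<Sum>i=1..n. G n (xs i w, ys i w))) t) \<longlonglongrightarrow>
      exp (- (t\<^sup>2 * (g x0 * p x0 * (LINT u|lborel. (k u)\<^sup>2)) / 2))"
  proof (rule triangular_clt_char)
    show "integrable M (\<lambda>w. (G n (X w, Y w))\<^sup>2)" for n
    proof (cases "1 \<le> n")
      case True
      show ?thesis unfolding sq[OF True] using kn_integrable[OF k2 W2] by simp
    next
      case False
      \<comment> \<open>Here the normalization is \<open>sqrt 0\<close>, and division by zero makes
        \<open>G 0\<close> vanish.\<close>
      then have "n = 0" by simp
      then show ?thesis by (simp add: G_def)
    qed
    show "(\<lambda>n. real n * expectation (\<lambda>w. G n (X w, Y w))) \<longlonglongrightarrow> 0"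
      using bias
    proof (rule Lim_transform_eventually)
      show "\<forall>\<^sub>F n in sequentially. sqrt (?a n) * kmean k n (\<lambda>w. \<phi> (Y w)) = real n * expectation (\<lambda>w. G n (X w, Y w))"
        using eventually_ge_at_top[of 1]
      proof eventually_elim
        case (elim n)
        note a = nhd_pos[OF elim]
        have s: "sqrt (?a n) = ?a n / sqrt (?a n)" using a by (simp add: real_div_sqrt)
        have "sqrt (?a n) * kmean k n (\<lambda>w. \<phi> (Y w)) = ?a n / sqrt (?a n) * kmean k n (\<lambda>w. \<phi> (Y w))"
          using s by simp
        then show ?case using h_pos[OF elim] by (simp add: G_def kmean_def)
      qed
    qed
    show "(\<lambda>n. real n * expectation (\<lambda>w. (G n (X w, Y w))\<^sup>2)) \<longlonglongrightarrow> g x0 * p x0 * (LINT u|lborel. (k u)\<^sup>2)"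
      using kmean_tendsto[OF k2 g gc]
    proof (rule Lim_transform_eventually)
      show "\<forall>\<^sub>F n in sequentially. kmean (\<lambda>u. (k u)\<^sup>2) n (\<lambda>w. (\<phi> (Y w))\<^sup>2) = real n * expectation (\<lambda>w. (G n (X w, Y w))\<^sup>2)"
        using eventually_ge_at_top[of 1]
        by eventually_elim (simp add: sq kmean_def)
    qed
    fix e :: real assume e: "0 < e"
    \<comment> \<open>Obtained by solving
      \<open>e < (B + 1) * |\<phi> y| / sqrt (n * h n ^ d)\<close> for \<open>(\<phi> y)^2\<close>;
      the factor \<open>B + 1\<close> is positive also when \<open>B = 0\<close>.\<close>
    define lev where "lev n = e\<^sup>2 / (B + 1)\<^sup>2 * ?a n" for n
    have Ltop: "filterlim lev at_top sequentially"
      unfolding lev_def using e B0 by (intro filterlim_tendsto_pos_mult_at_top[OF tendsto_const _ nh_lim]) auto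
    show "(\<lambda>n. real n * expectation (\<lambda>w. (G n (X w, Y w))\<^sup>2 * indicator {x. e < \<bar>x\<bar>} (G n (X w, Y w)))) \<longlonglongrightarrow> 0"
    proof (rule Lim_null_comparison[OF _ kmean_ui[OF k2 W2 ui Ltop]])
      show "\<forall>\<^sub>F n in sequentially.
          norm (real n * expectation (\<lambda>w. (G n (X w, Y w))\<^sup>2 * indicator {x. e < \<bar>x\<bar>} (G n (X w, Y w))))
          \<le> kmean (\<lambda>u. (k u)\<^sup>2) n (\<lambda>w. \<bar>(\<phi> (Y w))\<^sup>2\<bar> * indicator {lev n<..} \<bar>(\<phi> (Y w))\<^sup>2\<bar>)"
        using eventually_ge_at_top[of 1]
      proof eventually_elim
        case (elim n)
        note a = nhd_pos[OF elim]
        let ?W = "\<lambda>w. \<bar>(\<phi> (Y w))\<^sup>2\<bar> * indicator {lev n<..} \<bar>(\<phi> (Y w))\<^sup>2\<bar>"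
        have iW: "integrable M ?W"
          by (rule Bochner_Integration.integrable_bound[OF W2]) (auto split: split_indicator)
        have ind: "e < \<bar>G n (x, y)\<bar> \<Longrightarrow> lev n < (\<phi> y)\<^sup>2" for x y
        proof -
          assume "e < \<bar>G n (x, y)\<bar>"
          also have "\<dots> = kn k n x * \<bar>\<phi> y\<bar> / sqrt (?a n)" using a k0 by (simp add: G_def abs_mult kn_def)
          also have "\<dots> \<le> (B + 1) * \<bar>\<phi> y\<bar> / sqrt (?a n)"
            using a B by (intro divide_right_mono mult_right_mono) (auto simp: kn_def intro: order_trans[OF B])
          finally have "e * sqrt (?a n) < (B + 1) * \<bar>\<phi> y\<bar>" using a by (simp add: pos_less_divide_eq)
          then have "(e * sqrt (?a n))\<^sup>2 < ((B + 1) * \<bar>\<phi> y\<bar>)\<^sup>2"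
            using e a by (intro power_strict_mono) auto
          then have "e\<^sup>2 * ?a n < (B + 1)\<^sup>2 * (\<phi> y)\<^sup>2" using a by (simp add: power_mult_distrib)
          then show ?thesis using B0 by (simp add: lev_def field_simps)
        qed
        have "expectation (\<lambda>w. (G n (X w, Y w))\<^sup>2 * indicator {x. e < \<bar>x\<bar>} (G n (X w, Y w)))
            \<le> expectation (\<lambda>w. kn (\<lambda>u. (k u)\<^sup>2) n (X w) * ?W w / ?a n)"
        proof (rule integral_mono')
          show "integrable M (\<lambda>w. kn (\<lambda>u. (k u)\<^sup>2) n (X w) * ?W w / ?a n)"
            using kn_integrable[OF k2 iW] by simp
          show "(G n (X w, Y w))\<^sup>2 * indicator {x. e < \<bar>x\<bar>} (G n (X w, Y w)) \<le> kn (\<lambda>u. (k u)\<^sup>2) n (X w) * ?W w / ?a n" for w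
            using ind[of "X w" "Y w"] a unfolding sq[OF elim] by (auto simp: kn_def split: split_indicator)
          show "0 \<le> kn (\<lambda>u. (k u)\<^sup>2) n (X w) * ?W w / ?a n" for w
            using a by (auto simp: kn_def intro!: divide_nonneg_nonneg mult_nonneg_nonneg)
        qed
        then have "real n * expectation (\<lambda>w. (G n (X w, Y w))\<^sup>2 * indicator {x. e < \<bar>x\<bar>} (G n (X w, Y w)))
            \<le> real n * expectation (\<lambda>w. kn (\<lambda>u. (k u)\<^sup>2) n (X w) * ?W w / ?a n)" by (intro mult_left_mono) auto
        also have "\<dots> = kmean (\<lambda>u. (k u)\<^sup>2) n ?W" using elim by (simp add: kmean_def)
        finally show ?case by (simp add: abs_mult)
      qed
    qed
  qed auto
  then show ?thesis by (simp add: G_def ksum_def sum_divide_distrib)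
qed

end

section \<open>Minimizers of the kernel estimate\<close>

text \<open>The smoothing bias enters only through the deterministic bound \<open>b\<close>, uniform
  in the decision, which separates the stochastic argument from the Taylor expansion. Minimality of
  \<open>zhat\<close> is demanded only where the kernel sum is nonzero: otherwise all weights are
  zero and the estimate is constant in the decision.\<close>

locale nw_minimization =
  kernel_model M X Y xs ys p x0 h
  for M :: "'w measure" and X :: "'w \<Rightarrow> real^'dx" and Y :: "'w \<Rightarrow> real^'dy"
    and xs :: "nat \<Rightarrow> 'w \<Rightarrow> real^'dx" and ys :: "nat \<Rightarrow> 'w \<Rightarrow> real^'dy" and p x0 h +
  fixes K :: "real^'dx \<Rightarrow> real" and F :: "real^'dz \<Rightarrow> real^'dy \<Rightarrow> real"
    and f :: "real^'dz \<Rightarrow> real^'dx \<Rightarrow> real" and \<Z> :: "(real^'dz) set" and \<Y> :: "(real^'dy) set"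
    and C :: real and g2 :: "real^'dx \<Rightarrow> real" and b :: "nat \<Rightarrow> real"
    and zstar :: "real^'dz" and zhat :: "nat \<Rightarrow> 'w \<Rightarrow> real^'dz"
  assumes K: "smoothing_kernel K" and K_mass: "0 < integral\<^sup>L lborel K" and p_pos: "0 < p x0"
    and F_meas: "(\<lambda>(z, y). F z y) \<in> borel_measurable borel"
    and Z_compact: "compact \<Z>" and C_pos: "0 < C"
    and Y_in: "AE w in M. Y w \<in> \<Y>" and Y_sets: "\<Y> \<in> sets borel"
    and F_lip: "\<And>y z z'. y \<in> \<Y> \<Longrightarrow> z \<in> \<Z> \<Longrightarrow> z' \<in> \<Z> \<Longrightarrow> \<bar>F z y - F z' y\<bar> \<le> C * dist z z'"
    and f_cond: "\<And>z. z \<in> \<Z> \<Longrightarrow> cond_mean M X (\<lambda>w. F z (Y w)) (f z)"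
    and f_cont: "\<And>z. z \<in> \<Z> \<Longrightarrow> isCont (f z) x0"
    and F2_cond: "cond_mean M X (\<lambda>w. (F zstar (Y w))\<^sup>2) g2" and g2_cont: "isCont g2 x0"
    and ui1: "\<And>z. z \<in> \<Z> \<Longrightarrow> locally_ui (\<lambda>w. F z (Y w))"
    and ui2: "\<And>c. locally_ui (\<lambda>w. (F zstar (Y w) - c)\<^sup>2)"
    and b_lim: "b \<longlonglongrightarrow> 0"
    and bias: "\<And>n z. 1 \<le> n \<Longrightarrow> z \<in> \<Z> \<Longrightarrow>
      \<bar>sqrt (real n * h n ^ CARD('dx)) * kmean K n (\<lambda>w. F z (Y w) - f z x0)\<bar> \<le> b n"
    and zstar: "unique_minimizer \<Z> (\<lambda>z. f z x0) zstar"
    and zhat_meas [measurable]: "\<And>n. zhat n \<in> borel_measurable M"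
    and zhat_min: "\<And>n. n \<ge> 1 \<Longrightarrow> AE w in M.
          (\<Sum>j=1..n. K ((1 / h n) *\<^sub>R (xs j w - x0))) \<noteq> 0 \<longrightarrow>
          unique_minimizer \<Z> (cost_hat K h xs ys F x0 n w) (zhat n w)"
    and nondegenerate: "g2 x0 - (f zstar x0)\<^sup>2 > 0"
begin

abbreviation (input) "f0 z \<equiv> f z x0"
abbreviation (input) "fhat n w z \<equiv> cost_hat K h xs ys F x0 n w z"

definition S :: "nat \<Rightarrow> 'w \<Rightarrow> real" where "S n w = ksum K n (\<lambda>_. 1) w"

text \<open>Defined as a kernel sum, hence a sum of independent terms without a random denominator;
  \<open>U_eq\<close> recovers the error of \<open>fhat\<close> where \<open>S n\<close> is
  positive.\<close>

definition U :: "nat \<Rightarrow> real^'dz \<Rightarrow> 'w \<Rightarrow> real" where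
  "U n z w = ksum K n (\<lambda>y. F z y - f0 z) w / sqrt (real n * h n ^ CARD('dx))"

text \<open>The pathwise conditions under which the comparison arguments are valid; they hold
  eventually along \<open>whp\<close>.\<close>

definition regular :: "nat \<Rightarrow> 'w \<Rightarrow> bool" where
  "regular n w \<longleftrightarrow> 1 \<le> n \<and> 0 < S n w \<and> (\<forall>i\<in>{1..n}. ys i w \<in> \<Y>) \<and>
     unique_minimizer \<Z> (fhat n w) (zhat n w)"

lemma K_meas [measurable]: "K \<in> borel_measurable borel"
  and K_nonneg: "0 \<le> K u"
  using K by (auto simp: smoothing_kernel_def)

lemma F_meas1 [measurable]: "F z \<in> borel_measurable borel"
  using measurable_compose[OF borel_measurable_continuous_onI[of "\<lambda>y. (z, y)"] F_meas]
  by (simp add: continuous_intros)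

lemma zstar_in: "zstar \<in> \<Z>" and zstar_min: "z \<in> \<Z> \<Longrightarrow> f0 zstar \<le> f0 z"
  and zstar_unique: "z \<in> \<Z> \<Longrightarrow> f0 z \<le> f0 zstar \<Longrightarrow> z = zstar"
proof -
  show in': "zstar \<in> \<Z>" using zstar by (auto simp: unique_minimizer_def is_arg_min_def)
  show min: "f0 zstar \<le> f0 z" if "z \<in> \<Z>" for z
    using zstar that by (auto simp: unique_minimizer_def is_arg_min_linorder)
  show "z = zstar" if "z \<in> \<Z>" "f0 z \<le> f0 zstar"
    using zstar that min by (auto simp: unique_minimizer_def is_arg_min_linorder intro: order_trans)
qed

lemma F_int: "z \<in> \<Z> \<Longrightarrow> integrable M (\<lambda>w. F z (Y w))"
  using f_cond by (simp add: cond_mean_def)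

lemma kn_nonneg: "0 \<le> kn K n x"
  by (simp add: kn_def K_nonneg)

lemma S_eq: "S n w = (\<Sum>i=1..n. kn K n (xs i w))"
  by (simp add: S_def ksum_def)

lemma weight_eq: "nw_weight K h xs x0 n w i = kn K n (xs i w) / S n w"
  by (simp add: nw_weight_def S_eq kn_def)

lemma fhat_eq: "fhat n w z = ksum K n (F z) w / S n w"
  by (simp add: cost_hat_def weight_eq ksum_def sum_divide_distrib)

lemma U_eq:
  assumes "0 < S n w"
  shows "U n z w = S n w * (fhat n w z - f0 z) / sqrt (real n * h n ^ CARD('dx))"
proof -
  have "ksum K n (\<lambda>y. F z y - f0 z) w = ksum K n (F z) w - S n w * f0 z"
    unfolding ksum_def S_eq sum_distrib_right right_diff_distrib sum_subtractf ..
  also have "\<dots> = S n w * (fhat n w z - f0 z)" using assms by (simp add: fhat_eq right_diff_distrib)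
  finally show ?thesis by (simp add: U_def)
qed

lemma sum_weight: "0 < S n w \<Longrightarrow> (\<Sum>i=1..n. nw_weight K h xs x0 n w i) = 1"
  unfolding weight_eq sum_divide_distrib[symmetric] S_eq[symmetric] by simp

lemma weight_nonneg: "0 < S n w \<Longrightarrow> 0 \<le> nw_weight K h xs x0 n w i"
  by (simp add: weight_eq kn_nonneg)

lemma weighted_sum_le:
  assumes "0 < S n w" "\<And>i. i \<in> {1..n} \<Longrightarrow> \<bar>u i\<bar> \<le> c"
  shows "\<bar>\<Sum>i=1..n. nw_weight K h xs x0 n w i * u i\<bar> \<le> c"
proof -
  have "\<bar>\<Sum>i=1..n. nw_weight K h xs x0 n w i * u i\<bar> \<le> (\<Sum>i=1..n. \<bar>nw_weight K h xs x0 n w i * u i\<bar>)"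
    by (rule sum_abs)
  also have "\<dots> \<le> (\<Sum>i=1..n. nw_weight K h xs x0 n w i * c)"
    using assms weight_nonneg[OF assms(1)] by (intro sum_mono) (auto simp: abs_mult intro!: mult_left_mono)
  also have "\<dots> = c" by (simp only: sum_distrib_right[symmetric] sum_weight[OF assms(1)] mult_1)
  finally show ?thesis .
qed

lemma fhat_lip:
  assumes "0 < S n w" "\<forall>i\<in>{1..n}. ys i w \<in> \<Y>" "z \<in> \<Z>" "z' \<in> \<Z>"
  shows "\<bar>fhat n w z - fhat n w z'\<bar> \<le> C * dist z z'"
proof -
  have "fhat n w z - fhat n w z' = (\<Sum>i=1..n. nw_weight K h xs x0 n w i * (F z (ys i w) - F z' (ys i w)))"
    by (simp add: cost_hat_def right_diff_distrib sum_subtractf)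
  then show ?thesis using weighted_sum_le[OF assms(1), of "\<lambda>i. F z (ys i w) - F z' (ys i w)"] F_lip assms by auto
qed

text \<open>Since \<open>f z\<close> is a version of a conditional mean, the Lipschitz bound for
  \<open>F\<close> passes to it directly only for almost every \<open>x\<close>. At the given point
  \<open>x0\<close> it is obtained as the limit of the bound for smoothed means.\<close>

lemma f0_lip:
  assumes z: "z \<in> \<Z>" "z' \<in> \<Z>"
  shows "\<bar>f0 z - f0 z'\<bar> \<le> C * dist z z'"
proof -
  let ?I = "p x0 * integral\<^sup>L lborel K"
  have I: "0 < ?I" using p_pos K_mass by simp
  define W where "W w = F z (Y w) + (-1) * F z' (Y w)" for w
  have cm: "cond_mean M X W (\<lambda>x. f z x + (-1) * f z' x)"
    unfolding W_def[abs_def] using z by (intro cond_mean_add cond_mean_cmult f_cond)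
  have iW: "integrable M W" using cm by (simp add: cond_mean_def)
  have ct: "isCont (\<lambda>x. f z x + (-1) * f z' x) x0" using f_cont z by (intro continuous_intros) auto
  have 1: "(\<lambda>n. kmean K n W) \<longlonglongrightarrow> (f0 z + (-1) * f0 z') * p x0 * integral\<^sup>L lborel K"
    by (rule kmean_tendsto[OF K cm ct])
  have 2: "(\<lambda>n. C * dist z z' * kmean K n (\<lambda>_. 1)) \<longlonglongrightarrow> C * dist z z' * ?I"
    by (intro tendsto_mult tendsto_const kmean_one_tendsto K)
  have "AE w in M. \<bar>W w\<bar> \<le> C * dist z z'"
    using Y_in by eventually_elim (use F_lip z in \<open>simp add: W_def\<close>)
  then have "\<forall>\<^sub>F n in sequentially. \<bar>kmean K n W\<bar> \<le> C * dist z z' * kmean K n (\<lambda>_. 1)"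
    by (intro eventually_mono[OF eventually_ge_at_top[of 1]] kmean_abs_le[OF K _ iW]) auto
  then have "\<bar>(f0 z + (-1) * f0 z') * p x0 * integral\<^sup>L lborel K\<bar> \<le> C * dist z z' * ?I"
    by (intro tendsto_le[OF _ 2 tendsto_rabs[OF 1]]) auto
  then have "\<bar>f0 z - f0 z'\<bar> * ?I \<le> C * dist z z' * ?I" using p_pos K_mass by (simp add: abs_mult mult.assoc)
  then show ?thesis using I by (simp only: mult_le_cancel_right_pos)
qed

section \<open>Consistency of the estimate and of its minimizer\<close>

lemma S_tendsto: "((\<lambda>q. S (fst q) (snd q) / (real (fst q) * h (fst q) ^ CARD('dx))) \<longlongrightarrow> p x0 * integral\<^sup>L lborel K) whp"
  using kernel_wlln[OF K _ cond_mean_const[of 1] _ locally_ui_one] by (simp add: S_def)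

lemma a_pos: "\<forall>\<^sub>F q in whp. 1 \<le> fst q \<and> 0 < (real (fst q) * h (fst q) ^ CARD('dx))"
  by (rule eventually_whp_fst[OF eventually_mono[OF eventually_ge_at_top[of 1]]]) (use nhd_pos in auto)

lemma AE_ys: "AE w in M. \<forall>i\<in>{1..n}. ys i w \<in> \<Y>"
proof (rule AE_ball_countable[THEN iffD2])
  show "\<forall>i\<in>{1..n}. AE w in M. ys i w \<in> \<Y>"
  proof
    fix i assume "i \<in> {1..n}"
    then show "AE w in M. ys i w \<in> \<Y>"
      using AE_copy[of "\<lambda>v. snd v \<in> \<Y>" i] Y_in Y_sets by simp
  qed
qed simp

lemma eventually_regular: "\<forall>\<^sub>F q in whp. regular (fst q) (snd q)"
proof -
  have 1: "\<forall>\<^sub>F q in whp. 0 < S (fst q) (snd q) / (real (fst q) * h (fst q) ^ CARD('dx))"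
    using S_tendsto by (rule order_tendstoD) (use p_pos K_mass in simp)
  have "AE w in M. \<forall>i\<in>{1..n}. ys i w \<in> \<Y>" for n by (rule AE_ys)
  then have "\<forall>\<^sub>F n in sequentially. AE w in M. \<forall>i\<in>{1..n}. ys i w \<in> \<Y>" by simp
  note 2 = eventually_whp_AE[OF this]
  have "\<forall>\<^sub>F n in sequentially. AE w in M. (\<Sum>j=1..n. K ((1 / h n) *\<^sub>R (xs j w - x0))) \<noteq> 0 \<longrightarrow>
          unique_minimizer \<Z> (fhat n w) (zhat n w)"
    by (rule eventually_mono[OF eventually_ge_at_top[of 1]]) (rule zhat_min)
  note 3 = eventually_whp_AE[OF this]
  from 1 2 3 a_pos show ?thesis
    by eventually_elim (auto simp: regular_def S_eq kn_def zero_less_divide_iff)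
qed

lemma regularD:
  assumes "regular n w"
  shows "1 \<le> n" "0 < S n w" "\<forall>i\<in>{1..n}. ys i w \<in> \<Y>" "zhat n w \<in> \<Z>" "0 < (real n * h n ^ CARD('dx))"
    "z \<in> \<Z> \<Longrightarrow> fhat n w (zhat n w) \<le> fhat n w z"
  using assms nhd_pos[of n] by (auto simp: regular_def unique_minimizer_def is_arg_min_linorder)

lemma weighted_tendsto:
  assumes [measurable]: "\<phi> \<in> borel_measurable borel" and g: "cond_mean M X (\<lambda>w. \<phi> (Y w)) g" "isCont g x0"
    and "locally_ui (\<lambda>w. \<phi> (Y w))"
  shows "((\<lambda>q. ksum K (fst q) \<phi> (snd q) / S (fst q) (snd q)) \<longlongrightarrow> g x0) whp"
proof -
  let ?I = "p x0 * integral\<^sup>L lborel K"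
  have I: "0 < ?I" using p_pos K_mass by simp
  have "((\<lambda>q. (ksum K (fst q) \<phi> (snd q) / (real (fst q) * h (fst q) ^ CARD('dx))) / (S (fst q) (snd q) / (real (fst q) * h (fst q) ^ CARD('dx)))) \<longlongrightarrow>
      (g x0 * p x0 * integral\<^sup>L lborel K) / ?I) whp"
    using p_pos K_mass by (intro tendsto_divide kernel_wlln[OF K] S_tendsto assms) simp
  then have "((\<lambda>q. (ksum K (fst q) \<phi> (snd q) / (real (fst q) * h (fst q) ^ CARD('dx))) / (S (fst q) (snd q) / (real (fst q) * h (fst q) ^ CARD('dx)))) \<longlongrightarrow> g x0) whp"
    using p_pos K_mass by simp
  then show ?thesis
  proof (rule Lim_transform_eventually)
    have *: "x / A / (y / A) = x / y" if "0 < A" for x y A :: real using that by simp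
    show "\<forall>\<^sub>F q in whp. (ksum K (fst q) \<phi> (snd q) / (real (fst q) * h (fst q) ^ CARD('dx))) /
        (S (fst q) (snd q) / (real (fst q) * h (fst q) ^ CARD('dx))) = ksum K (fst q) \<phi> (snd q) / S (fst q) (snd q)"
      by (rule eventually_mono[OF a_pos]) (elim conjE, rule *)
  qed
qed

lemma fhat_tendsto: "z \<in> \<Z> \<Longrightarrow> ((\<lambda>q. fhat (fst q) (snd q) z) \<longlongrightarrow> f0 z) whp"
  unfolding fhat_eq by (intro weighted_tendsto f_cond f_cont ui1) auto

text \<open>\<open>fhat\<close> and \<open>f0\<close> share the Lipschitz constant \<open>C\<close>,
  so convergence on a finite net of the compact set \<open>\<Z>\<close> is enough.\<close>

lemma fhat_uniform:
  assumes e: "0 < e"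
  shows "\<forall>\<^sub>F q in whp. \<forall>z\<in>\<Z>. \<bar>fhat (fst q) (snd q) z - f0 z\<bar> < e"
proof -
  \<comment> \<open>With this mesh the error on the net and the two displacements are each below
    \<open>e / 4\<close>.\<close>
  have "0 < e / (4 * C)" using e C_pos by simp
  then obtain T where T: "finite T" "T \<subseteq> \<Z>" "\<Z> \<subseteq> (\<Union>t\<in>T. ball t (e / (4 * C)))"
    using Z_compact compactE_image[of \<Z> \<Z> "\<lambda>t. ball t (e / (4 * C))"] by (metis (no_types, lifting) UN_I centre_in_ball open_ball subsetI)
  have "\<forall>\<^sub>F q in whp. \<forall>t\<in>T. dist (fhat (fst q) (snd q) t) (f0 t) < e / 4"
    using T(1)
  proof (rule eventually_ball_finite, intro ballI)
    fix t assume "t \<in> T"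
    then show "\<forall>\<^sub>F q in whp. dist (fhat (fst q) (snd q) t) (f0 t) < e / 4"
      using T(2) e by (intro tendstoD[OF fhat_tendsto]) auto
  qed
  then show ?thesis using eventually_regular
  proof eventually_elim
    case (elim q)
    note r = regularD[OF elim(2)]
    show ?case
    proof
      fix z assume z: "z \<in> \<Z>"
      then obtain t where t: "t \<in> T" "dist t z < e / (4 * C)" using T(3) by auto
      have tZ: "t \<in> \<Z>" using t T(2) by auto
      have Cd: "C * dist z t < e / 4" using t(2) C_pos by (simp add: dist_commute field_simps)
      have "\<bar>fhat (fst q) (snd q) z - fhat (fst q) (snd q) t\<bar> \<le> C * dist z t"
        by (rule fhat_lip[OF r(2,3) z tZ])
      moreover have "\<bar>f0 z - f0 t\<bar> \<le> C * dist z t" by (rule f0_lip[OF z tZ])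
      moreover have "\<bar>fhat (fst q) (snd q) t - f0 t\<bar> < e / 4" using elim(1) t(1) by (simp add: dist_real_def)
      ultimately show "\<bar>fhat (fst q) (snd q) z - f0 z\<bar> < e" using Cd by linarith
    qed
  qed
qed

lemma f0_continuous: "continuous_on \<Z> f0"
  unfolding continuous_on_iff
proof (intro ballI allI impI)
  fix z e :: real and z' assume "z' \<in> \<Z>" "0 < e"
  then show "\<exists>d>0. \<forall>x\<in>\<Z>. dist x z' < d \<longrightarrow> dist (f0 x) (f0 z') < e"
    using C_pos by (intro exI[of _ "e / C"])
      (auto simp: dist_real_def field_simps intro: le_less_trans[OF f0_lip])
qed

lemma zhat_tendsto: "((\<lambda>q. dist (zhat (fst q) (snd q)) zstar) \<longlongrightarrow> 0) whp"
proof (rule tendstoI)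
  fix r :: real assume r: "0 < r"
  define Z' where "Z' = \<Z> - ball zstar r"
  have cZ': "compact Z'" unfolding Z'_def using Z_compact by (intro compact_diff) auto
  \<comment> \<open>By compactness and uniqueness, decisions outside the ball exceed the optimal
    value by a fixed amount. Uniform error below \<open>gap / 2\<close> then keeps the minimizer of
    \<open>fhat\<close> inside the ball.\<close>
  obtain gap where gap: "0 < gap" "\<And>z. z \<in> Z' \<Longrightarrow> f0 zstar + gap \<le> f0 z"
  proof (cases "Z' = {}")
    case True
    then show ?thesis using that[of 1] by auto
  next
    case False
    obtain w where w: "w \<in> Z'" "\<forall>z\<in>Z'. f0 w \<le> f0 z"
      using continuous_attains_inf[OF cZ' False continuous_on_subset[OF f0_continuous]] unfolding Z'_def by blast
    have "f0 zstar < f0 w"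
    proof (rule ccontr)
      assume "\<not> ?thesis"
      then have "w = zstar" using w(1) by (intro zstar_unique) (auto simp: Z'_def)
      then show False using w(1) r by (simp add: Z'_def)
    qed
    then show ?thesis using w(2) by (intro that[of "f0 w - f0 zstar"]) auto
  qed
  have "\<forall>\<^sub>F q in whp. \<forall>z\<in>\<Z>. \<bar>fhat (fst q) (snd q) z - f0 z\<bar> < gap / 2"
    using gap by (intro fhat_uniform) simp
  then show "\<forall>\<^sub>F q in whp. dist (dist (zhat (fst q) (snd q)) zstar) 0 < r"
    using eventually_regular
  proof eventually_elim
    case (elim q)
    note R = regularD[OF elim(2)]
    have "f0 (zhat (fst q) (snd q)) < f0 zstar + gap"
    proof -
      have "\<bar>fhat (fst q) (snd q) (zhat (fst q) (snd q)) - f0 (zhat (fst q) (snd q))\<bar> < gap / 2"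
        using elim(1) R(4) by blast
      moreover have "\<bar>fhat (fst q) (snd q) zstar - f0 zstar\<bar> < gap / 2" using elim(1) zstar_in by blast
      ultimately show ?thesis using R(6)[OF zstar_in] by linarith
    qed
    then have "zhat (fst q) (snd q) \<notin> Z'" using gap(2) by force
    then show ?case using R(4) by (simp add: Z'_def dist_commute)
  qed
qed

section \<open>Asymptotic equicontinuity\<close>

lemma U_meas [measurable]: "U n z \<in> borel_measurable M"
  using ksum_meas[of K "\<lambda>y. F z y - f0 z" n] unfolding U_def[abs_def] by simp

text \<open>For \<open>1 \<le> n\<close> and decisions in \<open>\<Z>\<close> this is the
  expectation of \<open>U n z\<close>, in the form bounded by the hypothesis
  \<open>bias\<close>.\<close>

definition centre :: "nat \<Rightarrow> real^'dz \<Rightarrow> real" where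
  "centre n z = sqrt (real n * h n ^ CARD('dx)) * kmean K n (\<lambda>w. F z (Y w) - f0 z)"

lemma centre_eq:
  assumes "1 \<le> n"
  shows "centre n z = real n * expectation (\<lambda>w. kn K n (X w) * (F z (Y w) - f0 z)) / sqrt (real n * h n ^ CARD('dx))"
proof -
  have s: "sqrt (real n * h n ^ CARD('dx)) = (real n * h n ^ CARD('dx)) / sqrt (real n * h n ^ CARD('dx))" using nhd_pos[OF assms] by (simp add: real_div_sqrt)
  have "centre n z = (real n * h n ^ CARD('dx)) / sqrt (real n * h n ^ CARD('dx)) * kmean K n (\<lambda>w. F z (Y w) - f0 z)"
    unfolding centre_def using s by simp
  then show ?thesis using h_pos[OF assms] by (simp add: kmean_def)
qed

text \<open>For decisions within \<open>r\<close> of each other the centred summands are at most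
  \<open>2 * C * r\<close> times the kernel value. Hence \<open>sum_centered_tail\<close> applies at
  the scale \<open>sqrt (n * h n ^ d) * r\<close> with a constant free of \<open>n\<close>, and
  \<open>chaining\<close> returns one modulus for all large \<open>n\<close>.\<close>

lemma equicontinuous:
  assumes e: "0 < e"
  shows "\<exists>\<delta>>0. \<forall>\<^sub>F n in sequentially. \<exists>A\<in>events. 1 - e \<le> prob A \<and>
    (\<forall>w\<in>A. \<forall>z\<in>\<Z>. dist z zstar < \<delta> \<longrightarrow>
      \<bar>(U n z w - centre n z) - (U n zstar w - centre n zstar)\<bar> \<le> e)"
proof -
  obtain B where B: "\<And>u. K u \<le> B" using K by (auto simp: smoothing_kernel_def)
  have B0: "0 \<le> B" using K_nonneg[of 0] B[of 0] by linarith
  define \<kappa> where "\<kappa> = p x0 * integral\<^sup>L lborel K + 1"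
  have \<kappa>: "0 < \<kappa>" using p_pos K_mass by (simp add: \<kappa>_def add_pos_pos)
  \<comment> \<open>The squared increment is at most \<open>4 * C^2 * B * r^2\<close> times the
    kernel value, whose mean is eventually below \<open>\<kappa> * h n ^ d\<close>.\<close>
  define c where "c = 4 * C\<^sup>2 * B * \<kappa>"
  obtain \<delta> where \<delta>: "0 < \<delta>" and chain: "\<And>W. (\<forall>z\<in>\<Z>. W z \<in> borel_measurable M) \<Longrightarrow>
      (\<forall>z\<in>\<Z>. \<forall>z'\<in>\<Z>. \<forall>r>0. dist z z' \<le> r \<longrightarrow>
        (\<forall>s. prob {w\<in>space M. r * s < \<bar>W z w - W z' w\<bar>} \<le> (2 * exp c) * exp (- s))) \<Longrightarrow>
      (AE w in M. continuous_on \<Z> (\<lambda>z. W z w)) \<Longrightarrow>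
      (\<exists>A\<in>events. 1 - e \<le> prob A \<and>
        (\<forall>w\<in>A. \<forall>z\<in>\<Z>. dist z zstar < \<delta> \<longrightarrow> \<bar>W z w - W zstar w :: real\<bar> \<le> e))"
    using chaining[OF compact_imp_bounded[OF Z_compact] zstar_in e, of "2 * exp c"] by force
  have "\<forall>\<^sub>F n in sequentially. kmean K n (\<lambda>_. 1) < \<kappa>"
    using kmean_one_tendsto[OF K] by (rule order_tendstoD(2)) (simp add: \<kappa>_def)
  \<comment> \<open>The condition \<open>2 * b \<le> a\<close> of \<open>sum_centered_tail\<close>
    after cancelling \<open>r\<close>: eventually the largest possible summand is small against the
    scale of the sum.\<close>
  moreover have "\<forall>\<^sub>F n in sequentially. 4 * C * B \<le> sqrt (real n * h n ^ CARD('dx))"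
    using filterlim_compose[OF sqrt_at_top nh_lim] by (simp add: filterlim_at_top)
  ultimately have "\<forall>\<^sub>F n in sequentially. \<exists>A\<in>events. 1 - e \<le> prob A \<and>
    (\<forall>w\<in>A. \<forall>z\<in>\<Z>. dist z zstar < \<delta> \<longrightarrow>
      \<bar>(U n z w - centre n z) - (U n zstar w - centre n zstar)\<bar> \<le> e)"
    using eventually_ge_at_top[of 1]
  proof eventually_elim
    case (elim n)
    note a = nhd_pos[OF elim(3)] and hn = h_pos[OF elim(3)]
    have sa: "0 < sqrt (real n * h n ^ CARD('dx))" using a by simp
    show ?case
    proof (rule chain)
      show "\<forall>z\<in>\<Z>. (\<lambda>w. U n z w - centre n z) \<in> borel_measurable M" by auto
      show "AE w in M. continuous_on \<Z> (\<lambda>z. U n z w - centre n z)"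
      proof -
        have "AE w in M. \<forall>i\<in>{1..n}. ys i w \<in> \<Y>" by (rule AE_ys)
        then show ?thesis
        proof eventually_elim
          case (elim w)
          have F_cont: "continuous_on \<Z> (\<lambda>z. F z y)" if "y \<in> \<Y>" for y
            unfolding continuous_on_iff
          proof (intro ballI allI impI)
            fix e :: real and z' assume "z' \<in> \<Z>" "0 < e"
            then show "\<exists>d>0. \<forall>x\<in>\<Z>. dist x z' < d \<longrightarrow> dist (F x y) (F z' y) < e"
              using C_pos that by (intro exI[of _ "e / C"])
                (auto simp: dist_real_def field_simps intro: le_less_trans[OF F_lip])
          qed
          have "continuous_on \<Z> (\<lambda>z. U n z w)"
            unfolding U_def ksum_def divide_inverse using elim
            by (intro continuous_on_mult_right continuous_on_sum continuous_on_mult_left continuous_on_diff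
                F_cont f0_continuous) auto
          moreover have "continuous_on \<Z> (\<lambda>z. centre n z)"
          proof -
            have "\<bar>centre n z - centre n z'\<bar> \<le> sqrt (real n * h n ^ CARD('dx)) * (2 * C * kmean K n (\<lambda>_. 1)) * dist z z'"
              if z: "z \<in> \<Z>" "z' \<in> \<Z>" for z z'
            proof -
              let ?D = "\<lambda>w. (F z (Y w) - f0 z) - (F z' (Y w) - f0 z')"
              have iD: "integrable M ?D" using F_int z by auto
              have "kmean K n (\<lambda>w. F z (Y w) - f0 z) - kmean K n (\<lambda>w. F z' (Y w) - f0 z') = kmean K n ?D"
                using z F_int by (intro kmean_diff[OF K, symmetric]) auto
              moreover have "\<bar>kmean K n ?D\<bar> \<le> 2 * C * dist z z' * kmean K n (\<lambda>_. 1)"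
              proof (rule kmean_abs_le[OF K \<open>1 \<le> n\<close> iD])
                show "AE w in M. \<bar>?D w\<bar> \<le> 2 * C * dist z z'"
                  using Y_in
                proof eventually_elim
                  case (elim w)
                  then show ?case using F_lip[OF elim z] f0_lip[OF z] by linarith
                qed
              qed
              ultimately have "sqrt (real n * h n ^ CARD('dx)) * \<bar>kmean K n (\<lambda>w. F z (Y w) - f0 z) - kmean K n (\<lambda>w. F z' (Y w) - f0 z')\<bar> \<le>
                  sqrt (real n * h n ^ CARD('dx)) * (2 * C * dist z z' * kmean K n (\<lambda>_. 1))"
                using sa by (intro mult_left_mono) auto
              then show ?thesis
                using sa unfolding centre_def right_diff_distrib[symmetric] abs_mult by (simp add: mult_ac)
            qed
            then show ?thesis
              by (intro lipschitz_on_continuous_on[of "sqrt (real n * h n ^ CARD('dx)) * (2 * C * kmean K n (\<lambda>_. 1))"] lipschitz_onI)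
                (use sa C_pos kmean_nonneg[OF K \<open>1 \<le> n\<close>, of "\<lambda>_. 1"] in \<open>auto simp: dist_real_def\<close>)
          qed
          ultimately show ?case by (intro continuous_intros)
        qed
      qed
      show "\<forall>z\<in>\<Z>. \<forall>z'\<in>\<Z>. \<forall>r>0. dist z z' \<le> r \<longrightarrow> (\<forall>s.
          prob {w\<in>space M. r * s < \<bar>(U n z w - centre n z) - (U n z' w - centre n z')\<bar>} \<le> (2 * exp c) * exp (- s))"
      proof (intro ballI allI impI)
        fix z z' and r s :: real
        assume z: "z \<in> \<Z>" "z' \<in> \<Z>" and r: "0 < r" "dist z z' \<le> r"
        define g where "g v = kn K n (fst v) * ((F z (snd v) - f0 z) - (F z' (snd v) - f0 z'))" for v
        have [measurable]: "g \<in> borel_measurable borel" unfolding g_def[abs_def] by measurable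
        have gb: "AE w in M. \<bar>g (X w, Y w)\<bar> \<le> kn K n (X w) * (2 * C * r)"
          using Y_in
        proof eventually_elim
          case (elim w)
          have "\<bar>(F z (Y w) - f0 z) - (F z' (Y w) - f0 z')\<bar> \<le> 2 * (C * dist z z')"
            using F_lip[OF elim z] f0_lip[OF z] by linarith
          also have "\<dots> \<le> 2 * C * r" using r C_pos by simp
          finally show ?case by (simp add: g_def abs_mult kn_nonneg mult_left_mono)
        qed
        have gB: "AE w in M. \<bar>g (X w, Y w)\<bar> \<le> 2 * C * B * r"
          using gb
        proof eventually_elim
          case (elim w)
          also have "kn K n (X w) * (2 * C * r) \<le> B * (2 * C * r)"
            using B r C_pos by (intro mult_right_mono) (auto simp: kn_def)
          finally show ?case by (simp add: mult_ac)
        qed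
        have v: "real n * expectation (\<lambda>w. (g (X w, Y w))\<^sup>2) \<le> c * (sqrt (real n * h n ^ CARD('dx)) * r)\<^sup>2"
        proof -
          have "expectation (\<lambda>w. (g (X w, Y w))\<^sup>2) \<le> expectation (\<lambda>w. (4 * C\<^sup>2 * B * r\<^sup>2) * (kn K n (X w) * 1))"
          proof (rule integral_mono_AE')
            show "AE w in M. 0 \<le> (4 * C\<^sup>2 * B * r\<^sup>2) * (kn K n (X w) * 1)"
              using B0 by (simp add: kn_nonneg)
            show "integrable M (\<lambda>w. (4 * C\<^sup>2 * B * r\<^sup>2) * (kn K n (X w) * 1))"
              by (intro integrable_mult_right kn_integrable K) simp
            show "AE w in M. (g (X w, Y w))\<^sup>2 \<le> (4 * C\<^sup>2 * B * r\<^sup>2) * (kn K n (X w) * 1)"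
              using gb
            proof eventually_elim
              case (elim w)
              have "(g (X w, Y w))\<^sup>2 \<le> (kn K n (X w) * (2 * C * r))\<^sup>2"
                using power_mono[OF elim abs_ge_zero, of 2] by simp
              also have "\<dots> = (kn K n (X w) * kn K n (X w)) * (4 * C\<^sup>2 * r\<^sup>2)"
                by (simp add: power2_eq_square)
              also have "\<dots> \<le> (B * kn K n (X w)) * (4 * C\<^sup>2 * r\<^sup>2)"
                using B by (intro mult_right_mono kn_nonneg) (auto simp: kn_def)
              finally show ?case by (simp add: mult_ac)
            qed
          qed
          also have "\<dots> = (4 * C\<^sup>2 * B * r\<^sup>2) * (h n ^ CARD('dx) * kmean K n (\<lambda>_. 1))"
            using hn by (simp add: kmean_def)
          also have "\<dots> \<le> (4 * C\<^sup>2 * B * r\<^sup>2) * (h n ^ CARD('dx) * \<kappa>)"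
            using elim(1) hn B0 by (intro mult_left_mono) auto
          finally have "real n * expectation (\<lambda>w. (g (X w, Y w))\<^sup>2) \<le>
              real n * ((4 * C\<^sup>2 * B * r\<^sup>2) * (h n ^ CARD('dx) * \<kappa>))" by (intro mult_left_mono) auto
          also have "\<dots> = c * ((real n * h n ^ CARD('dx)) * r\<^sup>2)" by (simp add: c_def mult_ac)
          also have "(real n * h n ^ CARD('dx)) * r\<^sup>2 = (sqrt (real n * h n ^ CARD('dx)) * r)\<^sup>2" using a by (simp add: power_mult_distrib)
          finally show ?thesis .
        qed
        have a2: "2 * (2 * C * B * r) \<le> sqrt (real n * h n ^ CARD('dx)) * r"
          using mult_right_mono[OF elim(2), of r] r by (simp add: mult_ac)
        have eqW: "(U n z w - centre n z) - (U n z' w - centre n z') =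
            ((\<Sum>i=1..n. g (xs i w, ys i w)) - real n * expectation (\<lambda>w. g (X w, Y w))) / sqrt (real n * h n ^ CARD('dx))" for w
        proof -
          have "expectation (\<lambda>w. g (X w, Y w)) = expectation (\<lambda>w. kn K n (X w) * (F z (Y w) - f0 z)) -
              expectation (\<lambda>w. kn K n (X w) * (F z' (Y w) - f0 z'))"
            unfolding g_def fst_conv snd_conv right_diff_distrib[of _ "F z _ - f0 z"]
            using z F_int by (intro Bochner_Integration.integral_diff kn_integrable K) auto
          moreover have "(\<Sum>i=1..n. g (xs i w, ys i w)) =
              ksum K n (\<lambda>y. F z y - f0 z) w - ksum K n (\<lambda>y. F z' y - f0 z') w"
            unfolding ksum_def sum_subtractf[symmetric] by (simp add: g_def right_diff_distrib)
          ultimately show ?thesis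
            unfolding U_def centre_eq[OF elim(3)]
            by (simp only: diff_divide_distrib[symmetric] right_diff_distrib) (simp add: algebra_simps)
        qed
        have "{w\<in>space M. r * s < \<bar>(U n z w - centre n z) - (U n z' w - centre n z')\<bar>} =
            {w\<in>space M. sqrt (real n * h n ^ CARD('dx)) * r * s < \<bar>(\<Sum>i=1..n. g (xs i w, ys i w)) - real n * expectation (\<lambda>w. g (X w, Y w))\<bar>}"
          unfolding eqW abs_divide abs_of_pos[OF sa] pos_less_divide_eq[OF sa] by (simp add: mult_ac)
        then show "prob {w\<in>space M. r * s < \<bar>(U n z w - centre n z) - (U n z' w - centre n z')\<bar>} \<le> (2 * exp c) * exp (- s)"
          using sum_centered_tail[OF \<open>g \<in> borel_measurable borel\<close> gB _ a2 v, of s] sa r by simp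
      qed
    qed
  qed
  with \<delta> show ?thesis by blast
qed

lemma centre_le: "1 \<le> n \<Longrightarrow> z \<in> \<Z> \<Longrightarrow> \<bar>centre n z\<bar> \<le> b n"
  unfolding centre_def by (rule bias)

text \<open>The equicontinuity event controls all decisions near \<open>zstar\<close> at once, so
  the random \<open>zhat\<close> may be inserted pathwise despite its dependence on the process. The
  centres differ by at most \<open>2 * b n\<close>.\<close>

lemma U_zhat_tendsto:
  "((\<lambda>q. U (fst q) (zhat (fst q) (snd q)) (snd q) - U (fst q) zstar (snd q)) \<longlongrightarrow> 0) whp"
proof -
  define D where "D n w = (U n (zhat n w) w - centre n (zhat n w)) - (U n zstar w - centre n zstar)" for n w
  have "((\<lambda>q. D (fst q) (snd q)) \<longlongrightarrow> 0) whp"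
  proof (rule tendstoI)
    fix r :: real assume r: "0 < r"
    show "\<forall>\<^sub>F q in whp. dist (D (fst q) (snd q)) 0 < r"
      unfolding eventually_whp
    proof (intro allI impI)
      fix e :: real assume e: "0 < e"
      \<comment> \<open>\<open>equicontinuous\<close> has a single parameter, which must bound both
        the lost probability, by \<open>e / 2\<close>, and the oscillation, strictly below
        \<open>r\<close>.\<close>
      define e' where "e' = min (e / 2) (r / 2)"
      have e': "0 < e'" using e r by (simp add: e'_def)
      obtain \<delta> where \<delta>: "0 < \<delta>" and eq: "\<forall>\<^sub>F n in sequentially. \<exists>A\<in>events. 1 - e' \<le> prob A \<and>
          (\<forall>w\<in>A. \<forall>z\<in>\<Z>. dist z zstar < \<delta> \<longrightarrow>
          \<bar>(U n z w - centre n z) - (U n zstar w - centre n zstar)\<bar> \<le> e')"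
        using equicontinuous[OF e'] by blast
      have "\<forall>\<^sub>F q in whp. regular (fst q) (snd q) \<and> dist (dist (zhat (fst q) (snd q)) zstar) 0 < \<delta>"
        by (intro eventually_conj eventually_regular tendstoD[OF zhat_tendsto \<delta>])
      then have "\<forall>\<^sub>F n in sequentially. \<exists>A\<in>events. 1 - e / 2 \<le> prob A \<and>
          (\<forall>w\<in>A. regular n w \<and> dist (dist (zhat n w) zstar) 0 < \<delta>)"
        unfolding eventually_whp using e half_gt_zero[OF e] by fastforce
      then show "\<forall>\<^sub>F n in sequentially. \<exists>A\<in>events. 1 - e \<le> prob A \<and>
          (\<forall>w\<in>A. dist (D (fst (n, w)) (snd (n, w))) 0 < r)"
        using eq
      proof eventually_elim
        case (elim n)
        obtain A1 where A1: "A1 \<in> events" "1 - e / 2 \<le> prob A1"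
          "\<And>w. w \<in> A1 \<Longrightarrow> regular n w \<and> dist (dist (zhat n w) zstar) 0 < \<delta>"
          using elim(1) by blast
        obtain A2 where A2: "A2 \<in> events" "1 - e' \<le> prob A2" "\<And>w z. w \<in> A2 \<Longrightarrow> z \<in> \<Z> \<Longrightarrow> dist z zstar < \<delta> \<Longrightarrow>
          \<bar>(U n z w - centre n z) - (U n zstar w - centre n zstar)\<bar> \<le> e'"
          using elim(2) by blast
        have "prob (A1 \<union> A2) + prob (A1 \<inter> A2) = prob A1 + prob A2"
          using A1(1) A2(1) by (simp add: finite_measure_Union' finite_measure_Diff' Int_commute)
        moreover have "prob (A1 \<union> A2) \<le> 1" by simp
        moreover have "e' \<le> e / 2" by (simp add: e'_def)
        ultimately have "1 - e \<le> prob (A1 \<inter> A2)" using A1(2) A2(2) by linarith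
        moreover have "\<bar>D n w\<bar> < r" if "w \<in> A1 \<inter> A2" for w
        proof -
          have "zhat n w \<in> \<Z>" "dist (zhat n w) zstar < \<delta>" using A1(3)[of w] that regularD(4) by auto
          then have "\<bar>D n w\<bar> \<le> e'" unfolding D_def using A2(3) that by blast
          also have "e' < r" using r by (simp add: e'_def min_less_iff_disj)
          finally show ?thesis .
        qed
        ultimately show ?case using A1(1) A2(1) by (intro bexI[of _ "A1 \<inter> A2"]) auto
      qed
    qed
  qed
  moreover have "((\<lambda>q. centre (fst q) (zhat (fst q) (snd q)) - centre (fst q) zstar) \<longlongrightarrow> 0) whp"
  proof (rule Lim_null_comparison)
    show "((\<lambda>q. 2 * b (fst q)) \<longlongrightarrow> 0) whp"
      using tendsto_whp_fst[OF tendsto_mult[OF tendsto_const b_lim, of 2]] by simp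
    show "\<forall>\<^sub>F q in whp. norm (centre (fst q) (zhat (fst q) (snd q)) - centre (fst q) zstar) \<le> 2 * b (fst q)"
      using eventually_regular
    proof eventually_elim
      case (elim q)
      then show ?case
        using centre_le[OF regularD(1)[OF elim] regularD(4)[OF elim]] centre_le[OF regularD(1)[OF elim] zstar_in]
        by (simp add: abs_le_iff)
    qed
  qed
  ultimately have "((\<lambda>q. D (fst q) (snd q) + (centre (fst q) (zhat (fst q) (snd q)) - centre (fst q) zstar)) \<longlongrightarrow> 0 + 0) whp"
    by (rule tendsto_add)
  then show ?thesis by (simp add: D_def algebra_simps)
qed

end

section \<open>The studentized optimal value\<close>

context nw_minimization begin

abbreviation (input) "vhat n w \<equiv> variance_hat K h xs ys F x0 n w"
abbreviation (input) "\<sigma>2 \<equiv> g2 x0 - (f0 zstar)\<^sup>2"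

text \<open>\<open>fhat n w (zhat n w) \<le> fhat n w zstar\<close> and \<open>f0 zstar \<le> f0 (zhat n w)\<close> enclose the left term
  between \<open>U n (zhat n w) w\<close> and \<open>U n zstar w\<close>.\<close>

lemma numerator_tendsto:
  "((\<lambda>q. S (fst q) (snd q) * (fhat (fst q) (snd q) (zhat (fst q) (snd q)) - f0 zstar) /
      sqrt (real (fst q) * h (fst q) ^ CARD('dx)) - U (fst q) zstar (snd q)) \<longlongrightarrow> 0) whp"
proof (rule Lim_null_comparison)
  show "((\<lambda>q. \<bar>U (fst q) (zhat (fst q) (snd q)) (snd q) - U (fst q) zstar (snd q)\<bar>) \<longlongrightarrow> 0) whp"
    using tendsto_rabs[OF U_zhat_tendsto] by simp
  show "\<forall>\<^sub>F q in whp. norm (S (fst q) (snd q) * (fhat (fst q) (snd q) (zhat (fst q) (snd q)) - f0 zstar) /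
      sqrt (real (fst q) * h (fst q) ^ CARD('dx)) - U (fst q) zstar (snd q)) \<le>
      \<bar>U (fst q) (zhat (fst q) (snd q)) (snd q) - U (fst q) zstar (snd q)\<bar>"
    using eventually_regular
  proof eventually_elim
    case (elim q)
    obtain n w where q: "q = (n, w)" by force
    note R = regularD[OF elim, unfolded q fst_conv snd_conv]
    let ?s = "sqrt (real n * h n ^ CARD('dx))"
    have s: "0 \<le> ?s" using R(5) by simp
    have "S n w * (fhat n w (zhat n w) - f0 zstar) / ?s \<le> S n w * (fhat n w zstar - f0 zstar) / ?s"
      using R(2) R(6)[OF zstar_in] s by (intro divide_right_mono mult_left_mono) auto
    moreover have "S n w * (fhat n w (zhat n w) - f0 (zhat n w)) / ?s \<le>
        S n w * (fhat n w (zhat n w) - f0 zstar) / ?s"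
      using R(2) zstar_min[OF R(4)] s by (intro divide_right_mono mult_left_mono) auto
    ultimately show ?case unfolding q by (simp add: U_eq[OF R(2)])
  qed
qed

text \<open>Write the estimated variance as a weighted second moment minus the square of the
  weighted mean. Both are moved from \<open>zhat\<close> to \<open>zstar\<close> by the Lipschitz
  bound, where the weak law applies.\<close>

lemma variance_hat_tendsto:
  "((\<lambda>q. vhat (fst q) (snd q) (zhat (fst q) (snd q))) \<longlongrightarrow> \<sigma>2) whp"
proof -
  let ?m2 = "\<lambda>n w. ksum K n (\<lambda>y. (F zstar y)\<^sup>2) w / S n w"
  let ?d = "\<lambda>n w. dist (zhat n w) zstar"
  have m2: "((\<lambda>q. ?m2 (fst q) (snd q)) \<longlongrightarrow> g2 x0) whp"
    using ui2[of 0] by (intro weighted_tendsto F2_cond g2_cont) auto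
  \<comment> \<open>From \<open>|u^2 - v^2| \<le> d * (d + 2 * |v|)\<close> for
    \<open>|u - v| \<le> d\<close>, and \<open>|v| \<le> 1 + v^2\<close>, so that after averaging
    only the convergent second moment at \<open>zstar\<close> occurs.\<close>
  define B where "B q = C * ?d (fst q) (snd q) * (C * ?d (fst q) (snd q) + 2 * (1 + ?m2 (fst q) (snd q)))" for q
  have "(B \<longlongrightarrow> C * 0 * (C * 0 + 2 * (1 + g2 x0))) whp"
    unfolding B_def by (intro tendsto_intros zhat_tendsto m2)
  then have B: "(B \<longlongrightarrow> 0) whp" by simp
  define G where "G n w = (\<Sum>i=1..n. nw_weight K h xs x0 n w i * (F (zhat n w) (ys i w))\<^sup>2)" for n w
  have "((\<lambda>q. G (fst q) (snd q) - ?m2 (fst q) (snd q)) \<longlongrightarrow> 0) whp"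
  proof (rule Lim_null_comparison[OF _ B])
    show "\<forall>\<^sub>F q in whp. norm (G (fst q) (snd q) - ?m2 (fst q) (snd q)) \<le> B q"
      using eventually_regular
    proof eventually_elim
      case (elim q)
      obtain n w where q: "q = (n, w)" by force
      note R = regularD[OF elim, unfolded q fst_conv snd_conv]
      let ?w = "nw_weight K h xs x0 n w" and ?D = "C * dist (zhat n w) zstar"
      have m2w: "?m2 n w = (\<Sum>i=1..n. ?w i * (F zstar (ys i w))\<^sup>2)"
        by (simp add: ksum_def weight_eq sum_divide_distrib)
      have D0: "0 \<le> ?D" using C_pos by simp
      have pointwise: "\<bar>?w i * ((F (zhat n w) (ys i w))\<^sup>2 - (F zstar (ys i w))\<^sup>2)\<bar> \<le>
          ?w i * (?D * (?D + 2)) + ?D * 2 * (?w i * (F zstar (ys i w))\<^sup>2)" if i: "i \<in> {1..n}" for i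
      proof -
        let ?u = "F (zhat n w) (ys i w)" and ?v = "F zstar (ys i w)"
        have uv: "\<bar>?u - ?v\<bar> \<le> ?D" using R(3) i by (intro F_lip R(4) zstar_in) auto
        have v: "\<bar>?v\<bar> \<le> 1 + ?v\<^sup>2"
        proof -
          have "0 \<le> (\<bar>?v\<bar> - 1)\<^sup>2 + \<bar>?v\<bar>" by simp
          then show ?thesis by (simp add: power2_diff)
        qed
        have "\<bar>?u\<^sup>2 - ?v\<^sup>2\<bar> = \<bar>?u - ?v\<bar> * \<bar>(?u - ?v) + 2 * ?v\<bar>"
          by (simp add: abs_mult[symmetric] power2_eq_square algebra_simps)
        also have "\<dots> \<le> ?D * (?D + 2 * (1 + ?v\<^sup>2))"
          using uv v D0 by (intro mult_mono) auto
        finally have "?w i * \<bar>?u\<^sup>2 - ?v\<^sup>2\<bar> \<le> ?w i * (?D * (?D + 2 * (1 + ?v\<^sup>2)))"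
          by (intro mult_left_mono weight_nonneg R(2))
        also have "\<dots> = ?w i * (?D * (?D + 2)) + ?D * 2 * (?w i * ?v\<^sup>2)" by (simp add: algebra_simps)
        finally show ?thesis unfolding abs_mult abs_of_nonneg[OF weight_nonneg[OF R(2), of i]] .
      qed
      have "\<bar>G n w - ?m2 n w\<bar> = \<bar>\<Sum>i=1..n. ?w i * ((F (zhat n w) (ys i w))\<^sup>2 - (F zstar (ys i w))\<^sup>2)\<bar>"
        unfolding G_def m2w by (simp add: right_diff_distrib sum_subtractf)
      also have "\<dots> \<le> (\<Sum>i=1..n. ?w i * (?D * (?D + 2)) + ?D * 2 * (?w i * (F zstar (ys i w))\<^sup>2))"
        by (rule order_trans[OF sum_abs]) (intro sum_mono pointwise)
      also have "\<dots> = (\<Sum>i=1..n. ?w i) * (?D * (?D + 2)) + ?D * 2 * ?m2 n w"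
        unfolding m2w sum.distrib sum_distrib_left sum_distrib_right ..
      also have "\<dots> = ?D * (?D + 2 * (1 + ?m2 n w))"
        unfolding sum_weight[OF R(2)] by (simp add: algebra_simps)
      finally show ?case by (simp add: q B_def)
    qed
  qed
  from tendsto_add[OF this m2] have G: "((\<lambda>q. G (fst q) (snd q)) \<longlongrightarrow> g2 x0) whp" by simp
  have "((\<lambda>q. fhat (fst q) (snd q) (zhat (fst q) (snd q)) - fhat (fst q) (snd q) zstar) \<longlongrightarrow> 0) whp"
  proof (rule Lim_null_comparison)
    show "((\<lambda>q. C * ?d (fst q) (snd q)) \<longlongrightarrow> 0) whp"
      using tendsto_mult[OF tendsto_const zhat_tendsto, of C] by simp
    show "\<forall>\<^sub>F q in whp. norm (fhat (fst q) (snd q) (zhat (fst q) (snd q)) - fhat (fst q) (snd q) zstar) \<le> C * ?d (fst q) (snd q)"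
      using eventually_regular by eventually_elim (simp add: fhat_lip[OF regularD(2,3,4) zstar_in])
  qed
  from tendsto_add[OF this fhat_tendsto[OF zstar_in]]
  have m1: "((\<lambda>q. fhat (fst q) (snd q) (zhat (fst q) (snd q))) \<longlongrightarrow> f0 zstar) whp" by simp
  have "((\<lambda>q. G (fst q) (snd q) - (fhat (fst q) (snd q) (zhat (fst q) (snd q)))\<^sup>2) \<longlongrightarrow> \<sigma>2) whp"
    by (intro tendsto_diff G tendsto_power m1)
  then show ?thesis
  proof (rule Lim_transform_eventually)
    show "\<forall>\<^sub>F q in whp. G (fst q) (snd q) - (fhat (fst q) (snd q) (zhat (fst q) (snd q)))\<^sup>2 =
        vhat (fst q) (snd q) (zhat (fst q) (snd q))"
      using eventually_regular
    proof eventually_elim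
      case (elim q)
      obtain n w where q: "q = (n, w)" by force
      note R = regularD[OF elim, unfolded q fst_conv snd_conv]
      let ?w = "nw_weight K h xs x0 n w" and ?u = "\<lambda>i. F (zhat n w) (ys i w)" and ?m = "fhat n w (zhat n w)"
      have "vhat n w (zhat n w) = (\<Sum>i=1..n. ?w i * (?u i)\<^sup>2 - 2 * ?m * (?w i * ?u i) + ?m\<^sup>2 * ?w i)"
        unfolding variance_hat_def by (intro sum.cong) (auto simp: power2_diff algebra_simps)
      also have "\<dots> = G n w - 2 * ?m * (\<Sum>i=1..n. ?w i * ?u i) + ?m\<^sup>2 * (\<Sum>i=1..n. ?w i)"
        unfolding sum.distrib sum_subtractf sum_distrib_left G_def ..
      also have "(\<Sum>i=1..n. ?w i * ?u i) = ?m" by (simp add: cost_hat_def)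
      finally show ?case unfolding q sum_weight[OF R(2)] by (simp add: power2_eq_square)
    qed
  qed
qed

lemma centred_square_cond:
  "cond_mean M X (\<lambda>w. (F zstar (Y w) - f0 zstar)\<^sup>2) (\<lambda>x. (g2 x + (- 2 * f0 zstar) * f zstar x) + (f0 zstar)\<^sup>2)"
  (is "cond_mean M X ?W ?g")
proof -
  have "cond_mean M X (\<lambda>w. ((F zstar (Y w))\<^sup>2 + (- 2 * f0 zstar) * F zstar (Y w)) + (f0 zstar)\<^sup>2) ?g"
    by (intro cond_mean_add cond_mean_cmult F2_cond f_cond zstar_in cond_mean_const)
  moreover have "(\<lambda>w. ((F zstar (Y w))\<^sup>2 + (- 2 * f0 zstar) * F zstar (Y w)) + (f0 zstar)\<^sup>2) = ?W"
    by (auto simp: power2_diff)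
  ultimately show ?thesis by simp
qed

text \<open>Supplies the tightness with which the error of the random standardization is multiplied
  in the studentized ratio.\<close>

lemma U_zstar_bounded:
  obtains B where "\<forall>\<^sub>F n in sequentially. integrable M (U n zstar)"
    "\<forall>\<^sub>F n in sequentially. expectation (\<lambda>w. \<bar>U n zstar w\<bar>) \<le> B"
proof -
  let ?\<phi> = "\<lambda>y. F zstar y - f0 zstar"
  let ?L = "(g2 x0 + (- 2 * f0 zstar) * f zstar x0 + (f0 zstar)\<^sup>2) * p x0 * (LINT u|lborel. (K u)\<^sup>2)"
  have key: "integrable M (U n zstar) \<and> expectation (\<lambda>w. \<bar>U n zstar w\<bar>) \<le>
      sqrt (kmean (\<lambda>u. (K u)\<^sup>2) n (\<lambda>w. (?\<phi> (Y w))\<^sup>2)) + b n" if n: "1 \<le> n" for n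
  proof -
    note a = nhd_pos[OF n]
    define g where "g v = kn K n (fst v) * ?\<phi> (snd v)" for v
    have [measurable]: "g \<in> borel_measurable borel" unfolding g_def[abs_def] by measurable
    have i2: "integrable M (\<lambda>w. (?\<phi> (Y w))\<^sup>2)"
      using F2_cond F_int[OF zstar_in] by (simp add: power2_diff cond_mean_def)
    have ig: "integrable M (\<lambda>w. (g (X w, Y w))\<^sup>2)"
      using kn_integrable[OF kernel_square[OF K] i2, of n] by (simp add: g_def power_mult_distrib kn_def)
    define W where "W w = (\<Sum>i=1..n. g (xs i w, ys i w)) - real n * expectation (\<lambda>w. g (X w, Y w))" for w
    have [measurable]: "W \<in> borel_measurable M"
      using V_meas_sum[of g n] unfolding W_def[abs_def] by simp
    have W2: "integrable M (\<lambda>w. (W w)\<^sup>2)"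
        "expectation (\<lambda>w. (W w)\<^sup>2) \<le> real n * expectation (\<lambda>w. (g (X w, Y w))\<^sup>2)"
      using sum_centered_square[of g n] ig unfolding W_def by auto
    note W1 = expectation_abs_le_sqrt[OF _ W2(1)]
    have U: "U n zstar w = W w / sqrt (real n * h n ^ CARD('dx)) + centre n zstar" for w
      unfolding centre_eq[OF n] U_def W_def g_def ksum_def by (simp add: diff_divide_distrib)
    have "expectation (\<lambda>w. \<bar>U n zstar w\<bar>) \<le> expectation (\<lambda>w. \<bar>W w\<bar> / sqrt (real n * h n ^ CARD('dx)) + b n)"
    proof (intro integral_mono)
      show "\<bar>U n zstar w\<bar> \<le> \<bar>W w\<bar> / sqrt (real n * h n ^ CARD('dx)) + b n" for w
        unfolding U using a centre_le[OF n zstar_in] by (intro order_trans[OF abs_triangle_ineq] add_mono) (auto simp: abs_divide)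
    qed (use W1 in \<open>auto simp: U\<close>)
    also have "\<dots> = expectation (\<lambda>w. \<bar>W w\<bar>) / sqrt (real n * h n ^ CARD('dx)) + b n"
      using W1 by (simp add: prob_space)
    also have "expectation (\<lambda>w. \<bar>W w\<bar>) \<le> sqrt (real n * expectation (\<lambda>w. (g (X w, Y w))\<^sup>2))"
      using order_trans[OF W1(2) real_sqrt_le_mono[OF W2(2)]] by simp
    finally have "expectation (\<lambda>w. \<bar>U n zstar w\<bar>) \<le>
        sqrt (real n * expectation (\<lambda>w. (g (X w, Y w))\<^sup>2)) / sqrt (real n * h n ^ CARD('dx)) + b n"
      using a by (simp add: divide_right_mono)
    also have "sqrt (real n * expectation (\<lambda>w. (g (X w, Y w))\<^sup>2)) / sqrt (real n * h n ^ CARD('dx)) =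
        sqrt (kmean (\<lambda>u. (K u)\<^sup>2) n (\<lambda>w. (?\<phi> (Y w))\<^sup>2))"
      unfolding real_sqrt_divide[symmetric] using n by (simp add: kmean_def g_def power_mult_distrib kn_def)
    finally have bound: "expectation (\<lambda>w. \<bar>U n zstar w\<bar>) \<le>
        sqrt (kmean (\<lambda>u. (K u)\<^sup>2) n (\<lambda>w. (?\<phi> (Y w))\<^sup>2)) + b n" .
    have "U n zstar = (\<lambda>w. W w / sqrt (real n * h n ^ CARD('dx)) + centre n zstar)"
      by (rule ext) (rule U)
    then have "integrable M (U n zstar)" using W1 by simp
    with bound show ?thesis by blast
  qed
  have "(\<lambda>n. sqrt (kmean (\<lambda>u. (K u)\<^sup>2) n (\<lambda>w. (?\<phi> (Y w))\<^sup>2)) + b n) \<longlonglongrightarrow> sqrt ?L + 0"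
    by (intro tendsto_add b_lim tendsto_real_sqrt kmean_tendsto[OF kernel_square[OF K] centred_square_cond])
      (intro continuous_intros g2_cont f_cont zstar_in)
  then have "\<forall>\<^sub>F n in sequentially. sqrt (kmean (\<lambda>u. (K u)\<^sup>2) n (\<lambda>w. (?\<phi> (Y w))\<^sup>2)) + b n < sqrt ?L + 1"
    by (rule order_tendstoD) simp
  then have "\<forall>\<^sub>F n in sequentially. expectation (\<lambda>w. \<bar>U n zstar w\<bar>) \<le> sqrt ?L + 1"
    using eventually_ge_at_top[of 1] by eventually_elim (use key in fastforce)
  moreover have "\<forall>\<^sub>F n in sequentially. integrable M (U n zstar)"
    by (rule eventually_mono[OF eventually_ge_at_top[of 1]]) (use key in auto)
  ultimately show ?thesis using that by blast
qed

lemma U_zstar_char: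
  "(\<lambda>n. char (distr M borel (U n zstar)) t) \<longlonglongrightarrow> exp (- (t\<^sup>2 * (\<sigma>2 * p x0 * (LINT u|lborel. (K u)\<^sup>2)) / 2))"
proof -
  let ?\<phi> = "\<lambda>y. F zstar y - f0 zstar"
  have ct: "isCont (\<lambda>x. (g2 x + (- 2 * f0 zstar) * f zstar x) + (f0 zstar)\<^sup>2) x0"
    by (intro continuous_intros g2_cont f_cont zstar_in)
  have bias0: "(\<lambda>n. sqrt (real n * h n ^ CARD('dx)) * kmean K n (\<lambda>w. ?\<phi> (Y w))) \<longlonglongrightarrow> 0"
  proof (rule Lim_null_comparison[OF _ b_lim])
    show "\<forall>\<^sub>F n in sequentially. norm (sqrt (real n * h n ^ CARD('dx)) * kmean K n (\<lambda>w. ?\<phi> (Y w))) \<le> b n"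
      by (rule eventually_mono[OF eventually_ge_at_top[of 1]]) (use bias[OF _ zstar_in] in simp)
  qed
  have eq: "g2 x0 + (- 2 * f0 zstar) * f zstar x0 + (f0 zstar)\<^sup>2 = \<sigma>2" by (simp add: power2_eq_square)
  show ?thesis
    using kernel_clt_char[OF K _ centred_square_cond ct ui2 bias0, of t] unfolding eq by (simp add: U_def[abs_def])
qed

text \<open>The sum of squared weights is the kernel sum for \<open>K^2\<close> divided by the
  square of \<open>S n\<close>, so \<open>S n\<close> cancels and the statistic becomes
  \<open>N / D\<close>. The limit of the square of \<open>D\<close> coincides with the limit
  variance of \<open>U n zstar\<close>, which is why the limit law is standard.\<close>

theorem studentized_weak_conv:
  "weak_conv_m
     (\<lambda>n. distr M borel (\<lambda>w.
        (cost_hat K h xs ys F x0 n w (zhat n w) - f zstar x0) /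
        sqrt (variance_hat K h xs ys F x0 n w (zhat n w) *
              (\<Sum>i=1..n. (nw_weight K h xs x0 n w i)\<^sup>2))))
     std_normal_distribution"
proof -
  define T where "T n w = (fhat n w (zhat n w) - f0 zstar) /
        sqrt (vhat n w (zhat n w) * (\<Sum>i=1..n. (nw_weight K h xs x0 n w i)\<^sup>2))" for n w
  have [measurable]: "(\<lambda>w. kn K n (xs i w)) \<in> borel_measurable M" if "i \<in> {1..n}" for i n
    using that by (intro measurable_compose[OF xs_meas kn_meas]) auto
  have [measurable]: "S n \<in> borel_measurable M" for n
    unfolding S_def[abs_def] by (intro ksum_meas) auto
  have w_meas: "(\<lambda>w. nw_weight K h xs x0 n w i) \<in> borel_measurable M" if "i \<in> {1..n}" for i n
    unfolding weight_eq using that by measurable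
  have F_zhat: "(\<lambda>w. F (zhat n w) (ys i w)) \<in> borel_measurable M" if "i \<in> {1..n}" for i n
  proof -
    have "(\<lambda>w. (zhat n w, ys i w)) \<in> M \<rightarrow>\<^sub>M borel"
      using that ys_meas[of i] by (simp add: borel_prod[symmetric])
    from measurable_compose[OF this F_meas] show ?thesis by simp
  qed
  have fhat_meas: "(\<lambda>w. fhat n w (zhat n w)) \<in> borel_measurable M" for n
    unfolding cost_hat_def by (intro borel_measurable_sum borel_measurable_times w_meas F_zhat)
  have vhat_meas: "(\<lambda>w. vhat n w (zhat n w)) \<in> borel_measurable M" for n
    unfolding variance_hat_def
    by (intro borel_measurable_sum borel_measurable_times w_meas borel_measurable_power borel_measurable_diff F_zhat fhat_meas)
  have "(\<lambda>w. vhat n w (zhat n w) * (\<Sum>i=1..n. (nw_weight K h xs x0 n w i)\<^sup>2)) \<in> borel_measurable M" for n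
    by (intro borel_measurable_times vhat_meas borel_measurable_sum borel_measurable_power w_meas)
  from measurable_compose[OF this borel_measurable_sqrt]
  have T_meas [measurable]: "T n \<in> borel_measurable M" for n
    unfolding T_def[abs_def] by (intro borel_measurable_divide borel_measurable_diff fhat_meas borel_measurable_const)
  let ?I2 = "LINT u|lborel. (K u)\<^sup>2"
  define v where "v = \<sigma>2 * (p x0 * ?I2)"
  have I2: "0 < ?I2"
  proof (rule ccontr)
    assume "\<not> ?thesis"
    moreover have "0 \<le> ?I2" by simp
    ultimately have "?I2 = 0" by linarith
    then have "AE u in lborel. (K u)\<^sup>2 = 0"
      using kernel_square[OF K] by (subst (asm) integral_nonneg_eq_0_iff_AE) (auto simp: smoothing_kernel_def)
    then have "AE u in lborel. K u = 0" by simp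
    then have "integral\<^sup>L lborel K = 0" by (simp add: integral_eq_zero_AE)
    then show False using K_mass by simp
  qed
  have v: "0 < v" using nondegenerate p_pos I2 by (simp add: v_def)
  have Q: "((\<lambda>q. ksum (\<lambda>u. (K u)\<^sup>2) (fst q) (\<lambda>_. 1) (snd q) / (real (fst q) * h (fst q) ^ CARD('dx))) \<longlongrightarrow> p x0 * ?I2) whp"
    using kernel_wlln[OF kernel_square[OF K] _ cond_mean_const[of 1] _ locally_ui_one] by simp
  define D where "D q = sqrt (vhat (fst q) (snd q) (zhat (fst q) (snd q)) *
      (ksum (\<lambda>u. (K u)\<^sup>2) (fst q) (\<lambda>_. 1) (snd q) / (real (fst q) * h (fst q) ^ CARD('dx))))" for q
  have D: "(D \<longlongrightarrow> sqrt v) whp"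
    unfolding D_def v_def by (intro tendsto_real_sqrt tendsto_mult variance_hat_tendsto Q)
  have D0: "sqrt v \<noteq> 0" using v by simp
  define N where "N q = S (fst q) (snd q) * (fhat (fst q) (snd q) (zhat (fst q) (snd q)) - f0 zstar) /
      sqrt (real (fst q) * h (fst q) ^ CARD('dx))" for q
  obtain B where B: "\<forall>\<^sub>F n in sequentially. integrable M (U n zstar)"
    "\<forall>\<^sub>F n in sequentially. expectation (\<lambda>w. \<bar>U n zstar w\<bar>) \<le> B" by (rule U_zstar_bounded)
  have inv: "((\<lambda>q. 1 / D q - 1 / sqrt v) \<longlongrightarrow> 0) whp"
    using tendsto_diff[OF tendsto_divide[OF tendsto_const D D0, of 1] tendsto_const[of "1 / sqrt v"]] by simp
  have "((\<lambda>q. U (fst q) zstar (snd q) * (1 / D q - 1 / sqrt v)) \<longlongrightarrow> 0) whp"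
    using tendsto_whp_tight_mult[OF B, of "\<lambda>n w. 1 / D (n, w) - 1 / sqrt v"] inv by simp
  moreover have "((\<lambda>q. (N q - U (fst q) zstar (snd q)) / D q) \<longlongrightarrow> 0 / sqrt v) whp"
    using numerator_tendsto unfolding N_def by (intro tendsto_divide D D0)
  \<comment> \<open>The sum is \<open>N / D - U / sqrt v\<close>: one term replaces \<open>N\<close>
    by \<open>U\<close>, the other the random \<open>D\<close> by its limit.\<close>
  ultimately have "((\<lambda>q. (N q - U (fst q) zstar (snd q)) / D q + U (fst q) zstar (snd q) * (1 / D q - 1 / sqrt v)) \<longlongrightarrow> 0) whp"
    using tendsto_add by fastforce
  then have diff: "((\<lambda>q. T (fst q) (snd q) - U (fst q) zstar (snd q) / sqrt v) \<longlongrightarrow> 0) whp"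
  proof (rule Lim_transform_eventually)
    show "\<forall>\<^sub>F q in whp. (N q - U (fst q) zstar (snd q)) / D q + U (fst q) zstar (snd q) * (1 / D q - 1 / sqrt v) =
        T (fst q) (snd q) - U (fst q) zstar (snd q) / sqrt v"
      using eventually_regular
    proof eventually_elim
      case (elim q)
      obtain n w where q: "q = (n, w)" by force
      note R = regularD[OF elim, unfolded q fst_conv snd_conv]
      let ?a = "real n * h n ^ CARD('dx)"
      let ?k2 = "ksum (\<lambda>u. (K u)\<^sup>2) n (\<lambda>_. 1) w"
      have "(\<Sum>i=1..n. (nw_weight K h xs x0 n w i)\<^sup>2) = ?k2 / (S n w)\<^sup>2"
        by (simp add: weight_eq ksum_def kn_def power_divide sum_divide_distrib)
      then have "T n w = (fhat n w (zhat n w) - f0 zstar) / (sqrt (vhat n w (zhat n w) * ?k2) / S n w)"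
        using R(2) by (simp add: T_def real_sqrt_divide real_sqrt_mult)
      also have "\<dots> = N q / D q"
      proof -
        have "D q = sqrt (vhat n w (zhat n w) * ?k2) / sqrt ?a"
          by (simp add: D_def q real_sqrt_divide[symmetric])
        moreover have "sqrt ?a \<noteq> 0" using R(5) by (metis less_irrefl real_sqrt_eq_zero_cancel_iff)
        ultimately show ?thesis
          by (simp only: N_def q fst_conv snd_conv) (simp add: divide_simps)
      qed
      finally have "T n w = N q / D q" .
      then show ?case by (simp add: q diff_divide_distrib right_diff_distrib)
    qed
  qed
  have "weak_conv_m (\<lambda>n. distr M borel (T n)) std_normal_distribution"
  proof (rule levy_continuity)
    show "real_distribution (distr M borel (T n))" for n by simp
    show "real_distribution std_normal_distribution" by (rule real_dist_normal_dist)
    fix t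
    have "(\<lambda>n. char (distr M borel (U n zstar)) (t / sqrt v)) \<longlonglongrightarrow>
        exp (- ((t / sqrt v)\<^sup>2 * (\<sigma>2 * p x0 * ?I2) / 2))" by (rule U_zstar_char)
    also have "(t / sqrt v)\<^sup>2 * (\<sigma>2 * p x0 * ?I2) = t\<^sup>2"
    proof -
      have e: "\<sigma>2 * p x0 * ?I2 = v" by (simp add: v_def mult.assoc)
      show ?thesis unfolding e using v by (simp add: power_divide)
    qed
    also have "(\<lambda>n. char (distr M borel (U n zstar)) (t / sqrt v)) =
        (\<lambda>n. char (distr M borel (\<lambda>w. U n zstar w / sqrt v)) t)"
      unfolding char_def by (intro ext) (simp add: integral_distr)
    finally have "(\<lambda>n. char (distr M borel (\<lambda>w. U n zstar w / sqrt v)) t) \<longlonglongrightarrow> char std_normal_distribution t"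
      by (simp add: char_std_normal_distribution)
    then show "(\<lambda>n. char (distr M borel (T n)) t) \<longlonglongrightarrow> char std_normal_distribution t"
      by (rule slutsky_char[rotated 3]) (use diff in simp_all)
  qed
  then show ?thesis unfolding T_def .
qed

end

section \<open>Smoothing bias and envelopes\<close>

lemma has_derivative_gradient:
  fixes f :: "real^'n \<Rightarrow> real"
  assumes "f differentiable (at x)"
  shows "(f has_derivative (\<lambda>u. gradient f x \<bullet> u)) (at x)"
proof -
  let ?D = "frechet_derivative f (at x)"
  have D: "(f has_derivative ?D) (at x)" using assms by (simp only: frechet_derivative_works)
  have lin: "linear ?D" using has_derivative_bounded_linear[OF D] by (rule bounded_linear.linear)
  have "?D u = gradient f x \<bullet> u" for u
  proof -
    have "?D u = ?D (\<Sum>i\<in>UNIV. (u $ i) *\<^sub>R axis i 1)"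
      using basis_expansion[of u] by (simp add: scalar_mult_eq_scaleR)
    also have "\<dots> = (\<Sum>i\<in>UNIV. (u $ i) * ?D (axis i 1))"
      using lin by (simp add: linear_sum linear_scale)
    also have "\<dots> = gradient f x \<bullet> u" by (simp add: gradient_def inner_vec_def mult.commute)
    finally show ?thesis .
  qed
  then have "?D = (\<lambda>u. gradient f x \<bullet> u)" by auto
  with D show ?thesis by simp
qed

lemma onorm_inner_le: "onorm (\<lambda>u. v \<bullet> u) \<le> norm (v :: 'b::real_inner)"
  by (rule onorm_bound) (auto simp: Cauchy_Schwarz_ineq2)

lemma lipschitz_of_gradient:
  fixes f :: "real^'n \<Rightarrow> real"
  assumes "\<And>y. y \<in> ball x0 r \<Longrightarrow> f differentiable (at y)"
    and "\<And>y. y \<in> ball x0 r \<Longrightarrow> norm (gradient f y) \<le> C"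
    and x: "x \<in> ball x0 r"
  shows "\<bar>f x - f x0\<bar> \<le> C * dist x x0"
proof -
  have "x0 \<in> ball x0 r" using x zero_le_dist[of x0 x] unfolding mem_ball by (simp, linarith)
  then have "norm (f x - f x0) \<le> C * norm (x - x0)"
    using x assms(1) has_derivative_at_withinI[OF has_derivative_gradient] order_trans[OF onorm_inner_le assms(2)]
    by (intro differentiable_bound[of "ball x0 r" f "\<lambda>y u. gradient f y \<bullet> u"]) auto
  then show ?thesis by (simp add: dist_norm)
qed

text \<open>The mean value inequality is used twice: on the gradient, with the Hessian bound, and on
  \<open>f\<close> minus its linear part. This gives the constant \<open>C\<close> in place of
  \<open>C / 2\<close>.\<close>

lemma taylor_quadratic:
  fixes f :: "real^'n \<Rightarrow> real"
  assumes d1: "\<And>y. y \<in> ball x0 r \<Longrightarrow> f differentiable (at y)"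
    and d2: "\<And>y. y \<in> ball x0 r \<Longrightarrow> gradient f differentiable (at y)"
    and C: "\<And>y. y \<in> ball x0 r \<Longrightarrow> spectral_norm (hessian f y) \<le> C"
    and x: "x \<in> ball x0 r"
  shows "\<bar>f x - f x0 - gradient f x0 \<bullet> (x - x0)\<bar> \<le> C * (dist x x0)\<^sup>2"
proof -
  have x0: "x0 \<in> ball x0 r" using x zero_le_dist[of x0 x] unfolding mem_ball by (simp, linarith)
  have grad: "norm (gradient f y - gradient f x0) \<le> C * norm (y - x0)" if "y \<in> ball x0 r" for y
  proof (rule differentiable_bound[of "ball x0 r" "gradient f" "\<lambda>y u. hessian f y *v u"])
    show "(gradient f has_derivative (\<lambda>u. hessian f z *v u)) (at z within ball x0 r)" if "z \<in> ball x0 r" for z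
      using has_derivative_at_withinI[OF d2[OF that, unfolded jacobian_works]] by (simp add: hessian_def)
    show "onorm (\<lambda>u. hessian f z *v u) \<le> C" if "z \<in> ball x0 r" for z
      using C[OF that] by (simp add: spectral_norm_def)
  qed (use that x0 in auto)
  have C0: "0 \<le> C" if "x \<noteq> x0"
  proof -
    have "0 \<le> norm (gradient f x - gradient f x0)" by simp
    also have "\<dots> \<le> C * norm (x - x0)" by (rule grad[OF x])
    finally show ?thesis using that by (simp add: zero_le_mult_iff)
  qed
  \<comment> \<open>On the smaller ball the gradient deviates from its value at \<open>x0\<close> by
    at most \<open>C * dist x x0\<close>, which produces the second factor of the quadratic
    bound.\<close>
  let ?B = "ball x0 r \<inter> cball x0 (dist x x0)"
  have "norm ((f x - gradient f x0 \<bullet> x) - (f x0 - gradient f x0 \<bullet> x0)) \<le> C * dist x x0 * norm (x - x0)"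
  proof (rule differentiable_bound[of ?B "\<lambda>y. f y - gradient f x0 \<bullet> y" "\<lambda>y u. (gradient f y - gradient f x0) \<bullet> u"])
    show "convex ?B" by (intro convex_Int convex_ball convex_cball)
    fix y assume y: "y \<in> ?B"
    have "((\<lambda>y. f y - gradient f x0 \<bullet> y) has_derivative (\<lambda>u. gradient f y \<bullet> u - gradient f x0 \<bullet> u)) (at y)"
    proof (rule has_derivative_diff)
      show "(f has_derivative (\<lambda>u. gradient f y \<bullet> u)) (at y)" using y by (intro has_derivative_gradient d1) auto
      show "((\<lambda>y. gradient f x0 \<bullet> y) has_derivative (\<lambda>u. gradient f x0 \<bullet> u)) (at y)"
        by (rule bounded_linear_imp_has_derivative[OF bounded_linear_inner_right])
    qed
    moreover have "(\<lambda>u. gradient f y \<bullet> u - gradient f x0 \<bullet> u) = (\<lambda>u. (gradient f y - gradient f x0) \<bullet> u)"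
      by (rule ext) (rule inner_diff_left[symmetric])
    ultimately show "((\<lambda>y. f y - gradient f x0 \<bullet> y) has_derivative (\<lambda>u. (gradient f y - gradient f x0) \<bullet> u)) (at y within ?B)"
      by (simp only: has_derivative_at_withinI)
    show "onorm (\<lambda>u. (gradient f y - gradient f x0) \<bullet> u) \<le> C * dist x x0"
    proof (cases "x = x0")
      case True
      then show ?thesis using y by (simp add: onorm_zero)
    next
      case False
      have "onorm (\<lambda>u. (gradient f y - gradient f x0) \<bullet> u) \<le> norm (gradient f y - gradient f x0)"
        by (rule onorm_inner_le)
      also have "\<dots> \<le> C * norm (y - x0)" using y by (intro grad) auto
      also have "norm (y - x0) = dist x0 y" by (simp add: dist_norm norm_minus_commute)
      also have "C * dist x0 y \<le> C * dist x x0" using y C0[OF False] by (intro mult_left_mono) auto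
      finally show ?thesis .
    qed
  next
    show "x \<in> ?B" "x0 \<in> ?B" using x x0 by (simp_all add: dist_commute)
  qed
  also have "(f x - gradient f x0 \<bullet> x) - (f x0 - gradient f x0 \<bullet> x0) = f x - f x0 - gradient f x0 \<bullet> (x - x0)"
    by (simp add: inner_diff_right)
  also have "C * dist x x0 * norm (x - x0) = C * (dist x x0)\<^sup>2"
    unfolding dist_norm power2_eq_square by (rule mult.assoc)
  finally show ?thesis unfolding real_norm_def .
qed

section \<open>Bias near and far from x0, and uniform integrability\<close>

context kernel_model begin

text \<open>The expansion is made for the product of \<open>g - c0\<close> with the density, since
  that is what the change of variables leaves under the integral. Localization by a ball centred at
  \<open>x0\<close> preserves evenness, and the second moment of \<open>K\<close> turns the
  quadratic remainder into \<open>h ^ (d + 2)\<close>.\<close>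

lemma near_bias:
  assumes K: "smoothing_kernel K" and sym: "\<And>u. K (- u) = K u"
    and m: "integrable lborel (\<lambda>u. K u * (norm u)\<^sup>2)"
    and [measurable]: "g \<in> borel_measurable borel" and r: "0 < r" and A: "0 \<le> A"
    and q: "\<And>x. x \<in> ball x0 r \<Longrightarrow> \<bar>(g x - c0) * p x - v \<bullet> (x - x0)\<bar> \<le> A * (dist x x0)\<^sup>2"
    and n: "1 \<le> n"
  shows "\<bar>expectation (\<lambda>w. kn K n (X w) * ((g (X w) - c0) * indicator (ball x0 r) (X w)))\<bar> \<le>
    A * (LINT u|lborel. K u * (norm u)\<^sup>2) * h n ^ (CARD('dx) + 2)"
proof -
  have [measurable]: "K \<in> borel_measurable borel" and K0: "\<And>u. 0 \<le> K u" and Ki: "integrable lborel K"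
    using K by (auto simp: smoothing_kernel_def)
  have [measurable]: "ball x0 r \<in> sets borel" by simp
  have hn: "0 < h n" by (rule h_pos[OF n])
  define Q where "Q x = (g x - c0) * p x" for x
  have [measurable]: "Q \<in> borel_measurable borel" unfolding Q_def[abs_def] by measurable
  define s :: "real^'dx \<Rightarrow> real" where "s u = indicator {u. norm (h n *\<^sub>R u) < r} u" for u
  have [measurable]: "s \<in> borel_measurable borel" unfolding s_def[abs_def] by measurable
  have s_eq: "indicator (ball x0 r) (x0 + h n *\<^sub>R u) = s u" for u
    by (simp add: s_def dist_norm split: split_indicator)
  have s_sym: "s (- u) = s u" for u by (simp add: s_def indicator_def)
  have aff: "(\<lambda>u. x0 + h n *\<^sub>R u) \<in> borel_measurable borel"
    by (intro borel_measurable_continuous_onI continuous_intros)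
  have [measurable]: "(\<lambda>u. Q (x0 + h n *\<^sub>R u)) \<in> borel_measurable borel"
    by (rule measurable_compose[OF aff]) simp
  have [measurable]: "(\<lambda>u. v \<bullet> (h n *\<^sub>R u)) \<in> borel_measurable borel"
    by (intro borel_measurable_continuous_onI continuous_intros)
  have "expectation (\<lambda>w. kn K n (X w) * ((g (X w) - c0) * indicator (ball x0 r) (X w))) =
      (LINT x|lborel. p x * (kn K n x * ((g x - c0) * indicator (ball x0 r) x)))"
    by (subst distributed_integral[OF X_density, symmetric]) (auto simp: p_nonneg)
  also have "\<dots> = (LINT x|lborel. kn K n x * (Q x * indicator (ball x0 r) x))"
    by (intro Bochner_Integration.integral_cong) (auto simp: Q_def)
  also have "\<dots> = h n ^ CARD('dx) * (LINT u|lborel. K u * (s u * Q (x0 + h n *\<^sub>R u)))"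
    using hn by (subst lborel_integral_affine[where c="h n" and t=x0]) (auto simp: kn_def s_eq mult.commute)
  finally have eq: "expectation (\<lambda>w. kn K n (X w) * ((g (X w) - c0) * indicator (ball x0 r) (X w))) =
      h n ^ CARD('dx) * (LINT u|lborel. K u * (s u * Q (x0 + h n *\<^sub>R u)))" .
  have lin_le: "\<bar>s u * (v \<bullet> (h n *\<^sub>R u))\<bar> \<le> norm v * r" for u
  proof (cases "norm (h n *\<^sub>R u) < r")
    case True
    have "\<bar>v \<bullet> (h n *\<^sub>R u)\<bar> \<le> norm v * norm (h n *\<^sub>R u)" by (rule Cauchy_Schwarz_ineq2)
    also have "\<dots> \<le> norm v * r" using True by (intro mult_left_mono) auto
    finally show ?thesis using True by (simp add: s_def)
  qed (use r in \<open>simp add: s_def\<close>)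
  have rem: "\<bar>s u * Q (x0 + h n *\<^sub>R u) - s u * (v \<bullet> (h n *\<^sub>R u))\<bar> \<le> A * ((h n)\<^sup>2 * (norm u)\<^sup>2)" for u
  proof (cases "norm (h n *\<^sub>R u) < r")
    case True
    then have "x0 + h n *\<^sub>R u \<in> ball x0 r" by (simp add: dist_norm)
    from q[OF this] show ?thesis using True hn by (simp add: s_def Q_def dist_norm power_mult_distrib)
  qed (use A in \<open>simp add: s_def\<close>)
  have i1: "integrable lborel (\<lambda>u. K u * (s u * (v \<bullet> (h n *\<^sub>R u))))"
  proof (rule Bochner_Integration.integrable_bound[where f="\<lambda>u. K u * (norm v * r)"])
    show "AE u in lborel. norm (K u * (s u * (v \<bullet> (h n *\<^sub>R u)))) \<le> norm (K u * (norm v * r))"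
    proof (intro AE_I2)
      fix u
      have "K u * \<bar>s u * (v \<bullet> (h n *\<^sub>R u))\<bar> \<le> K u * (norm v * r)" by (intro mult_left_mono lin_le K0)
      then show "norm (K u * (s u * (v \<bullet> (h n *\<^sub>R u)))) \<le> norm (K u * (norm v * r))"
        using K0[of u] r by (simp add: abs_mult)
    qed
  qed (use Ki in auto)
  have i2: "integrable lborel (\<lambda>u. K u * (s u * Q (x0 + h n *\<^sub>R u) - s u * (v \<bullet> (h n *\<^sub>R u))))"
  proof (rule Bochner_Integration.integrable_bound[where f="\<lambda>u. A * (h n)\<^sup>2 * (K u * (norm u)\<^sup>2)"])
    show "AE u in lborel. norm (K u * (s u * Q (x0 + h n *\<^sub>R u) - s u * (v \<bullet> (h n *\<^sub>R u)))) \<le>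
        norm (A * (h n)\<^sup>2 * (K u * (norm u)\<^sup>2))"
    proof (intro AE_I2)
      fix u
      have "K u * \<bar>s u * Q (x0 + h n *\<^sub>R u) - s u * (v \<bullet> (h n *\<^sub>R u))\<bar> \<le> K u * (A * ((h n)\<^sup>2 * (norm u)\<^sup>2))"
        by (intro mult_left_mono rem K0)
      then show "norm (K u * (s u * Q (x0 + h n *\<^sub>R u) - s u * (v \<bullet> (h n *\<^sub>R u)))) \<le>
        norm (A * (h n)\<^sup>2 * (K u * (norm u)\<^sup>2))"
        using K0[of u] A by (simp add: abs_mult mult_ac)
    qed
  qed (use m in auto)
  have "(LINT u|lborel. K u * (s u * (v \<bullet> (h n *\<^sub>R u)))) = - (LINT u|lborel. K u * (s u * (v \<bullet> (h n *\<^sub>R u))))"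
    by (subst lborel_integral_affine[where c="-1" and t=0]) (auto simp: sym s_sym)
  \<comment> \<open>The kernel is even, so the linear term of the Taylor expansion integrates to zero.\<close>
  then have zero: "(LINT u|lborel. K u * (s u * (v \<bullet> (h n *\<^sub>R u)))) = 0" by simp
  have "(LINT u|lborel. K u * (s u * Q (x0 + h n *\<^sub>R u))) =
      (LINT u|lborel. K u * (s u * Q (x0 + h n *\<^sub>R u) - s u * (v \<bullet> (h n *\<^sub>R u))) + K u * (s u * (v \<bullet> (h n *\<^sub>R u))))"
    by (intro Bochner_Integration.integral_cong) (auto simp: algebra_simps)
  also have "\<dots> = (LINT u|lborel. K u * (s u * Q (x0 + h n *\<^sub>R u) - s u * (v \<bullet> (h n *\<^sub>R u))))"
    using zero by (subst Bochner_Integration.integral_add[OF i2 i1]) simp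
  finally have "\<bar>LINT u|lborel. K u * (s u * Q (x0 + h n *\<^sub>R u))\<bar> \<le>
      (LINT u|lborel. \<bar>K u * (s u * Q (x0 + h n *\<^sub>R u) - s u * (v \<bullet> (h n *\<^sub>R u)))\<bar>)"
    by (simp only: integral_abs_bound)
  also have "\<dots> \<le> (LINT u|lborel. A * (h n)\<^sup>2 * (K u * (norm u)\<^sup>2))"
  proof (intro integral_mono integrable_abs i2)
    show "\<bar>K u * (s u * Q (x0 + h n *\<^sub>R u) - s u * (v \<bullet> (h n *\<^sub>R u)))\<bar> \<le> A * (h n)\<^sup>2 * (K u * (norm u)\<^sup>2)" for u
      using mult_left_mono[OF rem K0[of u]] K0[of u] by (simp add: abs_mult mult_ac)
  qed (use m in auto)
  also have "\<dots> = A * (h n)\<^sup>2 * (LINT u|lborel. K u * (norm u)\<^sup>2)" by simp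
  finally have "h n ^ CARD('dx) * \<bar>LINT u|lborel. K u * (s u * Q (x0 + h n *\<^sub>R u))\<bar> \<le>
      h n ^ CARD('dx) * (A * (h n)\<^sup>2 * (LINT u|lborel. K u * (norm u)\<^sup>2))"
    using hn by (intro mult_left_mono) auto
  then show ?thesis unfolding eq abs_mult power_add using hn by (simp add: mult_ac)
qed

text \<open>The first alternative of \<open>tail_control\<close>. Where \<open>dist x x0\<close> is
  at least \<open>r\<close>, the factor \<open>(dist x x0 / r)^2\<close> is at least 1 and equals
  \<open>(h n * norm u / r)^2\<close> after rescaling, so the second moment of the kernel pays for
  the rate \<open>h ^ (d + 2)\<close>.\<close>

lemma far_bias_density:
  assumes K: "smoothing_kernel K" and m: "integrable lborel (\<lambda>u. K u * (norm u)\<^sup>2)"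
    and g: "cond_mean M X W g" and [measurable]: "\<X> \<in> sets borel" and X_in: "AE w in M. X w \<in> \<X>"
    and r: "0 < r" and B: "\<And>x. x \<in> \<X> \<Longrightarrow> \<bar>g x - c0\<bar> * p x \<le> B" and B0: "0 \<le> B"
    and n: "1 \<le> n"
  shows "\<bar>expectation (\<lambda>w. kn K n (X w) * ((W w - c0) * indicator {x. r \<le> dist x x0} (X w)))\<bar> \<le>
    B / r\<^sup>2 * (LINT u|lborel. K u * (norm u)\<^sup>2) * h n ^ (CARD('dx) + 2)"
proof -
  have [measurable]: "K \<in> borel_measurable borel" and K0: "\<And>u. 0 \<le> K u"
    using K by (auto simp: smoothing_kernel_def)
  obtain Bk where Bk: "\<And>u. K u \<le> Bk" using K by (auto simp: smoothing_kernel_def)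
  have [measurable]: "g \<in> borel_measurable borel" using g by (simp add: cond_mean_def)
  have hn: "0 < h n" by (rule h_pos[OF n])
  define far where "far = (\<lambda>x. kn K n x * indicator {x. r \<le> dist x x0} x)"
  have [measurable]: "far \<in> borel_measurable borel" unfolding far_def by measurable
  have far0: "0 \<le> far x" for x using K0 by (simp add: far_def kn_def)
  have farB: "\<bar>far x\<bar> \<le> Bk" for x
    using K0[of "(1 / h n) *\<^sub>R (x - x0)"] Bk[of "(1 / h n) *\<^sub>R (x - x0)"] by (auto simp: far_def kn_def split: split_indicator)
  have g': "cond_mean M X (\<lambda>w. W w + - c0) (\<lambda>x. g x + - c0)"
    by (intro cond_mean_add g cond_mean_const)
  note ci = cond_mean_intg[OF g' \<open>far \<in> borel_measurable borel\<close> farB]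
  define k2 where "k2 u = (h n)\<^sup>2 / r\<^sup>2 * (K u * (norm u)\<^sup>2)" for u
  have [measurable]: "k2 \<in> borel_measurable borel" unfolding k2_def[abs_def] by measurable
  have k2i: "integrable lborel k2" unfolding k2_def[abs_def] using m by simp
  have [measurable]: "(\<lambda>x. k2 ((1 / h n) *\<^sub>R (x - x0))) \<in> borel_measurable borel"
    by (rule measurable_compose[of _ borel borel k2]) (auto intro!: borel_measurable_continuous_onI continuous_intros)
  have k2x: "integrable lborel (\<lambda>x. k2 ((1 / h n) *\<^sub>R (x - x0)))"
    using k2i hn by (subst lborel_integrable_affine[where c="h n" and t=x0]) auto
  have far_k2: "far x \<le> k2 ((1 / h n) *\<^sub>R (x - x0))" for x
  proof (cases "r \<le> dist x x0")
    case True
    have "1 \<le> (dist x x0 / r)\<^sup>2" using True r by (intro one_le_power) simp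
    then have "K ((1 / h n) *\<^sub>R (x - x0)) * 1 \<le> K ((1 / h n) *\<^sub>R (x - x0)) * (dist x x0 / r)\<^sup>2"
      by (intro mult_left_mono K0)
    also have "\<dots> = k2 ((1 / h n) *\<^sub>R (x - x0))"
      using hn by (simp add: k2_def dist_norm power_divide)
    finally show ?thesis using True by (simp add: far_def kn_def)
  next
    case False
    then show ?thesis using K0 by (simp add: far_def k2_def)
  qed
  have "expectation (\<lambda>w. kn K n (X w) * ((W w - c0) * indicator {x. r \<le> dist x x0} (X w))) =
      expectation (\<lambda>w. far (X w) * (W w + - c0))"
    by (intro Bochner_Integration.integral_cong) (auto simp: far_def)
  also have "\<dots> = expectation (\<lambda>w. far (X w) * (g (X w) + - c0))" by (rule ci(2))
  also have "\<bar>\<dots>\<bar> \<le> expectation (\<lambda>w. \<bar>far (X w) * (g (X w) + - c0)\<bar>)" by (rule integral_abs_bound)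
  also have "\<dots> = expectation (\<lambda>w. far (X w) * (indicator \<X> (X w) * \<bar>g (X w) - c0\<bar>))"
    using X_in by (intro integral_cong_AE) (auto elim!: eventually_mono simp: abs_mult far0)
  also have "\<dots> = (LINT x|lborel. p x * (far x * (indicator \<X> x * \<bar>g x - c0\<bar>)))"
    by (subst distributed_integral[OF X_density, symmetric]) (auto simp: p_nonneg)
  also have "\<dots> \<le> (LINT x|lborel. B * k2 ((1 / h n) *\<^sub>R (x - x0)))"
  proof (rule integral_mono')
    show "integrable lborel (\<lambda>x. B * k2 ((1 / h n) *\<^sub>R (x - x0)))" using k2x by simp
    show "0 \<le> B * k2 ((1 / h n) *\<^sub>R (x - x0))" for x using B0 K0 by (simp add: k2_def)
    show "p x * (far x * (indicator \<X> x * \<bar>g x - c0\<bar>)) \<le> B * k2 ((1 / h n) *\<^sub>R (x - x0))" for x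
    proof (cases "x \<in> \<X>")
      case True
      have "(\<bar>g x - c0\<bar> * p x) * far x \<le> B * k2 ((1 / h n) *\<^sub>R (x - x0))"
        using B[OF True] far_k2 far0 B0 by (intro mult_mono) auto
      then show ?thesis using True by (simp add: mult_ac)
    next
      case False
      then show ?thesis using B0 K0 by (simp add: k2_def)
    qed
  qed
  also have "\<dots> = B * (h n ^ CARD('dx) * (LINT u|lborel. k2 u))"
    using hn by (simp, subst lborel_integral_affine[where c="h n" and t=x0]) auto
  also have "\<dots> = B / r\<^sup>2 * (LINT u|lborel. K u * (norm u)\<^sup>2) * h n ^ (CARD('dx) + 2)"
  proof -
    have "(LINT u|lborel. k2 u) = (h n)\<^sup>2 / r\<^sup>2 * (LINT u|lborel. K u * (norm u)\<^sup>2)"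
      unfolding k2_def by (rule integral_mult_right_zero)
    then show ?thesis by (simp add: power_add power2_eq_square)
  qed
  finally show ?thesis .
qed

text \<open>The second alternative of \<open>tail_control\<close>. Pointwise decay of order
  \<open>d + 2\<close> bounds the kernel at distance at least \<open>r\<close> by
  \<open>B * (h n / r) ^ (d + 2)\<close>, and the first moment of \<open>W\<close> suffices.\<close>

lemma far_bias_kernel:
  assumes K: "smoothing_kernel K" and B: "\<And>u. norm u ^ (CARD('dx) + 2) * K u \<le> B" and B0: "0 \<le> B"
    and W: "integrable M W" and r: "0 < r" and n: "1 \<le> n"
  shows "\<bar>expectation (\<lambda>w. kn K n (X w) * (W w * indicator {x. r \<le> dist x x0} (X w)))\<bar> \<le>
    B / r ^ (CARD('dx) + 2) * expectation (\<lambda>w. \<bar>W w\<bar>) * h n ^ (CARD('dx) + 2)"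
proof -
  have [measurable]: "K \<in> borel_measurable borel" and K0: "\<And>u. 0 \<le> K u"
    using K by (auto simp: smoothing_kernel_def)
  have [measurable]: "W \<in> borel_measurable M" using W by simp
  have hn: "0 < h n" by (rule h_pos[OF n])
  let ?c = "B / r ^ (CARD('dx) + 2) * h n ^ (CARD('dx) + 2)"
  have pt: "kn K n x * indicator {x. r \<le> dist x x0} x \<le> ?c" for x
  proof (cases "r \<le> dist x x0")
    case True
    define u where "u = (1 / h n) *\<^sub>R (x - x0)"
    have "r / h n \<le> norm u" using True hn by (simp add: u_def dist_norm divide_right_mono)
    then have "(r / h n) ^ (CARD('dx) + 2) * K u \<le> norm u ^ (CARD('dx) + 2) * K u"
      using r hn K0 by (intro mult_right_mono power_mono) auto
    also have "\<dots> \<le> B" by (rule B)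
    finally have "K u \<le> ?c" using r hn by (simp add: power_divide field_simps del: power_Suc power_add)
    then show ?thesis using True by (simp add: kn_def u_def)
  next
    case False
    then show ?thesis using B0 r hn by simp
  qed
  have "\<bar>expectation (\<lambda>w. kn K n (X w) * (W w * indicator {x. r \<le> dist x x0} (X w)))\<bar> \<le>
      expectation (\<lambda>w. \<bar>kn K n (X w) * (W w * indicator {x. r \<le> dist x x0} (X w))\<bar>)" by (rule integral_abs_bound)
  also have "\<dots> \<le> expectation (\<lambda>w. ?c * \<bar>W w\<bar>)"
  proof (rule integral_mono')
    fix w
    show "0 \<le> ?c * \<bar>W w\<bar>" using B0 r hn by simp
    have "\<bar>kn K n (X w) * (W w * indicator {x. r \<le> dist x x0} (X w))\<bar> =
        (kn K n (X w) * indicator {x. r \<le> dist x x0} (X w)) * \<bar>W w\<bar>"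
      using K0 by (simp add: abs_mult kn_def)
    also have "\<dots> \<le> ?c * \<bar>W w\<bar>" by (intro mult_right_mono pt) simp
    finally show "\<bar>kn K n (X w) * (W w * indicator {x. r \<le> dist x x0} (X w))\<bar> \<le> ?c * \<bar>W w\<bar>" .
  qed (use W in auto)
  also have "\<dots> = B / r ^ (CARD('dx) + 2) * expectation (\<lambda>w. \<bar>W w\<bar>) * h n ^ (CARD('dx) + 2)" by simp
  finally show ?thesis .
qed

text \<open>Conditioning is applied only to the near part. The far part stays a hypothesis in terms
  of \<open>W\<close>, because the alternatives of \<open>tail_control\<close> estimate it
  differently.\<close>

lemma bias_bound:
  assumes K: "smoothing_kernel K" and sym: "\<And>u. K (- u) = K u"
    and m: "integrable lborel (\<lambda>u. K u * (norm u)\<^sup>2)"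
    and g: "cond_mean M X W g" and r: "0 < r" and A: "0 \<le> A"
    and q: "\<And>x. x \<in> ball x0 r \<Longrightarrow> \<bar>(g x - c0) * p x - v \<bullet> (x - x0)\<bar> \<le> A * (dist x x0)\<^sup>2"
    and n: "1 \<le> n"
    and far: "\<bar>expectation (\<lambda>w. kn K n (X w) * ((W w - c0) * indicator {x. r \<le> dist x x0} (X w)))\<bar> \<le>
      D * h n ^ (CARD('dx) + 2)"
  shows "\<bar>kmean K n (\<lambda>w. W w - c0)\<bar> \<le> (A * (LINT u|lborel. K u * (norm u)\<^sup>2) + D) * (h n)\<^sup>2"
proof -
  have [measurable]: "K \<in> borel_measurable borel" and K0: "\<And>u. 0 \<le> K u"
    using K by (auto simp: smoothing_kernel_def)
  obtain Bk where Bk: "\<And>u. K u \<le> Bk" using K by (auto simp: smoothing_kernel_def)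
  have [measurable]: "g \<in> borel_measurable borel" and W: "integrable M W" using g by (auto simp: cond_mean_def)
  have [measurable]: "ball x0 r \<in> sets borel" by simp
  have [measurable]: "W \<in> borel_measurable M" using W by simp
  have hn: "0 < h n" by (rule h_pos[OF n])
  define near where "near = (\<lambda>x. kn K n x * indicator (ball x0 r) x)"
  have [measurable]: "near \<in> borel_measurable borel" unfolding near_def by measurable
  have nearB: "\<bar>near x\<bar> \<le> Bk" for x
    using K0[of "(1 / h n) *\<^sub>R (x - x0)"] Bk[of "(1 / h n) *\<^sub>R (x - x0)"] by (auto simp: near_def kn_def split: split_indicator)
  have g': "cond_mean M X (\<lambda>w. W w + - c0) (\<lambda>x. g x + - c0)"
    by (intro cond_mean_add g cond_mean_const)
  have "expectation (\<lambda>w. near (X w) * (W w + - c0)) = expectation (\<lambda>w. near (X w) * (g (X w) + - c0))"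
    by (rule cond_mean_intg(2)[OF g' _ nearB]) simp
  then have near_eq: "expectation (\<lambda>w. kn K n (X w) * ((W w - c0) * indicator (ball x0 r) (X w))) =
      expectation (\<lambda>w. kn K n (X w) * ((g (X w) - c0) * indicator (ball x0 r) (X w)))"
    by (simp add: near_def mult_ac)
  have i: "integrable M (\<lambda>w. (W w - c0) * indicator (ball x0 r) (X w))"
    "integrable M (\<lambda>w. (W w - c0) * indicator {x. r \<le> dist x x0} (X w))"
    by (rule Bochner_Integration.integrable_bound[where f="\<lambda>w. W w - c0"]; use W in \<open>auto split: split_indicator\<close>)+
  have "expectation (\<lambda>w. kn K n (X w) * (W w - c0)) =
      expectation (\<lambda>w. kn K n (X w) * ((W w - c0) * indicator (ball x0 r) (X w)) +
        kn K n (X w) * ((W w - c0) * indicator {x. r \<le> dist x x0} (X w)))"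
    by (intro Bochner_Integration.integral_cong) (auto simp: dist_commute split: split_indicator)
  also have "\<dots> = expectation (\<lambda>w. kn K n (X w) * ((W w - c0) * indicator (ball x0 r) (X w))) +
      expectation (\<lambda>w. kn K n (X w) * ((W w - c0) * indicator {x. r \<le> dist x x0} (X w)))"
    by (intro Bochner_Integration.integral_add kn_integrable K i)
  finally have "\<bar>expectation (\<lambda>w. kn K n (X w) * (W w - c0))\<bar> \<le>
      A * (LINT u|lborel. K u * (norm u)\<^sup>2) * h n ^ (CARD('dx) + 2) + D * h n ^ (CARD('dx) + 2)"
    using near_bias[OF K sym m _ r A q n] far unfolding near_eq by (auto intro: order_trans[OF abs_triangle_ineq] add_mono)
  then have "\<bar>expectation (\<lambda>w. kn K n (X w) * (W w - c0))\<bar> / h n ^ CARD('dx) \<le>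
      ((A * (LINT u|lborel. K u * (norm u)\<^sup>2) + D) * (h n)\<^sup>2 * h n ^ CARD('dx)) / h n ^ CARD('dx)"
    using hn by (intro divide_right_mono) (auto simp: power_add power2_eq_square algebra_simps)
  then show ?thesis using hn by (simp add: kmean_def)
qed

text \<open>On \<open>|W| > L\<close> one has
  \<open>|W| \<le> |W|^(1 + \<gamma>/2) / L^(\<gamma>/2)\<close>. As \<open>|W|\<close> is of order
  \<open>1 + m^2\<close>, the numerator is of order \<open>1 + m^(2 + \<gamma>)\<close>, whose
  conditional mean is bounded on the ball; hence \<open>L\<close> can be chosen without regard to
  the weight \<open>\<psi>\<close>.\<close>

lemma locally_ui_envelope:
  fixes m :: "'w \<Rightarrow> real"
  assumes r: "0 < r" and \<gamma>: "0 < \<gamma>" and Cm: "0 \<le> Cm" and c: "0 < c"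
    and [measurable]: "m \<in> borel_measurable M" "W \<in> borel_measurable M"
    and m0: "AE w in M. 0 \<le> m w"
    and mom: "AE w in M. X w \<in> ball x0 r \<longrightarrow>
      nn_cond_exp M (sigma_gen M X) (\<lambda>w. ennreal (m w powr (2 + \<gamma>))) w \<le> ennreal Cm"
    and W: "AE w in M. \<bar>W w\<bar> \<le> c * (1 + (m w)\<^sup>2)"
  shows "locally_ui W"
  unfolding locally_ui_def
proof (rule exI[of _ r], intro conjI r allI impI)
  fix e :: real assume e: "0 < e"
  have [measurable]: "ball x0 r \<in> sets borel" by simp
  define s where "s = 1 + \<gamma> / 2"
  have s: "0 < s" using \<gamma> by (simp add: s_def)
  define c' where "c' = (2 * c) powr s"
  have c': "0 < c'" using c by (simp add: c'_def)
  \<comment> \<open>Chosen so that \<open>\<kappa> * (1 + Cm) = e\<close> below, with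
    \<open>L\<close> then determined by \<open>L powr (\<gamma> / 2) = T\<close>.\<close>
  define T where "T = c' * (1 + Cm) / e"
  have T: "0 < T" using c' Cm e by (simp add: T_def)
  define L where "L = T powr (2 / \<gamma>)"
  have L: "0 < L" using T by (simp add: L_def)
  have LT: "L powr (\<gamma> / 2) = T" using T \<gamma> by (simp add: L_def powr_powr)
  define \<kappa> where "\<kappa> = c' / T"
  have \<kappa>: "0 < \<kappa>" using c' T by (simp add: \<kappa>_def)
  have \<kappa>e: "\<kappa> * (1 + Cm) = e" using c' Cm e by (simp add: \<kappa>_def T_def)
  let ?D = "\<lambda>w. \<bar>W w\<bar> * indicator {L<..} \<bar>W w\<bar>"
  have D: "AE w in M. ?D w \<le> \<kappa> * (1 + m w powr (2 + \<gamma>))"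
    using W m0
  proof eventually_elim
    case (elim w)
    show ?case
    proof (cases "L < \<bar>W w\<bar>")
      case True
      have "\<bar>W w\<bar> * T \<le> \<bar>W w\<bar> * \<bar>W w\<bar> powr (\<gamma> / 2)"
        unfolding LT[symmetric] using True L \<gamma> by (intro mult_left_mono powr_mono2) auto
      also have "\<dots> = \<bar>W w\<bar> powr s" using True L by (simp add: s_def powr_add)
      also have "\<dots> \<le> (2 * c * max 1 ((m w)\<^sup>2)) powr s"
      proof (intro powr_mono2)
        have "c * (1 + (m w)\<^sup>2) \<le> c * (2 * max 1 ((m w)\<^sup>2))" using c by (intro mult_left_mono) auto
        then show "\<bar>W w\<bar> \<le> 2 * c * max 1 ((m w)\<^sup>2)" using elim(1) by simp
      qed (use s in auto)
      also have "\<dots> = c' * max 1 ((m w)\<^sup>2) powr s" using c by (simp add: c'_def powr_mult)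
      also have "\<dots> \<le> c' * (1 + m w powr (2 + \<gamma>))"
      proof (intro mult_left_mono)
        have "((m w)\<^sup>2) powr s = m w powr (2 + \<gamma>)"
        proof (cases "m w = 0")
          case False
          then have "(m w)\<^sup>2 = m w powr 2" using elim(2) by simp
          then show ?thesis by (simp add: powr_powr s_def algebra_simps)
        qed simp
        then show "max 1 ((m w)\<^sup>2) powr s \<le> 1 + m w powr (2 + \<gamma>)" by (simp add: max_def)
      qed (use c' in simp)
      finally have "\<bar>W w\<bar> \<le> \<kappa> * (1 + m w powr (2 + \<gamma>))" using T by (simp add: \<kappa>_def field_simps)
      then show ?thesis using True by simp
    next
      case False
      then show ?thesis using \<kappa> by simp
    qed
  qed
  interpret finite_measure_subalgebra M "sigma_gen M X" by standard (rule subalgebra_sigma_gen)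
  have XF: "X \<in> measurable (sigma_gen M X) borel" by (rule measurable_vimage_algebra1) simp
  show "\<exists>L. \<forall>\<psi>\<in>borel_measurable borel. (\<forall>x. 0 \<le> \<psi> x) \<longrightarrow> (\<exists>B. \<forall>x. \<psi> x \<le> B) \<longrightarrow>
     expectation (\<lambda>w. \<psi> (X w) * (indicator (ball x0 r) (X w) * (\<bar>W w\<bar> * indicator {L<..} \<bar>W w\<bar>)))
       \<le> e * expectation (\<lambda>w. \<psi> (X w))"
  proof (intro exI[of _ L] ballI impI)
    fix \<psi> :: "real^'dx \<Rightarrow> real"
    assume [measurable]: "\<psi> \<in> borel_measurable borel" and \<psi>0: "\<forall>x. 0 \<le> \<psi> x" and "\<exists>B. \<forall>x. \<psi> x \<le> B"
    then obtain B where B: "\<And>x. \<psi> x \<le> B" by blast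
    have i\<psi>: "integrable M (\<lambda>w. \<psi> (X w))"
      using \<psi>0 B by (intro integrable_const_bound[where B=B]) auto
    \<comment> \<open>The moment bound is available only where \<open>X\<close> lies in the ball, so
      the ball indicator is absorbed into the weight. Integrals with values in
      \<open>ennreal\<close> avoid any integrability claim for the envelope elsewhere.\<close>
    define \<phi> where "\<phi> x = ennreal (\<psi> x * indicator (ball x0 r) x)" for x
    have [measurable]: "\<phi> \<in> borel_measurable borel" unfolding \<phi>_def[abs_def] by measurable
    have \<phi>F: "(\<lambda>w. \<phi> (X w)) \<in> borel_measurable (sigma_gen M X)"
      by (rule measurable_compose[OF XF]) simp
    let ?m = "\<lambda>w. ennreal (m w powr (2 + \<gamma>))"
    have "(\<integral>\<^sup>+ w. \<phi> (X w) * nn_cond_exp M (sigma_gen M X) ?m w \<partial>M) \<le> (\<integral>\<^sup>+ w. \<phi> (X w) * ennreal Cm \<partial>M)"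
    proof (rule nn_integral_mono_AE)
      show "AE w in M. \<phi> (X w) * nn_cond_exp M (sigma_gen M X) ?m w \<le> \<phi> (X w) * ennreal Cm"
        using mom
      proof eventually_elim
        case (elim w)
        then show ?case by (cases "X w \<in> ball x0 r") (auto simp: \<phi>_def intro: mult_left_mono)
      qed
    qed
    also have "\<dots> = ennreal Cm * (\<integral>\<^sup>+ w. \<phi> (X w) \<partial>M)" by (subst nn_integral_multc) (auto intro: mult.commute)
    finally have moment: "(\<integral>\<^sup>+ w. \<phi> (X w) * nn_cond_exp M (sigma_gen M X) ?m w \<partial>M) \<le>
        ennreal Cm * (\<integral>\<^sup>+ w. \<phi> (X w) \<partial>M)" .
    have "(\<integral>\<^sup>+ w. ennreal (\<psi> (X w) * (indicator (ball x0 r) (X w) * ?D w)) \<partial>M) \<le>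
        (\<integral>\<^sup>+ w. ennreal \<kappa> * (\<phi> (X w) + \<phi> (X w) * ?m w) \<partial>M)"
    proof (rule nn_integral_mono_AE)
      show "AE w in M. ennreal (\<psi> (X w) * (indicator (ball x0 r) (X w) * ?D w)) \<le>
          ennreal \<kappa> * (\<phi> (X w) + \<phi> (X w) * ?m w)"
        using D
      proof eventually_elim
        case (elim w)
        let ?a = "\<psi> (X w) * indicator (ball x0 r) (X w)"
        have a0: "0 \<le> ?a" using \<psi>0 by simp
        have "?a * ?D w \<le> ?a * (\<kappa> * (1 + m w powr (2 + \<gamma>)))" by (intro mult_left_mono elim a0)
        also have "\<dots> = \<kappa> * (?a + ?a * m w powr (2 + \<gamma>))" by (simp add: algebra_simps)
        finally have "ennreal (?a * ?D w) \<le> ennreal (\<kappa> * (?a + ?a * m w powr (2 + \<gamma>)))" by (rule ennreal_leI)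
        also have "\<dots> = ennreal \<kappa> * (\<phi> (X w) + \<phi> (X w) * ?m w)"
        proof -
          have *: "ennreal (k * (a + a * P)) = ennreal k * (ennreal a + ennreal a * ennreal P)"
            if "0 \<le> k" "0 \<le> a" "0 \<le> P" for k a P :: real
            using that by (simp add: ennreal_mult)
          show ?thesis unfolding \<phi>_def using \<kappa> by (intro * a0) auto
        qed
        finally show ?case by (simp add: mult.assoc)
      qed
    qed
    also have "\<dots> = ennreal \<kappa> * ((\<integral>\<^sup>+ w. \<phi> (X w) \<partial>M) + (\<integral>\<^sup>+ w. \<phi> (X w) * ?m w \<partial>M))"
      by (simp add: nn_integral_cmult nn_integral_add)
    also have "(\<integral>\<^sup>+ w. \<phi> (X w) * ?m w \<partial>M) = (\<integral>\<^sup>+ w. \<phi> (X w) * nn_cond_exp M (sigma_gen M X) ?m w \<partial>M)"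
      by (rule nn_cond_exp_intg[OF \<phi>F, symmetric]) measurable
    also have "ennreal \<kappa> * ((\<integral>\<^sup>+ w. \<phi> (X w) \<partial>M) + (\<integral>\<^sup>+ w. \<phi> (X w) * nn_cond_exp M (sigma_gen M X) ?m w \<partial>M)) \<le>
        ennreal \<kappa> * ((\<integral>\<^sup>+ w. \<phi> (X w) \<partial>M) + ennreal Cm * (\<integral>\<^sup>+ w. \<phi> (X w) \<partial>M))"
      by (intro mult_left_mono add_left_mono moment) simp
    also have "ennreal \<kappa> * ((\<integral>\<^sup>+ w. \<phi> (X w) \<partial>M) + ennreal Cm * (\<integral>\<^sup>+ w. \<phi> (X w) \<partial>M)) =
        ennreal e * (\<integral>\<^sup>+ w. \<phi> (X w) \<partial>M)"
    proof -
      have "ennreal e = ennreal \<kappa> * (1 + ennreal Cm)"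
        unfolding \<kappa>e[symmetric] using \<kappa> Cm by (simp add: ennreal_mult)
      then show ?thesis by (simp add: distrib_left distrib_right mult.assoc)
    qed
    also have "\<dots> \<le> ennreal e * (\<integral>\<^sup>+ w. ennreal (\<psi> (X w)) \<partial>M)"
      using \<psi>0 by (intro mult_left_mono nn_integral_mono) (auto simp: \<phi>_def split: split_indicator)
    also have "\<dots> = ennreal (e * expectation (\<lambda>w. \<psi> (X w)))"
      using i\<psi> \<psi>0 e by (simp add: nn_integral_eq_integral ennreal_mult integral_nonneg_AE)
    finally have bound: "(\<integral>\<^sup>+ w. ennreal (\<psi> (X w) * (indicator (ball x0 r) (X w) * ?D w)) \<partial>M) \<le>
        ennreal (e * expectation (\<lambda>w. \<psi> (X w)))" .
    show "expectation (\<lambda>w. \<psi> (X w) * (indicator (ball x0 r) (X w) * (\<bar>W w\<bar> * indicator {L<..} \<bar>W w\<bar>)))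
       \<le> e * expectation (\<lambda>w. \<psi> (X w))"
      using \<psi>0 e by (intro integral_real_bounded bound mult_nonneg_nonneg integral_nonneg_AE) auto
  qed
qed

end

section \<open>Bandwidths, kernels, and the theorem\<close>

text \<open>\<open>n * h n ^ d\<close> is a multiple of \<open>n^(1 - \<delta> * d)\<close>, which
  diverges by \<open>\<delta> < 1 / d\<close>. The scaled bias has exponent
  \<open>(1 - \<delta> * d) / 2 - 2 * \<delta>\<close>, negative exactly because
  \<open>\<delta> > 1 / (d + 4)\<close>.\<close>

lemma bandwidth_rates:
  assumes bw: "bandwidth d h" and d: "1 \<le> d"
  shows "1 \<le> n \<Longrightarrow> 0 < h n" "h \<longlonglongrightarrow> 0"
    "filterlim (\<lambda>n. real n * h n ^ d) at_top sequentially"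
    "(\<lambda>n. sqrt (real n * h n ^ d) * (h n)\<^sup>2) \<longlonglongrightarrow> 0"
proof -
  obtain h0 \<delta> where h0: "0 < h0" and \<delta>: "1 / (real d + 4) < \<delta>" "\<delta> < 1 / real d"
    and h: "\<And>n. 1 \<le> n \<Longrightarrow> h n = h0 * real n powr (- \<delta>)"
    using bw by (auto simp: bandwidth_def)
  have "0 < 1 / (real d + 4)" by (simp add: add_nonneg_pos)
  then have \<delta>0: "0 < \<delta>" using \<delta> by linarith
  have e1: "0 < 1 - \<delta> * d" using \<delta>(2) d by (simp add: field_simps)
  have e2: "(1 - \<delta> * d) / 2 - 2 * \<delta> < 0"
    using \<delta>(1) by (simp add: pos_divide_less_eq add_nonneg_pos algebra_simps)
  show "1 \<le> n \<Longrightarrow> 0 < h n" using h h0 by simp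
  have ev: "\<forall>\<^sub>F n in sequentially. (1::nat) \<le> n" by (rule eventually_ge_at_top)
  have neg: "(\<lambda>n. real n powr s) \<longlonglongrightarrow> 0" if "s < 0" for s
    by (rule tendsto_neg_powr[OF that filterlim_real_sequentially])
  have "(\<lambda>n. h0 * real n powr (- \<delta>)) \<longlonglongrightarrow> h0 * 0" by (intro tendsto_mult tendsto_const neg) (use \<delta>0 in simp)
  then have "(\<lambda>n. h0 * real n powr (- \<delta>)) \<longlonglongrightarrow> 0" by simp
  then show "h \<longlonglongrightarrow> 0"
    by (rule Lim_transform_eventually) (rule eventually_mono[OF ev], use h in simp)
  have nh: "real n * h n ^ d = h0 ^ d * real n powr (1 - \<delta> * d)" if n: "1 \<le> n" for n
  proof -
    have "(real n powr (- \<delta>)) ^ d = real n powr (- \<delta> * d)" using n by (simp add: powr_power mult.commute)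
    then have "real n * h n ^ d = h0 ^ d * (real n powr 1 * real n powr (- \<delta> * d))"
      using n by (simp add: h[OF n] power_mult_distrib)
    then show ?thesis unfolding powr_add[symmetric] by simp
  qed
  have "filterlim (\<lambda>n. inverse (real n powr (- (1 - \<delta> * d)))) at_top sequentially"
  proof (rule filterlim_inverse_at_top)
    show "(\<lambda>n. real n powr (- (1 - \<delta> * d))) \<longlonglongrightarrow> 0" using e1 by (intro neg) simp
    show "\<forall>\<^sub>F n in sequentially. 0 < real n powr (- (1 - \<delta> * d))" using ev by (rule eventually_mono) simp
  qed
  then have "filterlim (\<lambda>n. real n powr (1 - \<delta> * d)) at_top sequentially"
    by (simp add: powr_minus[symmetric])
  then have "filterlim (\<lambda>n. h0 ^ d * real n powr (1 - \<delta> * d)) at_top sequentially"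
    using h0 by (intro filterlim_tendsto_pos_mult_at_top[OF tendsto_const]) auto
  then show "filterlim (\<lambda>n. real n * h n ^ d) at_top sequentially"
  proof (rule filterlim_cong[THEN iffD1, rotated -1, OF _ refl refl])
    show "\<forall>\<^sub>F n in sequentially. h0 ^ d * real n powr (1 - \<delta> * d) = real n * h n ^ d"
      by (rule eventually_mono[OF ev]) (rule nh[symmetric])
  qed
  have "(\<lambda>n. sqrt (h0 ^ d) * h0\<^sup>2 * real n powr ((1 - \<delta> * d) / 2 - 2 * \<delta>)) \<longlonglongrightarrow> sqrt (h0 ^ d) * h0\<^sup>2 * 0"
    by (intro tendsto_mult tendsto_const neg e2)
  then have "(\<lambda>n. sqrt (h0 ^ d) * h0\<^sup>2 * real n powr ((1 - \<delta> * d) / 2 - 2 * \<delta>)) \<longlonglongrightarrow> 0" by simp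
  then show "(\<lambda>n. sqrt (real n * h n ^ d) * (h n)\<^sup>2) \<longlonglongrightarrow> 0"
  proof (rule Lim_transform_eventually)
    show "\<forall>\<^sub>F n in sequentially. sqrt (h0 ^ d) * h0\<^sup>2 * real n powr ((1 - \<delta> * d) / 2 - 2 * \<delta>) =
        sqrt (real n * h n ^ d) * (h n)\<^sup>2"
      using ev
    proof eventually_elim
      case (elim n)
      have "sqrt (real n powr (1 - \<delta> * d)) = real n powr ((1 - \<delta> * d) / 2)"
        by (simp add: powr_half_sqrt[symmetric] powr_powr)
      moreover have "(real n powr (- \<delta>))\<^sup>2 = real n powr (- (2 * \<delta>))" using elim by (simp add: powr_power)
      moreover have "real n powr ((1 - \<delta> * d) / 2 - 2 * \<delta>) = real n powr ((1 - \<delta> * d) / 2) * real n powr (- (2 * \<delta>))"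
        by (simp add: powr_add[symmetric])
      ultimately show ?case
        unfolding nh[OF elim] unfolding h[OF elim] by (simp add: real_sqrt_mult power_mult_distrib)
    qed
  qed
qed

text \<open>The trace of the second-moment matrix gives the moment of \<open>norm u ^ 2\<close>.
  Integrability of \<open>K\<close> follows from boundedness on the unit ball and this moment
  outside it. The mass is positive, since otherwise \<open>K\<close> would vanish almost everywhere
  and \<open>\<Upsilon>\<close> would be zero.\<close>

lemma regular_kernelD:
  fixes K :: "real^'dx \<Rightarrow> real"
  assumes rk: "regular_kernel K"
  shows "smoothing_kernel K" "0 < integral\<^sup>L lborel K" "K (- u) = K u"
    "integrable lborel (\<lambda>u. K u * (norm u)\<^sup>2)"
proof -
  have [measurable]: "K \<in> borel_measurable borel" and K0: "\<And>u. 0 \<le> K u"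
    and rad: "\<And>u v. norm u = norm v \<Longrightarrow> K u = K v"
    and Ko: "integrable lborel (\<lambda>u. K u *\<^sub>R outer u)"
    and lim: "((\<lambda>u. norm u ^ CARD('dx) * K u) \<longlongrightarrow> 0) at_infinity"
    using rk unfolding regular_kernel_def by blast+
  obtain \<Upsilon> where \<Upsilon>: "0 < \<Upsilon>" "(LINT u|lborel. K u *\<^sub>R outer u) = \<Upsilon> *\<^sub>R mat 1"
    using rk unfolding regular_kernel_def by blast
  obtain B where B: "\<And>u. \<bar>K u\<bar> \<le> B" using rk unfolding regular_kernel_def by blast
  show "K (- u) = K u" by (rule rad) simp
  have comp: "bounded_linear (\<lambda>A :: real^'dx^'dx. A $ i $ i)" for i
    by (rule bounded_linear_compose[OF bounded_linear_vec_nth bounded_linear_vec_nth])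
  have "integrable lborel (\<lambda>u. (K u *\<^sub>R outer u) $ i $ i)" for i
    by (rule integrable_bounded_linear[OF comp Ko])
  then have "integrable lborel (\<lambda>u. \<Sum>i\<in>UNIV. (K u *\<^sub>R outer u) $ i $ i)"
    by (intro Bochner_Integration.integrable_sum)
  moreover have "(\<Sum>i\<in>UNIV. (K u *\<^sub>R outer u) $ i $ i) = K u * (norm u)\<^sup>2" for u
    by (simp add: outer_def sum_distrib_left power2_norm_eq_inner inner_vec_def)
  ultimately show m: "integrable lborel (\<lambda>u. K u * (norm u)\<^sup>2)" by simp
  have Kint: "integrable lborel K"
  proof (rule Bochner_Integration.integrable_bound)
    show "integrable lborel (\<lambda>u. B * indicator (cball 0 1) u + K u * (norm u)\<^sup>2)"
      using emeasure_bounded_finite[OF bounded_cball[of "0::real^'dx" 1]] m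
      by (intro Bochner_Integration.integrable_add integrable_mult_right integrable_real_indicator) auto
    show "AE u in lborel. norm (K u) \<le> norm (B * indicator (cball 0 1) u + K u * (norm u)\<^sup>2)"
    proof (intro AE_I2)
      fix u :: "real^'dx"
      have "K u \<le> B * indicator (cball 0 1) u + K u * (norm u)\<^sup>2"
      proof (cases "norm u \<le> 1")
        case True
        have "K u \<le> B" using B[of u] by linarith
        then show ?thesis using True K0[of u] by (simp add: add_increasing2)
      next
        case False
        then have "K u * 1 \<le> K u * (norm u)\<^sup>2" by (intro mult_left_mono K0 one_le_power) auto
        then show ?thesis using False by simp
      qed
      then show "norm (K u) \<le> norm (B * indicator (cball 0 1) u + K u * (norm u)\<^sup>2)"
        using K0[of u] by simp
    qed
  qed simp
  have "K u \<le> B" for u using B[of u] by linarith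
  with K0 Kint lim show "smoothing_kernel K" by (auto simp: smoothing_kernel_def)
  show "0 < integral\<^sup>L lborel K"
  proof (rule ccontr)
    assume "\<not> ?thesis"
    moreover have "0 \<le> integral\<^sup>L lborel K" using K0 by simp
    ultimately have "integral\<^sup>L lborel K = 0" by linarith
    then have "AE u in lborel. K u = 0"
      using Kint K0 by (subst (asm) integral_nonneg_eq_0_iff_AE) auto
    then have "(LINT u|lborel. K u *\<^sub>R outer u) = 0"
      by (intro integral_eq_zero_AE) (auto elim!: eventually_mono)
    then have "\<Upsilon> *\<^sub>R (mat 1 :: real^'dx^'dx) = 0" using \<Upsilon>(2) by simp
    then have "(\<Upsilon> *\<^sub>R (mat 1 :: real^'dx^'dx)) $ i $ i = (0 :: real^'dx^'dx) $ i $ i" for i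
      by (simp only:)
    then show False using \<Upsilon>(1) by (simp add: mat_def)
  qed
qed

theorem corollary1:
  fixes M :: "'w measure"
    and X :: "'w \<Rightarrow> real^'dx" and Y :: "'w \<Rightarrow> real^'dy"
    and xs :: "nat \<Rightarrow> 'w \<Rightarrow> real^'dx" and ys :: "nat \<Rightarrow> 'w \<Rightarrow> real^'dy"
    and \<X> :: "(real^'dx) set" and \<Y> :: "(real^'dy) set" and \<Z> :: "(real^'dz) set"
    and F :: "real^'dz \<Rightarrow> real^'dy \<Rightarrow> real"
    and f :: "real^'dz \<Rightarrow> real^'dx \<Rightarrow> real"
    and \<nu> :: "real^'dz \<Rightarrow> real^'dz \<Rightarrow> real^'dx \<Rightarrow> real"
    and p :: "real^'dx \<Rightarrow> real" and V :: "real^'dx \<Rightarrow> (real^'dx) set"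
    and Menv :: "real^'dy \<Rightarrow> real"
    and K :: "real^'dx \<Rightarrow> real" and h :: "nat \<Rightarrow> real"
    and x0 :: "real^'dx" and zstar :: "real^'dz" and zhat :: "nat \<Rightarrow> 'w \<Rightarrow> real^'dz"
  assumes prob: "prob_space M"
    and X_cont: "continuous_rv_on M X \<X>"
    and Y_cont: "continuous_rv_on M Y \<Y>"
    and sample: "iid_sample M xs ys X Y"
    and F_meas: "(\<lambda>(z, y). F z y) \<in> borel_measurable borel"
    and f_cond: "\<And>z. z \<in> \<Z> \<Longrightarrow> cond_mean M X (\<lambda>\<omega>. F z (Y \<omega>)) (f z)"
    and \<nu>_cond: "\<And>z z'. z \<in> \<Z> \<Longrightarrow> z' \<in> \<Z> \<Longrightarrow>
          cond_mean M X (\<lambda>\<omega>. F z (Y \<omega>) * F z' (Y \<omega>)) (\<nu> z z')"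
    and x0: "x0 \<in> \<X>"
    and A1: "regular_cost \<Z> \<Y> F"
    and A2: "neighborhoods \<X> V" "smooth_cond_cost \<X> V \<Z> f" "smooth_density M X \<X> V p"
          "smooth_cond_product \<X> V \<Z> \<nu>"
    and A3: "envelope M X Y \<Y> \<Z> F (V x0) Menv"
    and A4: "regular_kernel K"
    and A5: "bandwidth CARD('dx) h"
    and A6: "unique_minimizer \<Z> (\<lambda>z. f z x0) zstar"
    and K4: "integrable lborel (\<lambda>u. K u ^ 4)"
    and F2_log: "\<And>z. z \<in> \<Z> \<Longrightarrow>
          integrable M (\<lambda>\<omega>. \<bar>(F z (Y \<omega>))\<^sup>2\<bar> * max (ln \<bar>(F z (Y \<omega>))\<^sup>2\<bar>) 0)"
    and zhat_meas: "\<And>n. zhat n \<in> borel_measurable M"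
    and zhat_min: "\<And>n. n \<ge> 1 \<Longrightarrow> AE \<omega> in M.
          (\<Sum>j=1..n. K ((1 / h n) *\<^sub>R (xs j \<omega> - x0))) \<noteq> 0 \<longrightarrow>
          unique_minimizer \<Z> (cost_hat K h xs ys F x0 n \<omega>) (zhat n \<omega>)"
    and nondegenerate: "\<nu> zstar zstar x0 - (f zstar x0)\<^sup>2 > 0"
    and tails: "tail_control K \<X> \<Z> p f x0"
  shows "weak_conv_m
     (\<lambda>n. distr M borel (\<lambda>\<omega>.
        (cost_hat K h xs ys F x0 n \<omega> (zhat n \<omega>) - f zstar x0) /
        sqrt (variance_hat K h xs ys F x0 n \<omega> (zhat n \<omega>) *
              (\<Sum>i=1..n. (nw_weight K h xs x0 n \<omega> i)\<^sup>2))))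
     std_normal_distribution"
proof -
  interpret prob_space M by (rule prob)
  have [measurable]: "X \<in> borel_measurable M" "\<X> \<in> sets borel" and X_in: "AE w in M. X w \<in> \<X>"
    using X_cont by (auto simp: continuous_rv_on_def)
  have [measurable]: "Y \<in> borel_measurable M" "\<Y> \<in> sets borel" and Y_in: "AE w in M. Y w \<in> \<Y>"
    using Y_cont by (auto simp: continuous_rv_on_def)
  have zstar_in: "zstar \<in> \<Z>" using A6 by (auto simp: unique_minimizer_def is_arg_min_def)
  have V: "open (V x0)" "x0 \<in> V x0" "V x0 \<subseteq> \<X>" using A2(1) x0 by (auto simp: neighborhoods_def)
  obtain r where r: "0 < r" "ball x0 r \<subseteq> V x0" using V(1,2) by (auto simp: open_contains_ball)
  have rX: "x \<in> \<X>" if "x \<in> ball x0 r" for x using that r(2) V(3) by auto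
  have p0: "\<And>x. 0 \<le> p x" and dens: "distributed M lborel X (\<lambda>x. ennreal (p x))" and p2: "C2_on p \<X>"
    using A2(3) by (auto simp: smooth_density_def)
  have p_pos: "0 < p x0" using A2(3) x0 by (auto simp: smooth_density_def intro: less_le_trans)
  obtain Cp where Cp: "0 < Cp" "\<And>x. x \<in> V x0 \<Longrightarrow> \<bar>p x\<bar> \<le> Cp \<and> norm (gradient p x) \<le> Cp \<and> spectral_norm (hessian p x) \<le> Cp"
    using A2(3) x0 unfolding smooth_density_def by blast
  have f2: "\<And>z. z \<in> \<Z> \<Longrightarrow> C2_on (f z) \<X>" using A2(2) by (auto simp: smooth_cond_cost_def)
  obtain Cf where Cf: "0 < Cf" "\<And>x z. x \<in> V x0 \<Longrightarrow> z \<in> \<Z> \<Longrightarrow>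
      \<bar>f z x\<bar> \<le> Cf \<and> norm (gradient (f z) x) \<le> Cf \<and> spectral_norm (hessian (f z) x) \<le> Cf"
    using A2(2) x0 unfolding smooth_cond_cost_def by blast
  obtain C where C: "0 < C" "\<And>y z z'. y \<in> \<Y> \<Longrightarrow> z \<in> \<Z> \<Longrightarrow> z' \<in> \<Z> \<Longrightarrow> \<bar>F z y - F z' y\<bar> \<le> C * dist z z'"
    using A1 unfolding regular_cost_def dist_norm by blast
  have Z: "compact \<Z>" using A1 by (simp add: regular_cost_def)
  note rates = bandwidth_rates[OF A5, simplified]
  note K = regular_kernelD[OF A4]
  interpret km: kernel_model M X Y xs ys p x0 h
  proof
    show "(\<lambda>w. (X w, Y w)) \<in> borel_measurable M" by (simp add: borel_prod[symmetric])
    show "indep_vars (\<lambda>_. borel) (\<lambda>i w. (xs i w, ys i w)) {1..}"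
      using sample by (simp add: iid_sample_def)
    show "distr M borel (\<lambda>w. (xs i w, ys i w)) = distr M borel (\<lambda>w. (X w, Y w))" if "1 \<le> i" for i
      using sample that by (simp add: iid_sample_def)
    show "isCont p x0" using p2 x0 by (intro differentiable_imp_continuous_within) (simp add: C2_on_def)
    show "0 < h n" if "1 \<le> n" for n using rates(1) that by simp
  qed (use p0 dens rates in auto)
  \<comment> \<open>The product splits into the Taylor error of \<open>f z\<close> times
    \<open>p\<close> and the linear term times the increment of \<open>p\<close>; each contributes
    one \<open>Cf * Cp\<close>. The constant does not depend on the decision.\<close>
  have quadratic: "\<bar>(f z x - f z x0) * p x - (p x0 *\<^sub>R gradient (f z) x0) \<bullet> (x - x0)\<bar> \<le> 2 * Cf * Cp * (dist x x0)\<^sup>2"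
    if z: "z \<in> \<Z>" and x: "x \<in> ball x0 r" for z x
  proof -
    let ?g = "gradient (f z) x0 \<bullet> (x - x0)"
    have 1: "\<bar>f z x - f z x0 - ?g\<bar> \<le> Cf * (dist x x0)\<^sup>2"
      using f2[OF z] Cf(2)[OF _ z] r(2) rX x by (intro taylor_quadratic) (auto simp: C2_on_def)
    have 2: "\<bar>p x - p x0\<bar> \<le> Cp * dist x x0"
      using p2 Cp(2) r(2) rX x by (intro lipschitz_of_gradient) (auto simp: C2_on_def)
    have "\<bar>?g\<bar> \<le> norm (gradient (f z) x0) * norm (x - x0)" by (rule Cauchy_Schwarz_ineq2)
    also have "\<dots> \<le> Cf * dist x x0" unfolding dist_norm using Cf(2)[OF V(2) z] by (intro mult_right_mono) auto
    finally have 3: "\<bar>?g\<bar> \<le> Cf * dist x x0" .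
    have 4: "\<bar>p x\<bar> \<le> Cp" using Cp(2) r(2) x by auto
    have "(f z x - f z x0) * p x - (p x0 *\<^sub>R gradient (f z) x0) \<bullet> (x - x0) =
        (f z x - f z x0 - ?g) * p x + ?g * (p x - p x0)" by (simp add: algebra_simps)
    also have "\<bar>\<dots>\<bar> \<le> \<bar>f z x - f z x0 - ?g\<bar> * \<bar>p x\<bar> + \<bar>?g\<bar> * \<bar>p x - p x0\<bar>"
      by (metis abs_mult abs_triangle_ineq)
    also have "\<dots> \<le> Cf * (dist x x0)\<^sup>2 * Cp + Cf * dist x x0 * (Cp * dist x x0)"
      using 1 2 3 4 Cf(1) Cp(1) by (intro add_mono mult_mono) auto
    also have "\<dots> = 2 * Cf * Cp * (dist x x0)\<^sup>2" by (simp add: power2_eq_square algebra_simps)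
    finally show ?thesis .
  qed
  define m2 where "m2 = (LINT u|lborel. K u * (norm u)\<^sup>2)"
  \<comment> \<open>Both alternatives of \<open>tail_control\<close> yield a constant that is
    uniform in the decision, as the bound \<open>b\<close> requires.\<close>
  obtain D where far: "\<And>n z. 1 \<le> n \<Longrightarrow> z \<in> \<Z> \<Longrightarrow>
      \<bar>expectation (\<lambda>w. km.kn K n (X w) * ((F z (Y w) - f z x0) * indicator {x. r \<le> dist x x0} (X w)))\<bar> \<le>
      D * h n ^ (CARD('dx) + 2)"
    using tails unfolding tail_control_def
  proof (elim disjE exE)
    fix B assume B: "\<forall>z\<in>\<Z>. \<forall>x\<in>\<X>. \<bar>f z x - f z x0\<bar> * p x \<le> B"
    have "\<bar>f zstar x0 - f zstar x0\<bar> * p x0 \<le> B" using B zstar_in x0 by blast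
    then have B0: "0 \<le> B" by simp
    show thesis
    proof (rule that[of "B / r\<^sup>2 * m2"])
      fix n :: nat and z assume n: "1 \<le> n" and z: "z \<in> \<Z>"
      show "\<bar>expectation (\<lambda>w. km.kn K n (X w) * ((F z (Y w) - f z x0) * indicator {x. r \<le> dist x x0} (X w)))\<bar> \<le>
          B / r\<^sup>2 * m2 * h n ^ (CARD('dx) + 2)"
        unfolding m2_def using B z
        by (intro km.far_bias_density[OF K(1) K(4) f_cond[OF z] _ X_in r(1) _ B0 n]) auto
    qed
  next
    fix B assume B: "\<forall>u. norm u ^ (CARD('dx) + 2) * K u \<le> B"
    have "norm (0 :: real^'dx) ^ (CARD('dx) + 2) * K 0 \<le> B" using B by blast
    then have B0: "0 \<le> B" by simp
    \<comment> \<open>Boundedness of \<open>\<Z>\<close> and the Lipschitz condition reduce the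
      first moments of all decisions to that of \<open>zstar\<close>.\<close>
    obtain R where R: "\<And>z. z \<in> \<Z> \<Longrightarrow> dist z zstar \<le> R"
      using compact_imp_bounded[OF Z] by (metis bounded_any_center dist_commute)
    have iF: "integrable M (\<lambda>w. F z (Y w))" if "z \<in> \<Z>" for z
      using f_cond[OF that] by (simp add: cond_mean_def)
    let ?E = "expectation (\<lambda>w. \<bar>F zstar (Y w)\<bar> + (C * R + Cf))"
    have E: "expectation (\<lambda>w. \<bar>F z (Y w) - f z x0\<bar>) \<le> ?E" if z: "z \<in> \<Z>" for z
    proof (rule integral_mono_AE)
      show "AE w in M. \<bar>F z (Y w) - f z x0\<bar> \<le> \<bar>F zstar (Y w)\<bar> + (C * R + Cf)"
        using Y_in
      proof eventually_elim
        case (elim w)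
        have "\<bar>F z (Y w) - F zstar (Y w)\<bar> \<le> C * dist z zstar" by (rule C(2)[OF elim z zstar_in])
        also have "\<dots> \<le> C * R" using R[OF z] C(1) by simp
        finally show ?case using Cf(2)[OF V(2) z] by linarith
      qed
    qed (use iF z zstar_in in auto)
    show thesis
    proof (rule that[of "B / r ^ (CARD('dx) + 2) * ?E"])
      fix n :: nat and z assume n: "1 \<le> n" and z: "z \<in> \<Z>"
      have "integrable M (\<lambda>w. F z (Y w) - f z x0)" using iF[OF z] by simp
      from km.far_bias_kernel[OF K(1) B[rule_format] B0 this r(1) n]
      have "\<bar>expectation (\<lambda>w. km.kn K n (X w) * ((F z (Y w) - f z x0) * indicator {x. r \<le> dist x x0} (X w)))\<bar> \<le>
          B / r ^ (CARD('dx) + 2) * expectation (\<lambda>w. \<bar>F z (Y w) - f z x0\<bar>) * h n ^ (CARD('dx) + 2)" .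
      also have "\<dots> \<le> B / r ^ (CARD('dx) + 2) * ?E * h n ^ (CARD('dx) + 2)"
        using E[OF z] B0 r(1) km.h_pos[OF n] by (intro mult_right_mono mult_left_mono) auto
      finally show "\<bar>expectation (\<lambda>w. km.kn K n (X w) * ((F z (Y w) - f z x0) * indicator {x. r \<le> dist x x0} (X w)))\<bar> \<le>
          B / r ^ (CARD('dx) + 2) * ?E * h n ^ (CARD('dx) + 2)" .
    qed
  qed
  define b where "b n = (2 * Cf * Cp * m2 + D) * (sqrt (real n * h n ^ CARD('dx)) * (h n)\<^sup>2)" for n
  have b_lim: "b \<longlonglongrightarrow> 0"
    unfolding b_def[abs_def] using tendsto_mult[OF tendsto_const rates(4)] by simp
  have bias: "\<bar>sqrt (real n * h n ^ CARD('dx)) * km.kmean K n (\<lambda>w. F z (Y w) - f z x0)\<bar> \<le> b n"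
    if n: "1 \<le> n" and z: "z \<in> \<Z>" for n z
  proof -
    have "\<bar>km.kmean K n (\<lambda>w. F z (Y w) - f z x0)\<bar> \<le> (2 * Cf * Cp * m2 + D) * (h n)\<^sup>2"
      unfolding m2_def using Cf(1) Cp(1)
      by (intro km.bias_bound[OF K(1) K(3) K(4) f_cond[OF z] r(1) _ quadratic[OF z] n far[OF n z]]) auto
    then have "sqrt (real n * h n ^ CARD('dx)) * \<bar>km.kmean K n (\<lambda>w. F z (Y w) - f z x0)\<bar> \<le>
        sqrt (real n * h n ^ CARD('dx)) * ((2 * Cf * Cp * m2 + D) * (h n)\<^sup>2)"
      using km.nhd_pos[OF n] by (intro mult_left_mono) auto
    then show ?thesis using km.nhd_pos[OF n] by (simp only: abs_mult b_def) (simp add: mult_ac)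
  qed
  have [measurable]: "Menv \<in> borel_measurable borel" using A3 by (simp add: envelope_def)
  have Menv0: "AE w in M. 0 \<le> Menv (Y w)"
    using Y_in A3 by (auto simp: envelope_def elim!: eventually_mono)
  have "AE y in distr M borel Y. y \<in> \<Y> \<longrightarrow> (\<forall>z\<in>\<Z>. \<bar>F z y\<bar> \<le> Menv y)"
    using A3 by (simp add: envelope_def)
  then have "AE w in M. Y w \<in> \<Y> \<longrightarrow> (\<forall>z\<in>\<Z>. \<bar>F z (Y w)\<bar> \<le> Menv (Y w))"
    by (rule AE_distrD[rotated]) simp
  with Y_in have F_env: "AE w in M. \<forall>z\<in>\<Z>. \<bar>F z (Y w)\<bar> \<le> Menv (Y w)" by eventually_elim simp
  obtain \<gamma> Cm where \<gamma>: "0 < \<gamma>" and Cm: "0 < Cm" and mom: "AE w in M. X w \<in> V x0 \<longrightarrow>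
      nn_cond_exp M (sigma_gen M X) (\<lambda>w. ennreal (Menv (Y w) powr (2 + \<gamma>))) w \<le> ennreal Cm"
    using A3 unfolding envelope_def by blast
  have mom': "AE w in M. X w \<in> ball x0 r \<longrightarrow>
      nn_cond_exp M (sigma_gen M X) (\<lambda>w. ennreal (Menv (Y w) powr (2 + \<gamma>))) w \<le> ennreal Cm"
    using mom by eventually_elim (use r(2) in auto)
  have F1_meas: "F z \<in> borel_measurable borel" for z
    using measurable_compose[OF borel_measurable_continuous_onI[of "\<lambda>y. (z, y)"] F_meas]
    by (simp add: continuous_intros)
  have F_Y [measurable]: "(\<lambda>w. F z (Y w)) \<in> borel_measurable M" for z
    by (rule measurable_compose[OF _ F1_meas]) simp
  note ui = km.locally_ui_envelope[OF r(1) \<gamma> less_imp_le[OF Cm] _ _ _ Menv0 mom']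
  interpret nw_minimization M X Y xs ys p x0 h K F f \<Z> \<Y> C "\<nu> zstar zstar" b zstar zhat
  proof
    show "isCont (f z) x0" if "z \<in> \<Z>" for z
      using f2[OF that] x0 by (intro differentiable_imp_continuous_within) (simp add: C2_on_def)
    show "cond_mean M X (\<lambda>w. (F zstar (Y w))\<^sup>2) (\<nu> zstar zstar)"
      using \<nu>_cond[OF zstar_in zstar_in] by (simp add: power2_eq_square)
    show "isCont (\<nu> zstar zstar) x0"
      using A2(4) zstar_in x0 by (intro differentiable_imp_continuous_within) (simp add: smooth_cond_product_def C1_on_def)
    show "km.locally_ui (\<lambda>w. F z (Y w))" if z: "z \<in> \<Z>" for z
    proof (rule ui[of 1])
      show "AE w in M. \<bar>F z (Y w)\<bar> \<le> 1 * (1 + (Menv (Y w))\<^sup>2)"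
        using F_env
      proof eventually_elim
        case (elim w)
        have "0 \<le> (Menv (Y w) - 1)\<^sup>2 + (Menv (Y w))\<^sup>2 + 1" by simp
        then have "Menv (Y w) \<le> 1 + (Menv (Y w))\<^sup>2" by (simp add: power2_diff)
        moreover have "\<bar>F z (Y w)\<bar> \<le> Menv (Y w)" using elim z by blast
        ultimately show ?case unfolding mult_1 by linarith
      qed
    qed auto
    show "km.locally_ui (\<lambda>w. (F zstar (Y w) - c)\<^sup>2)" for c
    proof (rule ui[of "2 + 2 * c\<^sup>2"])
      show "AE w in M. \<bar>(F zstar (Y w) - c)\<^sup>2\<bar> \<le> (2 + 2 * c\<^sup>2) * (1 + (Menv (Y w))\<^sup>2)"
        using F_env
      proof eventually_elim
        case (elim w)
        let ?F = "F zstar (Y w)"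
        have "\<bar>?F\<bar> \<le> Menv (Y w)" using elim zstar_in by blast
        then have F2: "?F\<^sup>2 \<le> (Menv (Y w))\<^sup>2" using power_mono[of "\<bar>?F\<bar>" "Menv (Y w)" 2] by simp
        \<comment> \<open>Expanding this square yields
          \<open>(F - c)^2 \<le> 2 * F^2 + 2 * c^2\<close>; the factor \<open>2 + 2 * c^2\<close>
          then dominates both terms.\<close>
        have "0 \<le> (?F + c)\<^sup>2" by simp
        then have "(?F - c)\<^sup>2 \<le> 2 * ?F\<^sup>2 + 2 * c\<^sup>2" by (simp add: power2_diff power2_sum)
        also have "\<dots> \<le> 2 * (Menv (Y w))\<^sup>2 + 2 * c\<^sup>2 + (2 + 2 * (c\<^sup>2 * (Menv (Y w))\<^sup>2))"
          using F2 by (intro add_increasing2[of "2 + 2 * (c\<^sup>2 * (Menv (Y w))\<^sup>2)"] add_nonneg_nonneg) auto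
        also have "\<dots> = (2 + 2 * c\<^sup>2) * (1 + (Menv (Y w))\<^sup>2)" by (simp add: algebra_simps)
        finally show ?case by simp
      qed
      show "0 < 2 + 2 * c\<^sup>2" by (simp add: add_pos_nonneg)
    qed auto
  qed (use K p_pos F_meas Z C Y_in f_cond b_lim bias A6 zhat_meas zhat_min nondegenerate in auto)
  show ?thesis by (rule studentized_weak_conv)
qed

end
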